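(* Let $n\geq1$ and $A,C\in\mathbb{R}^{n\times n}$. Define linear operators on $\mathbb{S}^n$ by $\mathcal{L}_{(-A,C)}(M)=-MA-A^\top M+C^\top MC$ and $\mathcal{L}^*_{(-A,C)}(M)=-AM-MA^\top+CMC^\top$. The following statements are equivalent: (i) The system $dX(t)=[AX(t)+Cz(t)]\,dt+z(t)\,dW(t)$, $t\ge0$, $X(0)=x$, with control $z$, is stabilizable. (ii) There exists a positive definite $P\in\mathbb{S}^n$ such that $\mathcal{L}^*_{(-A,C)}(P)>0$. (iii) If $S\in\bar{\mathbb{S}}^n_+$ and $\mathcal{L}_{(-A,C)}(S)\leq0$, then $S=0$. (iv) If $H\in\bar{\mathbb{S}}^n_+\setminus\{0\}$ and $\mathcal{L}_{(-A,C)}(H)=\lambda H$ for some $\lambda\in\mathbb{R}$, then $\lambda>0$.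
   Context: $\mathbb{S}^n$ is the space of real symmetric $n\times n$ matrices, and $\bar{\mathbb{S}}^n_+$ is the set of positive semidefinite matrices in $\mathbb{S}^n$. For $M,N\in\mathbb{S}^n$, $M\geq N$ (resp. $M>N$) means that $M-N$ is positive semidefinite (resp. positive definite). $W$ is a standard one-dimensional Brownian motion. The system in (i) is stabilizable if there exists $K\in\mathbb{R}^{n\times n}$ such that the closed-loop system obtained from $z=KX$, namely $dX(t)=(A+CK)X(t)\,dt+KX(t)\,dW(t)$, $X(0)=x$, is $L^2$-stable, i.e. its solution satisfies $\mathbb{E}\int_0^\infty|X(t;x)|^2dt<\infty$ for all $x\in\mathbb{R}^n$. (For such linear systems $L^2$-stability is equivalent to exponential mean-square stability and to asymptotic mean-square stability, $\lim_{t\to\infty}\mathbb{E}|X(t;x)|^2=0$ for all $x$.) *)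

theory Defs
  imports "HOL-Probability.Probability"
begin

section \<open>Symmetric matrices\<close>

definition pos_semidef :: "real^'n^'n \<Rightarrow> bool" where
  "pos_semidef M \<longleftrightarrow> transpose M = M \<and> (\<forall>v. 0 \<le> v \<bullet> (M *v v))"

definition pos_def :: "real^'n^'n \<Rightarrow> bool" where
  "pos_def M \<longleftrightarrow> transpose M = M \<and> (\<forall>v. v \<noteq> 0 \<longrightarrow> 0 < v \<bullet> (M *v v))"

definition loewner_le :: "real^'n^'n \<Rightarrow> real^'n^'n \<Rightarrow> bool" where
  "loewner_le N M \<longleftrightarrow> pos_semidef (M - N)"

definition loewner_less :: "real^'n^'n \<Rightarrow> real^'n^'n \<Rightarrow> bool" where
  "loewner_less N M \<longleftrightarrow> pos_def (M - N)"

text \<open>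
  The operators with index \<open>(-A, C)\<close>. They are written on all square matrices, map symmetric
  matrices to symmetric matrices, and are only ever applied to symmetric ones.
\<close>

definition lyap_op :: "real^'n^'n \<Rightarrow> real^'n^'n \<Rightarrow> real^'n^'n \<Rightarrow> real^'n^'n" where
  "lyap_op A C M = - (M ** A) - transpose A ** M + transpose C ** M ** C"

definition lyap_adj_op :: "real^'n^'n \<Rightarrow> real^'n^'n \<Rightarrow> real^'n^'n \<Rightarrow> real^'n^'n" where
  "lyap_adj_op A C M = - (A ** M) - M ** transpose A + C ** M ** transpose C"

section \<open>Brownian motion\<close>

text \<open>
  Time is \<open>[0, \<infinity>)\<close>, encoded in \<^typ>\<open>real\<close>; the values of filtrations and processes at negative
  times play no role.
\<close>

definition filtration_on :: "'a measure \<Rightarrow> (real \<Rightarrow> 'a measure) \<Rightarrow> bool" where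
  "filtration_on M F \<longleftrightarrow>
     (\<forall>t\<ge>0. subalgebra M (F t)) \<and> (\<forall>s t. 0 \<le> s \<and> s \<le> t \<longrightarrow> sets (F s) \<subseteq> sets (F t))"

definition std_brownian_motion ::
    "'a measure \<Rightarrow> (real \<Rightarrow> 'a measure) \<Rightarrow> (real \<Rightarrow> 'a \<Rightarrow> real) \<Rightarrow> bool" where
  "std_brownian_motion M F W \<longleftrightarrow>
     prob_space M \<and> filtration_on M F \<and>
     (\<forall>t\<ge>0. W t \<in> borel_measurable (F t)) \<and>
     (AE \<omega> in M. W 0 \<omega> = 0) \<and>
     (\<forall>s t. 0 \<le> s \<and> s < t \<longrightarrow>
        distributed M lborel (\<lambda>\<omega>. W t \<omega> - W s \<omega>) (normal_density 0 (sqrt (t - s)))) \<and>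
     (\<forall>s t. 0 \<le> s \<and> s < t \<longrightarrow>
        prob_space.indep_set M (sets (F s))
          (sets (vimage_algebra (space M) (\<lambda>\<omega>. W t \<omega> - W s \<omega>) borel))) \<and>
     (AE \<omega> in M. continuous_on {0..} (\<lambda>t. W t \<omega>))"

section \<open>The Ito integral\<close>

definition prog_measurable ::
    "(real \<Rightarrow> 'a measure) \<Rightarrow> (real \<Rightarrow> 'a \<Rightarrow> 'b::topological_space) \<Rightarrow> bool" where
  "prog_measurable F Y \<longleftrightarrow>
     (\<forall>t\<ge>0. case_prod Y \<in> borel_measurable (restrict_space borel {0..t} \<Otimes>\<^sub>M F t))"

text \<open>
  The simple process given by \<open>k\<close>, \<open>u\<close>, \<open>\<xi>\<close> takes the value \<open>\<xi> i\<close> on \<open>(u i, u (i + 1)]\<close> for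
  \<open>i < k\<close>, and \<open>0\<close> elsewhere.
\<close>

definition simple_on ::
    "(real \<Rightarrow> 'a measure) \<Rightarrow> real \<Rightarrow> nat \<Rightarrow> (nat \<Rightarrow> real) \<Rightarrow> (nat \<Rightarrow> 'a \<Rightarrow> 'b::euclidean_space) \<Rightarrow> bool"
  where
  "simple_on F T k u \<xi> \<longleftrightarrow>
     0 \<le> u 0 \<and> (\<forall>i<k. u i \<le> u (Suc i)) \<and> u k \<le> T \<and>
     (\<forall>i<k. \<xi> i \<in> borel_measurable (F (u i)) \<and>
       (\<exists>B. \<forall>\<omega>\<in>space (F (u i)). norm (\<xi> i \<omega>) \<le> B))"

definition simple_val ::
    "nat \<Rightarrow> (nat \<Rightarrow> real) \<Rightarrow> (nat \<Rightarrow> 'a \<Rightarrow> 'b::euclidean_space) \<Rightarrow> real \<Rightarrow> 'a \<Rightarrow> 'b" where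
  "simple_val k u \<xi> s \<omega> = (\<Sum>i<k. indicator {u i<..u (Suc i)} s *\<^sub>R \<xi> i \<omega>)"

definition simple_ito ::
    "(real \<Rightarrow> 'a \<Rightarrow> real) \<Rightarrow> nat \<Rightarrow> (nat \<Rightarrow> real) \<Rightarrow> (nat \<Rightarrow> 'a \<Rightarrow> 'b::euclidean_space) \<Rightarrow> 'a \<Rightarrow> 'b" where
  "simple_ito W k u \<xi> \<omega> = (\<Sum>i<k. (W (u (Suc i)) \<omega> - W (u i) \<omega>) *\<^sub>R \<xi> i \<omega>)"

text \<open>
  The integral over \<open>[0, T]\<close> of a progressively measurable square integrable integrand, as the
  \<open>L\<^sup>2\<close> limit of the integrals of simple processes approximating it in \<open>L\<^sup>2([0, T] \<times> \<Omega>)\<close>. By the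
  Ito isometry the value is unique up to null sets, hence the relational form.
\<close>

definition has_ito_integral ::
    "'a measure \<Rightarrow> (real \<Rightarrow> 'a measure) \<Rightarrow> (real \<Rightarrow> 'a \<Rightarrow> real) \<Rightarrow> real \<Rightarrow>
     (real \<Rightarrow> 'a \<Rightarrow> 'b::euclidean_space) \<Rightarrow> ('a \<Rightarrow> 'b) \<Rightarrow> bool" where
  "has_ito_integral M F W T Y I \<longleftrightarrow>
     prog_measurable F Y \<and> I \<in> borel_measurable M \<and>
     (\<exists>k u \<xi>.
        (\<forall>m. simple_on F T (k m) (u m) (\<xi> m)) \<and>
        (\<lambda>m. \<integral>\<^sup>+\<omega>. (\<integral>\<^sup>+s\<in>{0..T}.
            ennreal ((norm (Y s \<omega> - simple_val (k m) (u m) (\<xi> m) s \<omega>))\<^sup>2) \<partial>lborel) \<partial>M) \<longlonglongrightarrow> 0 \<and>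
        (\<lambda>m. \<integral>\<^sup>+\<omega>. ennreal ((norm (I \<omega> - simple_ito W (k m) (u m) (\<xi> m) \<omega>))\<^sup>2) \<partial>M) \<longlonglongrightarrow> 0)"

section \<open>The controlled system and stabilizability\<close>

definition locally_square_integrable ::
    "'a measure \<Rightarrow> (real \<Rightarrow> 'a \<Rightarrow> 'b::euclidean_space) \<Rightarrow> bool" where
  "locally_square_integrable M Y \<longleftrightarrow>
     (\<forall>T\<ge>0. (\<integral>\<^sup>+\<omega>. (\<integral>\<^sup>+s\<in>{0..T}. ennreal ((norm (Y s \<omega>))\<^sup>2) \<partial>lborel) \<partial>M) < \<infinity>)"

text \<open>
  \<open>X\<close> is a strong solution of \<open>dX = (A X + C z) dt + z dW\<close>, \<open>X(0) = x\<close>, for the control \<open>z\<close>.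
\<close>

definition controlled_solution ::
    "'a measure \<Rightarrow> (real \<Rightarrow> 'a measure) \<Rightarrow> (real \<Rightarrow> 'a \<Rightarrow> real) \<Rightarrow> real^'n^'n \<Rightarrow> real^'n^'n \<Rightarrow>
     real^'n \<Rightarrow> (real \<Rightarrow> 'a \<Rightarrow> real^'n) \<Rightarrow> (real \<Rightarrow> 'a \<Rightarrow> real^'n) \<Rightarrow> bool" where
  "controlled_solution M F W A C x z X \<longleftrightarrow>
     prog_measurable F z \<and> locally_square_integrable M z \<and>
     prog_measurable F X \<and> locally_square_integrable M X \<and>
     (AE \<omega> in M. continuous_on {0..} (\<lambda>t. X t \<omega>)) \<and>
     (\<forall>t\<ge>0. \<exists>I. has_ito_integral M F W t z I \<and>
        (AE \<omega> in M. X t \<omega> = x + (LINT s:{0..t}|lborel. A *v X s \<omega> + C *v z s \<omega>) + I \<omega>))"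

text \<open>
  Inserting \<open>z = K X\<close> gives the closed-loop system \<open>dX = (A + C K) X dt + K X dW\<close>.
\<close>

definition closed_loop_solution ::
    "'a measure \<Rightarrow> (real \<Rightarrow> 'a measure) \<Rightarrow> (real \<Rightarrow> 'a \<Rightarrow> real) \<Rightarrow> real^'n^'n \<Rightarrow> real^'n^'n \<Rightarrow>
     real^'n^'n \<Rightarrow> real^'n \<Rightarrow> (real \<Rightarrow> 'a \<Rightarrow> real^'n) \<Rightarrow> bool" where
  "closed_loop_solution M F W A C K x X \<longleftrightarrow>
     controlled_solution M F W A C x (\<lambda>t \<omega>. K *v X t \<omega>) X"

text \<open>
  Solutions are unique only up to indistinguishability, so ``the solution is square integrable''
  is rendered as: a solution exists, and every solution is square integrable.
\<close>

definition L2_stable_closed_loop ::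
    "'a measure \<Rightarrow> (real \<Rightarrow> 'a measure) \<Rightarrow> (real \<Rightarrow> 'a \<Rightarrow> real) \<Rightarrow> real^'n^'n \<Rightarrow> real^'n^'n \<Rightarrow>
     real^'n^'n \<Rightarrow> bool" where
  "L2_stable_closed_loop M F W A C K \<longleftrightarrow>
     (\<forall>x. (\<exists>X. closed_loop_solution M F W A C K x X) \<and>
          (\<forall>X. closed_loop_solution M F W A C K x X \<longrightarrow>
             (\<integral>\<^sup>+\<omega>. (\<integral>\<^sup>+s\<in>{0..}. ennreal ((norm (X s \<omega>))\<^sup>2) \<partial>lborel) \<partial>M) < \<infinity>))"

definition stabilizable ::
    "'a measure \<Rightarrow> (real \<Rightarrow> 'a measure) \<Rightarrow> (real \<Rightarrow> 'a \<Rightarrow> real) \<Rightarrow> real^'n^'n \<Rightarrow> real^'n^'n \<Rightarrow> bool" where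
  "stabilizable M F W A C \<longleftrightarrow> (\<exists>K. L2_stable_closed_loop M F W A C K)"

end

theory Submission
  imports Defs
begin

text \<open>
  The noise enters stability only through second moments. For a solution \<open>X\<close> of the closed-loop system with
  feedback \<open>K\<close> and a symmetric \<open>S\<close>, the mean \<open>E \<langle>X t, S (X t)\<rangle>\<close> grows at rate \<open>E \<langle>X t, R (X t)\<rangle>\<close>,
  where \<open>R = S (A + C K) + (A + C K)\<^sup>T S + K\<^sup>T S K\<close>; this matrix is \<open>lyap_op (- (A + C K)) K S\<close>
  (\<open>closed_loop_second_moment\<close>). So \<open>K\<close> stabilizes as soon as some \<open>S > 0\<close> has \<open>R < 0\<close>
  (\<open>sq_integrable_if_lyap\<close>). Conversely, the second moments of the solutions, integrated over a long time
  interval, satisfy the adjoint inequality (\<open>lyap_if_stable\<close>), and a maximum principle together with a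
  separation argument turns it back into an inequality for an \<open>S\<close> (\<open>lyap_dual\<close>).

  For fixed \<open>S\<close>, the matrix \<open>R\<close> is quadratic in \<open>K\<close> and minimal for \<open>K = - S\<^sup>-\<^sup>1 C\<^sup>T S\<close>. With
  \<open>P = S\<^sup>-\<^sup>1\<close> the minimum is \<open>- S (lyap_adj_op A C P) S\<close> (\<open>closed_loop_lyap_form\<close>). Hence a stabilizing feedback
  exists if and only if \<open>lyap_adj_op A C P > 0\<close> for some \<open>P > 0\<close>, which is the equivalence of (i) and (ii).

  Statements (ii) and (iii) are alternatives in the sense of convex duality: if no \<open>P\<close> as in (ii) exists, a
  hyperplane separates the image of the positive definite cone from that cone, and its normal violates
  (iii) (\<open>pos_def_separation\<close>). Statement (iv) is the special case of (iii) for eigenvectors. For the converse,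
  \<open>lyap_op A C\<close> generates a positivity preserving flow; if \<open>lyap_op A C S \<le> 0\<close>, this flow leaves the face
  of the positive semidefinite cone generated by \<open>S\<close> invariant, and a Perron-Frobenius argument in this face
  yields an eigenvector with nonpositive eigenvalue (\<open>lyap_nonpos_eigenvalue\<close>).

  Stabilizability includes that the closed-loop equation is solvable. A solution is obtained as the limit
  of Euler schemes on dyadic grids. A one-step recursion gives mean square errors of order \<open>1 / 2 ^ n\<close>
  (\<open>euler_error\<close>), and a maximal inequality with the Borel-Cantelli lemma makes the convergence locally
  uniform along almost every path, so that the limit is continuous (\<open>AE_sol\<close>). The mean square
  estimates also identify its noise part as an Ito integral (\<open>sol_has_ito_integral\<close>).
\<close>

section \<open>The Lyapunov operators as quadratic forms\<close>

text \<open>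
  Matrices are compared through their bilinear forms. Products and transposes then become arguments
  of one form, and identities between operators become linear identities between real numbers.
\<close>
lemma matrix_eq_iff_form:
  fixes M N :: "real^'n^'n"
  shows "M = N \<longleftrightarrow> (\<forall>v w. v \<bullet> (M *v w) = v \<bullet> (N *v w))"
proof
  assume "\<forall>v w. v \<bullet> (M *v w) = v \<bullet> (N *v w)"
  then have "M *v w = N *v w" for w by (metis vector_eq_ldot)
  then show "M = N" by (simp add: matrix_eq)
qed simp

lemma form_transpose: "v \<bullet> (transpose M *v w) = w \<bullet> ((M::real^'n^'m) *v v)"
  by (metis dot_lmul_matrix inner_commute transpose_matrix_vector)

lemma transpose_form: "(transpose M *v v) \<bullet> w = v \<bullet> ((M::real^'n^'m) *v w)"
  by (metis dot_lmul_matrix transpose_matrix_vector)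

lemma form_commute:
  fixes M :: "real^'n^'n"
  assumes "transpose M = M"
  shows "v \<bullet> (M *v w) = w \<bullet> (M *v v)"
  using form_transpose[of v M w] assms by simp

lemma symmetric_iff_form:
  fixes M :: "real^'n^'n"
  shows "transpose M = M \<longleftrightarrow> (\<forall>v w. v \<bullet> (M *v w) = w \<bullet> (M *v v))"
  unfolding matrix_eq_iff_form form_transpose by metis

lemmas form_simps = matrix_vector_mult_add_rdistrib matrix_vector_mult_diff_rdistrib
  scaleR_matrix_vector_assoc[symmetric] matrix_vector_right_distrib
  matrix_vector_mult_diff_distrib matrix_vector_mult_scaleR inner_add_left inner_add_right
  inner_diff_left inner_diff_right matrix_vector_mul_assoc[symmetric]

lemma minus_matrix_vector [simp]: "(- M) *v v = - ((M::real^'n^'m) *v v)"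
  by (metis add.inverse_unique add.right_inverse matrix_vector_mult_0 matrix_vector_mult_add_rdistrib)

lemma lyap_op_form:
  "v \<bullet> (lyap_op A C M *v w) = - (v \<bullet> (M *v (A *v w))) - (A *v v) \<bullet> (M *v w) + (C *v v) \<bullet> (M *v (C *v w))"
  unfolding lyap_op_def
  by (simp add: form_simps form_transpose inner_commute del: transpose_matrix_vector)

lemma lyap_adj_op_form:
  "v \<bullet> (lyap_adj_op A C P *v w) = - ((transpose A *v v) \<bullet> (P *v w)) - v \<bullet> (P *v (transpose A *v w))
     + (transpose C *v v) \<bullet> (P *v (transpose C *v w))"
  unfolding lyap_adj_op_def
  by (simp add: form_simps transpose_form del: transpose_matrix_vector)

lemma inner_matrix_mult_left:
  fixes A P S :: "real^'n^'n"
  shows "(A ** P) \<bullet> S = P \<bullet> (transpose A ** S)"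
proof -
  have "(A ** P) \<bullet> S = (\<Sum>i\<in>UNIV. \<Sum>j\<in>UNIV. \<Sum>k\<in>UNIV. A$i$k * P$k$j * S$i$j)"
    by (simp add: inner_vec_def matrix_matrix_mult_def sum_distrib_right)
  also have "\<dots> = (\<Sum>i\<in>UNIV. \<Sum>k\<in>UNIV. \<Sum>j\<in>UNIV. A$i$k * P$k$j * S$i$j)"
    by (rule sum.cong[OF refl], rule sum.swap)
  also have "\<dots> = (\<Sum>k\<in>UNIV. \<Sum>i\<in>UNIV. \<Sum>j\<in>UNIV. A$i$k * P$k$j * S$i$j)"
    by (rule sum.swap)
  also have "\<dots> = (\<Sum>k\<in>UNIV. \<Sum>j\<in>UNIV. \<Sum>i\<in>UNIV. A$i$k * P$k$j * S$i$j)"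
    by (rule sum.cong[OF refl], rule sum.swap)
  also have "\<dots> = P \<bullet> (transpose A ** S)"
    by (simp add: inner_vec_def matrix_matrix_mult_def sum_distrib_left transpose_def ac_simps)
  finally show ?thesis .
qed

lemma inner_transpose_transpose:
  fixes M N :: "real^'n^'n"
  shows "transpose M \<bullet> transpose N = M \<bullet> N"
  by (simp add: inner_vec_def transpose_def) (rule sum.swap)

lemma inner_matrix_mult_right:
  fixes A P S :: "real^'n^'n"
  shows "(P ** A) \<bullet> S = P \<bullet> (S ** transpose A)"
  using inner_matrix_mult_left[of "transpose A" "transpose P" "transpose S"]
  by (metis inner_transpose_transpose matrix_transpose_mul transpose_transpose)

text \<open>
  The trace pairing of symmetric matrices is the inner product on matrices. All passages between
  conditions on \<open>P\<close> and conditions on \<open>S\<close> rest on this duality.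
\<close>
lemma lyap_adjoint: "lyap_adj_op A C P \<bullet> S = P \<bullet> lyap_op A C S"
proof -
  have "(C ** P ** transpose C) \<bullet> S = P \<bullet> (transpose C ** S ** C)"
    using inner_matrix_mult_right[of "C ** P" "transpose C" S] inner_matrix_mult_left[of C P "S ** C"]
    by (simp add: matrix_mul_assoc)
  moreover have "(P ** transpose A) \<bullet> S = P \<bullet> (S ** A)"
    using inner_matrix_mult_right[of P "transpose A" S] by simp
  ultimately show ?thesis
    unfolding lyap_op_def lyap_adj_op_def
    by (simp add: inner_add_left inner_add_right inner_diff_left inner_diff_right
        inner_matrix_mult_left[of A P S])
qed

lemma linear_lyap_op: "linear (lyap_op A C)"
  by (rule linearI)
     (simp_all add: matrix_eq_iff_form lyap_op_form form_simps algebra_simps)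

lemma linear_lyap_adj_op: "linear (lyap_adj_op A C)"
  by (rule linearI)
     (simp_all add: matrix_eq_iff_form lyap_adj_op_form form_simps algebra_simps del: transpose_matrix_vector)

lemma lyap_op_symmetric:
  assumes "transpose M = M" shows "transpose (lyap_op A C M) = lyap_op A C M"
  unfolding symmetric_iff_form lyap_op_form
proof (intro allI)
  fix v w
  have "v \<bullet> (M *v (A *v w)) = (A *v w) \<bullet> (M *v v)"
    "w \<bullet> (M *v (A *v v)) = (A *v v) \<bullet> (M *v w)"
    "(C *v v) \<bullet> (M *v (C *v w)) = (C *v w) \<bullet> (M *v (C *v v))"
    by (rule form_commute[OF assms])+
  then show "- (v \<bullet> (M *v (A *v w))) - (A *v v) \<bullet> (M *v w) + (C *v v) \<bullet> (M *v (C *v w)) = - (w \<bullet> (M *v (A *v v))) - (A *v w) \<bullet> (M *v v) + (C *v w) \<bullet> (M *v (C *v v))" by linarith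
qed

lemma lyap_adj_op_symmetric:
  assumes "transpose M = M" shows "transpose (lyap_adj_op A C M) = lyap_adj_op A C M"
  unfolding symmetric_iff_form lyap_adj_op_form
proof (intro allI)
  fix v w
  have "v \<bullet> (M *v (transpose A *v w)) = (transpose A *v w) \<bullet> (M *v v)"
    "w \<bullet> (M *v (transpose A *v v)) = (transpose A *v v) \<bullet> (M *v w)"
    "(transpose C *v v) \<bullet> (M *v (transpose C *v w)) = (transpose C *v w) \<bullet> (M *v (transpose C *v v))"
    by (rule form_commute[OF assms])+
  then show "- ((transpose A *v v) \<bullet> (M *v w)) - v \<bullet> (M *v (transpose A *v w)) + (transpose C *v v) \<bullet> (M *v (transpose C *v w)) = - ((transpose A *v w) \<bullet> (M *v v)) - w \<bullet> (M *v (transpose A *v v)) + (transpose C *v w) \<bullet> (M *v (transpose C *v v))" by linarith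
qed

section \<open>Positive semidefinite matrices\<close>

lemma pos_semidef_add: "pos_semidef M \<Longrightarrow> pos_semidef N \<Longrightarrow> pos_semidef (M + N)"
  by (simp add: pos_semidef_def symmetric_iff_form form_simps)

lemma pos_semidef_scaleR: "pos_semidef M \<Longrightarrow> 0 \<le> c \<Longrightarrow> pos_semidef (c *\<^sub>R M)"
  by (simp add: pos_semidef_def symmetric_iff_form form_simps)

lemma pos_def_add: "pos_def M \<Longrightarrow> pos_semidef N \<Longrightarrow> pos_def (M + N)"
  by (simp add: pos_semidef_def pos_def_def symmetric_iff_form form_simps add_pos_nonneg)

lemma pos_def_scaleR: "pos_def M \<Longrightarrow> 0 < c \<Longrightarrow> pos_def (c *\<^sub>R M)"
  by (simp add: pos_def_def symmetric_iff_form form_simps)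

lemma pos_def_imp_semidef: "pos_def M \<Longrightarrow> pos_semidef M"
  unfolding pos_def_def pos_semidef_def
  by (metis inner_zero_left order_less_imp_le order_refl)

lemma pos_def_mat_1: "pos_def (mat 1)"
  by (simp add: pos_def_def)

text \<open>
  Once \<open>a\<close> and \<open>b\<close> are known to be nonnegative, the points \<open>(b, -c)\<close> and \<open>(-c, a)\<close> decide the case in
  which one of them is positive, and \<open>(1, -c)\<close> the case \<open>a = b = 0\<close>.
\<close>
lemma quadratic_discriminant:
  fixes a b c :: real
  assumes q: "\<And>s t. 0 \<le> s\<^sup>2 * a + 2 * s * t * c + t\<^sup>2 * b"
  shows "c\<^sup>2 \<le> a * b"
proof -
  have "0 \<le> a" "0 \<le> b" using q[of 1 0] q[of 0 1] by auto
  have b: "0 \<le> b * (a * b - c\<^sup>2)" using q[of b "-c"] by (simp add: power2_eq_square algebra_simps)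
  have a: "0 \<le> a * (a * b - c\<^sup>2)" using q[of "-c" a] by (simp add: power2_eq_square algebra_simps)
  have "0 \<le> a * b - c\<^sup>2"
  proof (cases "a = 0 \<and> b = 0")
    case True
    then show ?thesis using q[of 1 "-c"] by (simp add: power2_eq_square)
  next
    case False
    then show ?thesis using a b \<open>0 \<le> a\<close> \<open>0 \<le> b\<close> by (auto simp: zero_le_mult_iff)
  qed
  then show ?thesis by simp
qed

lemma form_Cauchy_Schwarz:
  fixes M :: "real^'n^'n"
  assumes "pos_semidef M"
  shows "(w \<bullet> (M *v v))\<^sup>2 \<le> (w \<bullet> (M *v w)) * (v \<bullet> (M *v v))"
proof (rule quadratic_discriminant)
  fix s t :: real
  have sym: "v \<bullet> (M *v w) = w \<bullet> (M *v v)"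
    using assms form_commute[of M v w] unfolding pos_semidef_def by simp
  have "0 \<le> (s *\<^sub>R w + t *\<^sub>R v) \<bullet> (M *v (s *\<^sub>R w + t *\<^sub>R v))"
    using assms unfolding pos_semidef_def by blast
  also have "\<dots> = s\<^sup>2 * (w \<bullet> (M *v w)) + 2 * s * t * (w \<bullet> (M *v v)) + t\<^sup>2 * (v \<bullet> (M *v v))"
    by (simp add: form_simps sym power2_eq_square algebra_simps)
  finally show "0 \<le> s\<^sup>2 * (w \<bullet> (M *v w)) + 2 * s * t * (w \<bullet> (M *v v)) + t\<^sup>2 * (v \<bullet> (M *v v))" .
qed

lemma pos_semidef_kernel:
  assumes "pos_semidef M" "v \<bullet> (M *v v) = 0"
  shows "M *v v = 0"
  using form_Cauchy_Schwarz[OF assms(1), of "M *v v" v] assms(2) by simp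

definition outer :: "real^'n \<Rightarrow> real^'n^'n" where "outer v = (\<chi> i j. v$i * v$j)"

lemma outer_form: "u \<bullet> (outer v *v w) = (u \<bullet> v) * (v \<bullet> w)"
proof -
  have "outer v *v w = (v \<bullet> w) *\<^sub>R v"
    by (simp add: outer_def inner_vec_def matrix_vector_mult_def vec_eq_iff sum_distrib_left ac_simps)
  then show ?thesis by (simp add: inner_commute)
qed

lemma inner_outer: "N \<bullet> outer v = v \<bullet> (N *v v)"
  by (simp add: outer_def inner_vec_def matrix_vector_mult_def sum_distrib_left ac_simps)

lemma pos_semidef_outer: "pos_semidef (outer v)"
  by (simp add: pos_semidef_def symmetric_iff_form outer_form inner_commute)

lemma form_axis: "axis i 1 \<bullet> (M *v axis j 1) = (M::real^'n^'n) $ i $ j"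
  by (simp add: inner_axis' matrix_vector_mult_basis column_def)

text \<open>
  A substitute for the spectral decomposition. For a basis vector \<open>e\<close> with \<open>a = e \<bullet> S e > 0\<close>,
  Cauchy-Schwarz shows that subtracting the outer square of \<open>S e / sqrt a\<close> leaves a positive semidefinite
  matrix. Its diagonal entry at \<open>e\<close> is zero, and no diagonal entry grows, so the number of nonzero
  diagonal entries decreases.
\<close>
lemma pos_semidef_sum_outer:
  fixes S :: "real^'n^'n"
  assumes "pos_semidef S"
  shows "\<exists>ws. S = sum_list (map outer ws)"
  using assms
proof (induction "card {i. S$i$i \<noteq> 0}" arbitrary: S rule: less_induct)
  case less
  show ?case
  proof (cases "\<exists>i. S$i$i \<noteq> 0")
    case False
    have "S *v axis i 1 = 0" for i :: 'n
      using False form_axis[of i S i] by (intro pos_semidef_kernel less.prems) simp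
    then have "S = 0"
      by (metis (no_types, lifting) form_axis inner_zero_right vec_eq_iff zero_index)
    then show ?thesis by (intro exI[of _ "[]"]) simp
  next
    case True
    then obtain i where i: "S$i$i \<noteq> 0" by blast
    define e where "e = (axis i 1 :: real^'n)"
    define a where "a = e \<bullet> (S *v e)"
    have a: "0 < a"
      using i less.prems form_axis[of i S i] unfolding a_def e_def pos_semidef_def by (metis order_le_less)
    define w where "w = (1 / sqrt a) *\<^sub>R (S *v e)"
    define S' where "S' = S - outer w"
    have sym: "x \<bullet> (S *v y) = y \<bullet> (S *v x)" for x y
      using form_commute less.prems unfolding pos_semidef_def by blast
    have form: "x \<bullet> (S' *v y) = x \<bullet> (S *v y) - (x \<bullet> (S *v e)) * (y \<bullet> (S *v e)) / a" for x y
      unfolding S'_def w_def using a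
      by (simp add: form_simps outer_form inner_commute[of "S *v e"])
    have psd: "pos_semidef S'"
      unfolding pos_semidef_def symmetric_iff_form
    proof safe
      fix v w show "v \<bullet> (S' *v w) = w \<bullet> (S' *v v)" unfolding form using sym by (simp add: mult.commute)
    next
      fix v
      show "0 \<le> v \<bullet> (S' *v v)"
        using form_Cauchy_Schwarz[OF less.prems, of v e] a unfolding form a_def[symmetric]
        by (simp add: field_simps power2_eq_square)
    qed
    have ii: "S'$i$i = 0"
      using form[of e e] a unfolding a_def[symmetric] by (simp add: e_def form_axis)
    have jj: "S'$j$j = 0" if "S$j$j = 0" for j
    proof -
      have "S'$j$j \<le> S$j$j" unfolding S'_def outer_def by simp
      moreover have "0 \<le> S'$j$j" using psd form_axis[of j S' j] unfolding pos_semidef_def by metis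
      ultimately show ?thesis using that by simp
    qed
    have "{j. S'$j$j \<noteq> 0} \<subset> {j. S$j$j \<noteq> 0}" using ii jj i by blast
    then have "card {j. S'$j$j \<noteq> 0} < card {j. S$j$j \<noteq> 0}"
      by (intro psubset_card_mono) auto
    from less.hyps[OF this psd] obtain ws where "S' = sum_list (map outer ws)" by blast
    then have "S = sum_list (map outer (w # ws))" unfolding S'_def by (simp add: algebra_simps)
    then show ?thesis by blast
  qed
qed

lemma inner_sum_outer: "N \<bullet> sum_list (map outer ws) = (\<Sum>w\<leftarrow>ws. w \<bullet> (N *v w))"
  by (induction ws) (simp_all add: inner_add_right inner_outer)

lemma inner_pos_semidef_nonneg:
  assumes "pos_semidef S" "pos_semidef R" shows "0 \<le> R \<bullet> S"
proof -
  obtain ws where "S = sum_list (map outer ws)" using pos_semidef_sum_outer[OF assms(1)] by blast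
  then show ?thesis using assms(2) unfolding pos_semidef_def
    by (auto simp: inner_sum_outer intro!: sum_list_nonneg)
qed

lemma inner_pos_def_pos:
  assumes "pos_semidef S" "S \<noteq> 0" "pos_def R" shows "0 < R \<bullet> S"
proof -
  obtain ws where S: "S = sum_list (map outer ws)" using pos_semidef_sum_outer[OF assms(1)] by blast
  have "\<exists>w\<in>set ws. w \<noteq> 0"
  proof (rule ccontr)
    assume "\<not> ?thesis"
    then have "\<forall>M\<in>set (map outer ws). M = 0" by (auto simp: outer_def vec_eq_iff)
    then have "S = 0" unfolding S by (induction ws) auto
    then show False using assms(2) by simp
  qed
  then obtain w where w: "w \<in> set ws" "w \<noteq> 0" by blast
  have "0 < w \<bullet> (R *v w)" using assms(3) w(2) unfolding pos_def_def by blast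
  also have "\<dots> \<le> (\<Sum>w\<leftarrow>ws. w \<bullet> (R *v w))"
    using w(1) pos_def_imp_semidef[OF assms(3)] unfolding pos_semidef_def
    by (intro member_le_sum_list) auto
  finally show ?thesis unfolding S inner_sum_outer .
qed

lemma pos_def_lower_bound:
  fixes R :: "real^'n^'n"
  assumes "pos_def R" obtains \<delta> where "0 < \<delta>" "\<And>v. \<delta> * (v \<bullet> v) \<le> v \<bullet> (R *v v)"
proof -
  have "axis undefined 1 \<in> sphere (0::real^'n) 1" by simp
  then have ne: "sphere (0::real^'n) 1 \<noteq> {}" by blast
  have "continuous_on (sphere 0 1) (\<lambda>v. v \<bullet> (R *v v))"
    by (intro continuous_intros linear_continuous_on linear_linear[THEN iffD2]) simp
  from continuous_attains_inf[OF compact_sphere ne this]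
  obtain u where u: "norm u = 1" "\<And>v. norm v = 1 \<Longrightarrow> u \<bullet> (R *v u) \<le> v \<bullet> (R *v v)" by auto
  define \<delta> where "\<delta> = u \<bullet> (R *v u)"
  have "0 < \<delta>" unfolding \<delta>_def using assms u(1) unfolding pos_def_def by (metis norm_zero zero_neq_one)
  moreover have "\<delta> * (v \<bullet> v) \<le> v \<bullet> (R *v v)" for v
  proof (cases "v = 0")
    case False
    define w where "w = (1 / norm v) *\<^sub>R v"
    have "norm w = 1" using False by (simp add: w_def)
    then have "\<delta> \<le> w \<bullet> (R *v w)" unfolding \<delta>_def by (rule u(2))
    also have "\<dots> = (v \<bullet> (R *v v)) / (norm v)\<^sup>2"
      by (simp add: w_def form_simps power2_eq_square)
    finally show ?thesis using False by (simp add: dot_square_norm field_simps)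
  qed simp
  ultimately show ?thesis using that by blast
qed

lemma form_le_norm: "\<bar>v \<bullet> ((R::real^'n^'n) *v v)\<bar> \<le> onorm ((*v) R) * (v \<bullet> v)"
proof -
  have "\<bar>v \<bullet> (R *v v)\<bar> \<le> norm v * norm (R *v v)" by (rule Cauchy_Schwarz_ineq2)
  also have "\<dots> \<le> norm v * (onorm ((*v) R) * norm v)"
    by (intro mult_left_mono onorm matrix_vector_mul_bounded_linear) simp
  finally show ?thesis by (simp add: dot_square_norm power2_eq_square ac_simps)
qed

section \<open>Separation and duality\<close>

lemma pos_semidef_symmetric: "pos_semidef M \<Longrightarrow> transpose M = M"
  by (simp add: pos_semidef_def)

lemma pos_def_symmetric: "pos_def M \<Longrightarrow> transpose M = M"
  by (simp add: pos_def_def)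

lemma matrix_vector_minus [simp]: "(M::real^'n^'m) *v (- v) = - (M *v v)"
  by (metis diff_0 matrix_vector_mult_0_right matrix_vector_mult_diff_distrib)

lemma pos_def_outer_add: "0 < \<epsilon> \<Longrightarrow> pos_def (outer v + \<epsilon> *\<^sub>R mat 1)"
  using pos_def_add[OF pos_def_scaleR[OF pos_def_mat_1] pos_semidef_outer] by (simp add: add.commute)

lemma nonneg_of_add_epsilon:
  fixes a b :: real
  assumes "\<And>\<epsilon>. 0 < \<epsilon> \<Longrightarrow> 0 \<le> a + \<epsilon> * b"
  shows "0 \<le> a"
proof (rule ccontr)
  assume "\<not> 0 \<le> a"
  then have a: "a < 0" by simp
  show False
  proof (cases "b \<le> 0")
    case True
    then show False using assms[of 1] a by simp
  next
    case False
    then show False using assms[of "- a / (2 * b)"] a by (simp add: field_simps)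
  qed
qed

lemma pos_semidef_if_pairing_nonneg:
  assumes "transpose N = N" "\<And>P. pos_def P \<Longrightarrow> 0 \<le> N \<bullet> P"
  shows "pos_semidef N"
  unfolding pos_semidef_def
proof (intro conjI allI)
  fix v
  have "0 \<le> v \<bullet> (N *v v) + \<epsilon> * (N \<bullet> mat 1)" if "0 < \<epsilon>" for \<epsilon>
    using assms(2)[OF pos_def_outer_add[OF that, of v]] by (simp add: inner_add_right inner_outer)
  then show "0 \<le> v \<bullet> (N *v v)" by (rule nonneg_of_add_epsilon)
qed (rule assms(1))

text \<open>
  The image under \<open>f\<close> of the positive definite cone is separated from the cone \<open>T\<close> of all matrices with
  positive quadratic form. That \<open>T\<close> contains nonsymmetric matrices matters: for a skew \<open>N\<close> it contains
  \<open>1 + c N\<close> for every \<open>c\<close>, so that the separating functional vanishes on skew matrices and is represented by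
  a nonzero symmetric \<open>H\<close>.
\<close>
lemma pos_def_separation:
  fixes f :: "real^'n^'n \<Rightarrow> real^'n^'n"
  assumes "linear f" and sym: "\<And>P. transpose P = P \<Longrightarrow> transpose (f P) = f P"
    and none: "\<not> (\<exists>P. pos_def P \<and> pos_def (f P))"
  obtains H where "pos_semidef H" "H \<noteq> 0" "\<And>P. pos_def P \<Longrightarrow> H \<bullet> f P \<le> 0"
proof -
  define T where "T = {R::real^'n^'n. \<forall>v. v \<noteq> 0 \<longrightarrow> 0 < v \<bullet> (R *v v)}"
  define U where "U = f ` {P. pos_def P}"
  have convP: "convex {P::real^'n^'n. pos_def P}"
  proof (rule convexI, simp)
    fix x y :: "real^'n^'n" and u v :: real
    assume "pos_def x" "pos_def y" "0 \<le> u" "0 \<le> v" "u + v = 1"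
    then show "pos_def (u *\<^sub>R x + v *\<^sub>R y)"
      by (cases "u = 0")
        (simp_all add: pos_def_add pos_def_scaleR pos_semidef_scaleR pos_def_imp_semidef)
  qed
  then have "convex U" unfolding U_def by (rule convex_linear_image[OF assms(1)])
  moreover have "convex T"
  proof (rule convexI)
    fix x y :: "real^'n^'n" and u v :: real
    assume "x \<in> T" "y \<in> T" and "0 \<le> u" "0 \<le> v" "u + v = 1"
    have "0 < z \<bullet> ((u *\<^sub>R x + v *\<^sub>R y) *v z)" if "z \<noteq> 0" for z
    proof -
      have "0 < z \<bullet> (x *v z)" "0 < z \<bullet> (y *v z)"
        using that \<open>x \<in> T\<close> \<open>y \<in> T\<close> unfolding T_def by auto
      then show ?thesis
        using \<open>0 \<le> u\<close> \<open>0 \<le> v\<close> \<open>u + v = 1\<close>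
        by (cases "u = 0") (simp_all add: form_simps add_pos_nonneg)
    qed
    then show "u *\<^sub>R x + v *\<^sub>R y \<in> T" unfolding T_def by blast
  qed
  moreover have "U \<noteq> {}" "T \<noteq> {}"
    using pos_def_mat_1 unfolding U_def T_def pos_def_def by blast+
  moreover have "U \<inter> T = {}"
    using none sym unfolding U_def T_def pos_def_def by blast
  ultimately obtain H b where H: "H \<noteq> 0" and HU: "\<forall>x\<in>U. H \<bullet> x \<le> b" and HT: "\<forall>x\<in>T. b \<le> H \<bullet> x"
    using separating_hyperplane_sets[of U T] by metis
  have scale: "c *\<^sub>R R \<in> T" if "R \<in> T" "0 < c" for R c
    using that by (auto simp: T_def form_simps)
  have one: "mat 1 \<in> T" by (simp add: T_def)
  have "b \<le> 0"
  proof -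
    have "0 \<le> - b + \<epsilon> * (H \<bullet> mat 1)" if "0 < \<epsilon>" for \<epsilon>
      using HT scale[OF one that] by fastforce
    from nonneg_of_add_epsilon[OF this] show ?thesis by simp
  qed
  have HT0: "0 \<le> H \<bullet> R" if "R \<in> T" for R
  proof -
    have "0 \<le> H \<bullet> R + \<epsilon> * (- b)" if "0 < \<epsilon>" for \<epsilon>
    proof -
      have "b \<le> H \<bullet> ((1 / \<epsilon>) *\<^sub>R R)" using bspec[OF HT scale[OF \<open>R \<in> T\<close>, of "1 / \<epsilon>"]] that by simp
      then show ?thesis using that by (simp add: field_simps)
    qed
    then show ?thesis by (rule nonneg_of_add_epsilon)
  qed
  have "transpose H = H"
    unfolding symmetric_iff_form
  proof (intro allI)
    fix v w :: "real^'n"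
    define N :: "real^'n^'n" where "N = (\<chi> i j. v$i * w$j - w$i * v$j)"
    have HN: "H \<bullet> N = v \<bullet> (H *v w) - w \<bullet> (H *v v)"
      by (simp add: N_def inner_vec_def matrix_vector_mult_def sum_distrib_left sum_subtractf
          right_diff_distrib ac_simps)
    have N: "x \<bullet> (N *v x) = 0" for x
    proof -
      have "N *v x = (w \<bullet> x) *\<^sub>R v - (v \<bullet> x) *\<^sub>R w"
        by (simp add: N_def inner_vec_def matrix_vector_mult_def vec_eq_iff sum_distrib_left
            sum_distrib_right sum_subtractf left_diff_distrib right_diff_distrib ac_simps)
      then show ?thesis by (simp add: inner_diff_right inner_commute)
    qed
    have 0: "0 \<le> H \<bullet> (mat 1 + c *\<^sub>R N)" for c
      by (rule HT0) (simp add: T_def form_simps N)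
    have "H \<bullet> N = 0"
    proof (rule ccontr)
      assume "H \<bullet> N \<noteq> 0"
      then show False using 0[of "- (H \<bullet> mat 1 + 1) / (H \<bullet> N)"] by (simp add: inner_add_right)
    qed
    then show "v \<bullet> (H *v w) = w \<bullet> (H *v v)" using HN by simp
  qed
  moreover have "0 \<le> H \<bullet> P" if "pos_def P" for P
    using that HT0 unfolding T_def pos_def_def by blast
  ultimately have "pos_semidef H" by (rule pos_semidef_if_pairing_nonneg)
  moreover have "H \<bullet> f P \<le> 0" if "pos_def P" for P
    using HU \<open>b \<le> 0\<close> that unfolding U_def by fastforce
  ultimately show ?thesis using that H by blast
qed

lemma minus_form: "v \<bullet> ((- N) *v w) = - (v \<bullet> ((N::real^'n^'n) *v w))" by simp

lemma transpose_minus [simp]: "transpose (- N) = - transpose (N::real^'n^'n)"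
  by (simp add: transpose_def vec_eq_iff)

text \<open>
  Read through the duality, a functional separating the values of \<open>lyap_adj_op A C\<close> from the positive
  definite matrices is a counterexample \<open>H\<close> to the assumption.
\<close>
lemma lyap_adj_pos_if_trivial_kernel:
  assumes "\<And>S. pos_semidef S \<Longrightarrow> pos_semidef (- lyap_op A C S) \<Longrightarrow> S = 0"
  shows "\<exists>P. pos_def P \<and> pos_def (lyap_adj_op A C P)"
proof (rule ccontr)
  assume "\<not> ?thesis"
  then obtain H where H: "pos_semidef H" "H \<noteq> 0" "\<And>P. pos_def P \<Longrightarrow> H \<bullet> lyap_adj_op A C P \<le> 0"
    using pos_def_separation[OF linear_lyap_adj_op lyap_adj_op_symmetric] by metis
  have "pos_semidef (- lyap_op A C H)"
  proof (rule pos_semidef_if_pairing_nonneg)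
    show "transpose (- lyap_op A C H) = - lyap_op A C H"
      by (simp add: lyap_op_symmetric pos_semidef_symmetric[OF H(1)])
    fix P :: "real^'a^'a" assume "pos_def P"
    then show "0 \<le> (- lyap_op A C H) \<bullet> P"
      using H(3)[of P] lyap_adjoint[of A C P H] by (simp add: inner_commute[of _ P] inner_commute[of _ H])
  qed
  then show False using assms H by blast
qed

lemma trivial_kernel_if_lyap_adj_pos:
  assumes "pos_def (lyap_adj_op A C P)" "pos_def P" "pos_semidef S" "pos_semidef (- lyap_op A C S)"
  shows "S = 0"
proof (rule ccontr)
  assume "S \<noteq> 0"
  then have "0 < lyap_adj_op A C P \<bullet> S" using assms inner_pos_def_pos by blast
  also have "\<dots> = - ((- lyap_op A C S) \<bullet> P)" by (simp add: lyap_adjoint inner_commute[of P])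
  also have "\<dots> \<le> 0" using inner_pos_semidef_nonneg assms pos_def_imp_semidef by fastforce
  finally show False by simp
qed

lemma pos_semidef_nonzero_form:
  assumes "pos_semidef H" "H \<noteq> 0" obtains v where "0 < v \<bullet> (H *v v)"
proof (rule ccontr)
  assume "\<not> thesis"
  then have "v \<bullet> (H *v v) = 0" for v
    using that assms(1) unfolding pos_semidef_def by (metis order_le_less)
  then have "H *v v = 0" for v using assms(1) pos_semidef_kernel by blast
  then have "H = 0" by (simp add: matrix_eq)
  then show False using assms(2) by simp
qed

text \<open>
  A maximum principle. If \<open>m\<close> is the largest ratio of the forms of \<open>H\<close> and \<open>P\<close>, attained at \<open>u\<close>, then
  \<open>N = m P - H\<close> is positive semidefinite with \<open>N u = 0\<close>. In the form of \<open>lyap_adj_op D K N\<close> at \<open>u\<close> the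
  terms with \<open>D\<close> vanish and the one with \<open>K\<close> is nonnegative, whereas the assumptions make the form negative.
\<close>
lemma lyap_adj_comparison:
  fixes P H :: "real^'n^'n"
  assumes P: "pos_def P" and LP: "pos_def (- lyap_adj_op D K P)"
    and H: "pos_semidef H" and LH: "pos_semidef (lyap_adj_op D K H)"
  shows "H = 0"
proof (rule ccontr)
  assume "H \<noteq> 0"
  then obtain v where v: "0 < v \<bullet> (H *v v)" using pos_semidef_nonzero_form H by blast
  have Ppos: "x \<noteq> 0 \<Longrightarrow> 0 < x \<bullet> (P *v x)" for x using P unfolding pos_def_def by blast
  have "axis undefined 1 \<in> sphere (0::real^'n) 1" by simp
  then have ne: "sphere (0::real^'n) 1 \<noteq> {}" by blast
  have "x \<bullet> (P *v x) \<noteq> 0" if "x \<in> sphere 0 1" for x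
    using Ppos[of x] that by force
  then have "continuous_on (sphere 0 1) (\<lambda>x. (x \<bullet> (H *v x)) / (x \<bullet> (P *v x)))"
    by (intro continuous_intros linear_continuous_on linear_linear[THEN iffD2]) auto
  from continuous_attains_sup[OF compact_sphere ne this]
  obtain u where u: "norm u = 1"
    and max: "\<And>x. norm x = 1 \<Longrightarrow> (x \<bullet> (H *v x)) / (x \<bullet> (P *v x)) \<le> (u \<bullet> (H *v u)) / (u \<bullet> (P *v u))"
    by auto
  define m where "m = (u \<bullet> (H *v u)) / (u \<bullet> (P *v u))"
  have "u \<noteq> 0" using u by force
  have le: "x \<bullet> (H *v x) \<le> m * (x \<bullet> (P *v x))" for x
  proof (cases "x = 0")
    case False
    define y where "y = (1 / norm x) *\<^sub>R x"
    have "norm y = 1" using False by (simp add: y_def)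
    then have "(y \<bullet> (H *v y)) / (y \<bullet> (P *v y)) \<le> m" unfolding m_def by (rule max)
    moreover have "(y \<bullet> (H *v y)) / (y \<bullet> (P *v y)) = (x \<bullet> (H *v x)) / (x \<bullet> (P *v x))"
      using False by (simp add: y_def form_simps)
    ultimately show ?thesis using Ppos[OF False] by (simp add: field_simps)
  qed simp
  have "v \<noteq> 0" using v by auto
  then have m: "0 < m" using le[of v] v Ppos[of v] by (smt (verit) mult_nonpos_nonneg)
  define N where "N = m *\<^sub>R P - H"
  have symP: "transpose P = P" and symH: "transpose H = H"
    using P H unfolding pos_def_def pos_semidef_def by auto
  have N: "pos_semidef N"
    using le form_commute[OF symP] form_commute[OF symH]
    unfolding pos_semidef_def symmetric_iff_form N_def by (simp add: form_simps)
  have "u \<bullet> (N *v u) = 0"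
    using Ppos[OF \<open>u \<noteq> 0\<close>] by (simp add: N_def form_simps m_def)
  then have Nu: "N *v u = 0" by (rule pos_semidef_kernel[OF N])
  have "u \<bullet> (N *v w) = 0" for w
    using form_commute[of N u w] N Nu unfolding pos_semidef_def by simp
  then have "0 \<le> u \<bullet> (lyap_adj_op D K N *v u)"
    unfolding lyap_adj_op_form using N Nu unfolding pos_semidef_def
    by (simp del: transpose_matrix_vector)
  also have "\<dots> = m * (u \<bullet> (lyap_adj_op D K P *v u)) - u \<bullet> (lyap_adj_op D K H *v u)"
    unfolding N_def linear_diff[OF linear_lyap_adj_op] linear_scale[OF linear_lyap_adj_op]
    by (simp add: form_simps)
  also have "\<dots> < 0"
  proof -
    have "u \<bullet> (lyap_adj_op D K P *v u) < 0"
      using LP \<open>u \<noteq> 0\<close> unfolding pos_def_def minus_form by auto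
    then have "m * (u \<bullet> (lyap_adj_op D K P *v u)) < 0" using m by (simp add: mult_pos_neg)
    moreover have "0 \<le> u \<bullet> (lyap_adj_op D K H *v u)" using LH unfolding pos_semidef_def by blast
    ultimately show ?thesis by simp
  qed
  finally show False by simp
qed

text \<open>
  If the inequality for \<open>S\<close> had no solution, separation would give a nonzero \<open>H\<close> that contradicts the
  comparison with \<open>P\<close>.
\<close>
lemma lyap_dual:
  fixes P :: "real^'n^'n"
  assumes P: "pos_def P" "pos_def (- lyap_adj_op D K P)"
  shows "\<exists>S. pos_def S \<and> pos_def (- lyap_op D K S)"
proof (rule ccontr)
  assume none: "\<not> ?thesis"
  have lin: "linear (\<lambda>S. - lyap_op D K S)"
    by (simp add: linear_compose_neg linear_lyap_op)
  have sym: "transpose (- lyap_op D K S) = - lyap_op D K S" if "transpose S = S" for S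
    using lyap_op_symmetric[OF that] by simp
  obtain H where H: "pos_semidef H" "H \<noteq> 0" "\<And>S. pos_def S \<Longrightarrow> H \<bullet> (- lyap_op D K S) \<le> 0"
    using pos_def_separation[OF lin sym none] by metis
  have "pos_semidef (lyap_adj_op D K H)"
  proof (rule pos_semidef_if_pairing_nonneg)
    show "transpose (lyap_adj_op D K H) = lyap_adj_op D K H"
      by (simp add: lyap_adj_op_symmetric pos_semidef_symmetric[OF H(1)])
    fix S :: "real^'n^'n" assume "pos_def S"
    then show "0 \<le> lyap_adj_op D K H \<bullet> S"
      using H(3)[of S] lyap_adjoint[of D K H S] by simp
  qed
  then show False using lyap_adj_comparison[OF P H(1)] H(2) by blast
qed

section \<open>The optimal feedback\<close>

lemma pos_def_inverse:
  fixes P :: "real^'n^'n"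
  assumes "pos_def P" obtains Q where "pos_def Q" "\<And>v. P *v (Q *v v) = v" "\<And>v. Q *v (P *v v) = v"
proof -
  have "x = 0" if "P *v x = 0" for x
    using assms that unfolding pos_def_def by (metis inner_zero_right less_irrefl)
  then obtain Q where Q: "Q ** P = mat 1" using matrix_left_invertible_ker[of P] by blast
  then have Q': "P ** Q = mat 1" by (simp add: matrix_left_right_inverse)
  have PQ: "P *v (Q *v v) = v" and QP: "Q *v (P *v v) = v" for v
    using Q Q' by (simp_all add: matrix_vector_mul_assoc)
  have sym: "v \<bullet> (P *v w) = w \<bullet> (P *v v)" for v w
    using assms form_commute unfolding pos_def_def by blast
  have "pos_def Q"
    unfolding pos_def_def symmetric_iff_form
  proof safe
    fix v w
    show "v \<bullet> (Q *v w) = w \<bullet> (Q *v v)"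
      using sym[of "Q *v v" "Q *v w"] by (simp add: PQ inner_commute)
  next
    fix v :: "real^'n" assume "v \<noteq> 0"
    then have "Q *v v \<noteq> 0" using PQ[of v] by auto
    then have "0 < (Q *v v) \<bullet> (P *v (Q *v v))" using assms unfolding pos_def_def by blast
    then show "0 < v \<bullet> (Q *v v)" by (simp add: PQ inner_commute)
  qed
  then show ?thesis using that PQ QP by blast
qed

text \<open>
  Completion of the square in \<open>K v\<close>, where \<open>P\<close> is the inverse of \<open>S\<close>. The first term is nonnegative and
  vanishes exactly for the feedback \<open>K = - P C\<^sup>T S\<close>, which is why one operator without \<open>K\<close>, applied to
  the inverse of the Lyapunov matrix, decides whether a stabilizing feedback exists.
\<close>
lemma closed_loop_lyap_form:
  fixes S P :: "real^'n^'n"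
  assumes S: "pos_def S" and SP: "\<And>v. S *v (P *v v) = v" "\<And>v. P *v (S *v v) = v"
  shows "v \<bullet> (lyap_op (- (A + C ** K)) K S *v v) =
    (K *v v + P *v (transpose C *v (S *v v))) \<bullet> (S *v (K *v v + P *v (transpose C *v (S *v v))))
    - (S *v v) \<bullet> (lyap_adj_op A C P *v (S *v v))"
proof -
  define y k where "y = transpose C *v (S *v v)" and "k = K *v v"
  have sym: "v \<bullet> (S *v w) = w \<bullet> (S *v v)" for v w
    using S form_commute unfolding pos_def_def by blast
  have 1: "v \<bullet> (S *v (A *v v)) = (A *v v) \<bullet> (S *v v)" by (rule sym)
  have 2: "v \<bullet> (S *v (C *v k)) = y \<bullet> k"
    unfolding y_def transpose_form by (metis sym inner_commute)
  have 5: "(C *v k) \<bullet> (S *v v) = y \<bullet> k" using sym[of v "C *v k"] 2 by simp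
  have 3: "(transpose A *v (S *v v)) \<bullet> v = (A *v v) \<bullet> (S *v v)"
    "(S *v v) \<bullet> (P *v (transpose A *v (S *v v))) = (A *v v) \<bullet> (S *v v)"
  proof -
    show "(transpose A *v (S *v v)) \<bullet> v = (A *v v) \<bullet> (S *v v)"
      by (metis transpose_form inner_commute)
    have "(S *v v) \<bullet> (P *v (transpose A *v (S *v v))) = (P *v (transpose A *v (S *v v))) \<bullet> (S *v v)"
      by (rule inner_commute)
    also have "\<dots> = v \<bullet> (transpose A *v (S *v v))" by (subst sym) (simp add: SP del: transpose_matrix_vector)
    also have "\<dots> = (A *v v) \<bullet> (S *v v)" by (metis form_transpose inner_commute)
    finally show "(S *v v) \<bullet> (P *v (transpose A *v (S *v v))) = (A *v v) \<bullet> (S *v v)" .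
  qed
  have 4: "(P *v y) \<bullet> (S *v k) = y \<bullet> k" "(P *v y) \<bullet> y = y \<bullet> (P *v y)"
    using sym[of "P *v y" k] by (simp_all add: SP inner_commute)
  show ?thesis
    unfolding lyap_op_form lyap_adj_op_form k_def[symmetric] y_def[symmetric]
    by (simp add: form_simps 1 2 5 3 4 SP y_def[symmetric] k_def[symmetric] inner_commute[of k y]
        del: transpose_matrix_vector)
qed

lemma stabilizing_feedback:
  fixes P :: "real^'n^'n"
  assumes "pos_def P" "pos_def (lyap_adj_op A C P)"
  obtains K S where "pos_def S" "pos_def (- lyap_op (- (A + C ** K)) K S)"
proof -
  obtain S where S: "pos_def S" "\<And>v. P *v (S *v v) = v" "\<And>v. S *v (P *v v) = v"
    using pos_def_inverse[OF assms(1)] by metis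
  define K where "K = - (P ** transpose C ** S)"
  have K: "K *v v + P *v (transpose C *v (S *v v)) = 0" for v
    by (simp add: K_def matrix_vector_mul_assoc[symmetric] del: transpose_matrix_vector)
  have "transpose (- lyap_op (- (A + C ** K)) K S) = - lyap_op (- (A + C ** K)) K S"
    unfolding transpose_minus using lyap_op_symmetric[OF pos_def_symmetric[OF S(1)]] by metis
  moreover have "0 < v \<bullet> (- lyap_op (- (A + C ** K)) K S *v v)" if "v \<noteq> 0" for v
  proof -
    have "S *v v \<noteq> 0" using S(2)[of v] that by auto
    then show ?thesis
      using assms(2) unfolding pos_def_def minus_form closed_loop_lyap_form[OF S(1,3,2)] K by simp
  qed
  ultimately show ?thesis using that[OF S(1)] unfolding pos_def_def by blast
qed

lemma lyap_adj_pos_if_feedback: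
  fixes S :: "real^'n^'n"
  assumes "pos_def S" "pos_def (- lyap_op (- (A + C ** K)) K S)"
  shows "\<exists>P. pos_def P \<and> pos_def (lyap_adj_op A C P)"
proof -
  obtain P where P: "pos_def P" "\<And>v. S *v (P *v v) = v" "\<And>v. P *v (S *v v) = v"
    using pos_def_inverse[OF assms(1)] by metis
  have "transpose (lyap_adj_op A C P) = lyap_adj_op A C P"
    by (simp add: lyap_adj_op_symmetric pos_def_symmetric[OF P(1)])
  moreover have "0 < u \<bullet> (lyap_adj_op A C P *v u)" if "u \<noteq> 0" for u
  proof -
    define v where "v = P *v u"
    have u: "S *v v = u" unfolding v_def by (rule P)
    then have "v \<noteq> 0" using that by auto
    then have "v \<bullet> (lyap_op (- (A + C ** K)) K S *v v) < 0"
      using assms(2) unfolding pos_def_def minus_form by auto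
    moreover have "0 \<le> w \<bullet> (S *v w)" for w
      using pos_def_imp_semidef[OF assms(1)] unfolding pos_semidef_def by blast
    ultimately show ?thesis
      unfolding closed_loop_lyap_form[OF assms(1) P(2,3)] u by (smt (verit))
  qed
  ultimately show ?thesis using P(1) unfolding pos_def_def by blast
qed

section \<open>Eigenvectors in a face of the positive semidefinite cone\<close>

lemma pos_semidef_range:
  fixes S :: "real^'n^'n"
  assumes S: "pos_semidef S" and w: "\<And>v. S *v v = 0 \<Longrightarrow> w \<bullet> v = 0"
  obtains u where "w = S *v u"
proof -
  obtain y z where yz: "y \<in> span (range ((*v) S))" "\<And>x. x \<in> span (range ((*v) S)) \<Longrightarrow> orthogonal z x" "w = y + z"
    using orthogonal_subspace_decomp_exists[of "range ((*v) S)" w] by metis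
  have rng: "span (range ((*v) S)) = range ((*v) S)"
    by (intro span_eq_iff[THEN iffD2] linear_subspace_image) auto
  have "z \<bullet> (S *v z) = 0" using yz(2)[of "S *v z"] by (simp add: orthogonal_def span_base)
  then have "S *v z = 0" by (rule pos_semidef_kernel[OF S])
  then have "w \<bullet> z = 0" by (rule w)
  moreover have "y \<bullet> z = 0" using yz(2)[OF yz(1)] by (simp add: orthogonal_def inner_commute)
  ultimately have "z = 0" using yz(3) by (simp add: inner_add_left)
  then show ?thesis using yz rng that by auto
qed

text \<open>
  Each \<open>w\<close> in a decomposition of \<open>M\<close> into outer squares is orthogonal to the kernel of \<open>S\<close>, hence of the form
  \<open>S u\<close>. Then \<open>(w \<bullet> v)\<^sup>2 \<le> (u \<bullet> S u) (v \<bullet> S v)\<close>, and \<open>c\<close> is the sum of the first factors.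
\<close>
lemma pos_semidef_dominated:
  fixes S M :: "real^'n^'n"
  assumes S: "pos_semidef S" and M: "pos_semidef M" and ker: "\<And>v. S *v v = 0 \<Longrightarrow> M *v v = 0"
  obtains c where "0 \<le> c" "\<And>v. v \<bullet> (M *v v) \<le> c * (v \<bullet> (S *v v))"
proof -
  obtain ws where ws: "M = sum_list (map outer ws)" using pos_semidef_sum_outer[OF M] by blast
  have one: "\<exists>c\<ge>0. \<forall>v. (w \<bullet> v)\<^sup>2 \<le> c * (v \<bullet> (S *v v))" if w: "w \<in> set ws" for w
  proof -
    have "w \<bullet> v = 0" if "S *v v = 0" for v
    proof -
      have "0 = M \<bullet> outer v" using ker[OF that] by (simp add: inner_outer)
      also have "\<dots> = (\<Sum>w\<leftarrow>ws. (w \<bullet> v)\<^sup>2)"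
        unfolding inner_commute[of M] unfolding ws inner_sum_outer
        by (simp add: outer_form power2_eq_square inner_commute)
      finally have "(\<Sum>w\<leftarrow>ws. (w \<bullet> v)\<^sup>2) = 0" by simp
      then have "(w \<bullet> v)\<^sup>2 = 0"
        using w by (subst (asm) sum_list_nonneg_eq_0_iff) auto
      then show ?thesis by simp
    qed
    then obtain u where u: "w = S *v u" using pos_semidef_range[OF S] by blast
    have "(w \<bullet> v)\<^sup>2 \<le> (u \<bullet> (S *v u)) * (v \<bullet> (S *v v))" for v
      using form_Cauchy_Schwarz[OF S, of v u] unfolding u by (simp add: inner_commute mult.commute)
    then show ?thesis using S unfolding pos_semidef_def by blast
  qed
  then obtain c where c: "\<And>w. w \<in> set ws \<Longrightarrow> 0 \<le> c w"
    "\<And>w v. w \<in> set ws \<Longrightarrow> (w \<bullet> v)\<^sup>2 \<le> c w * (v \<bullet> (S *v v))" by metis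
  have "v \<bullet> (M *v v) \<le> (\<Sum>w\<leftarrow>ws. c w) * (v \<bullet> (S *v v))" for v
  proof -
    have "v \<bullet> (M *v v) = (\<Sum>w\<leftarrow>ws. (w \<bullet> v)\<^sup>2)"
      unfolding inner_outer[symmetric] inner_commute[of M] unfolding ws inner_sum_outer
      by (simp add: outer_form power2_eq_square inner_commute)
    also have "\<dots> \<le> (\<Sum>w\<leftarrow>ws. c w * (v \<bullet> (S *v v)))" by (rule sum_list_mono) (rule c)
    also have "\<dots> = (\<Sum>w\<leftarrow>ws. c w) * (v \<bullet> (S *v v))" by (simp add: sum_list_mult_const)
    finally show ?thesis .
  qed
  moreover have "0 \<le> (\<Sum>w\<leftarrow>ws. c w)" by (rule sum_list_nonneg) (auto simp: c)
  ultimately show ?thesis using that by blast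
qed

text \<open>
  At \<open>v\<close> in the kernel of \<open>S\<close> only the term with \<open>C\<close> survives in the form of \<open>lyap_op A C S\<close>. It is
  nonnegative, and the form is nonpositive, so both vanish; hence \<open>S C v = 0\<close>, and \<open>v\<close> lies in the kernel of
  \<open>lyap_op A C S\<close>, where all that is left of this matrix is \<open>- S A v\<close>.
\<close>
lemma kernel_invariant:
  fixes S :: "real^'n^'n"
  assumes S: "pos_semidef S" and L: "pos_semidef (- lyap_op A C S)" and v: "S *v v = 0"
  shows "S *v (C *v v) = 0" "S *v (A *v v) = 0"
proof -
  have sym: "x \<bullet> (S *v y) = y \<bullet> (S *v x)" for x y
    using S form_commute unfolding pos_semidef_def by blast
  have "v \<bullet> (lyap_op A C S *v v) = (C *v v) \<bullet> (S *v (C *v v))"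
    unfolding lyap_op_form using v sym[of v "A *v v"] by simp
  moreover have "v \<bullet> (lyap_op A C S *v v) \<le> 0" "0 \<le> (C *v v) \<bullet> (S *v (C *v v))"
    using S L unfolding pos_semidef_def minus_form by auto
  ultimately have 0: "(C *v v) \<bullet> (S *v (C *v v)) = 0" "v \<bullet> ((- lyap_op A C S) *v v) = 0" by simp_all
  show C: "S *v (C *v v) = 0" by (rule pos_semidef_kernel[OF S 0(1)])
  have "(- lyap_op A C S) *v v = 0" by (rule pos_semidef_kernel[OF L 0(2)])
  then have "w \<bullet> (lyap_op A C S *v v) = 0" for w by simp
  then have "w \<bullet> (S *v (A *v v)) = 0" for w unfolding lyap_op_form using v C by simp
  then show "S *v (A *v v) = 0" by (metis inner_eq_zero_iff)
qed

lemma transpose_mult_form: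
  "v \<bullet> ((transpose A ** M ** A) *v w) = (A *v v) \<bullet> ((M::real^'n^'n) *v (A *v w))"
  unfolding matrix_vector_mul_assoc[symmetric] form_transpose by (rule inner_commute)

text \<open>
  This is the matrix \<open>(1 - \<epsilon> A)\<^sup>T M (1 - \<epsilon> A) + \<epsilon> C\<^sup>T M C\<close>. It agrees with \<open>M + \<epsilon> lyap_op A C M\<close> to
  first order and, in contrast to it, depends on \<open>M\<close> in a positivity preserving way.
\<close>
definition perturb :: "real \<Rightarrow> real^'n^'n \<Rightarrow> real^'n^'n \<Rightarrow> real^'n^'n \<Rightarrow> real^'n^'n" where
  "perturb \<epsilon> A C M = M + \<epsilon> *\<^sub>R lyap_op A C M + \<epsilon>\<^sup>2 *\<^sub>R (transpose A ** M ** A)"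

lemma perturb_form:
  "v \<bullet> (perturb \<epsilon> A C M *v w) = (v - \<epsilon> *\<^sub>R (A *v v)) \<bullet> (M *v (w - \<epsilon> *\<^sub>R (A *v w)))
     + \<epsilon> * ((C *v v) \<bullet> (M *v (C *v w)))"
proof -
  have "v \<bullet> ((transpose A ** M ** A) *v w) = (A *v v) \<bullet> (M *v (A *v w))"
    by (rule transpose_mult_form)
  then show ?thesis
    unfolding perturb_def
    by (simp add: form_simps lyap_op_form power2_eq_square del: matrix_vector_mul_assoc)
       (simp add: algebra_simps)
qed

lemma linear_perturb: "linear (perturb \<epsilon> A C)"
  by (rule linearI) (simp_all add: matrix_eq_iff_form perturb_form form_simps algebra_simps)

lemma pos_semidef_perturb:
  assumes "pos_semidef M" "0 \<le> \<epsilon>" shows "pos_semidef (perturb \<epsilon> A C M)"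
  unfolding pos_semidef_def symmetric_iff_form perturb_form
proof (intro conjI allI)
  fix v w
  show "(v - \<epsilon> *\<^sub>R (A *v v)) \<bullet> (M *v (w - \<epsilon> *\<^sub>R (A *v w))) + \<epsilon> * ((C *v v) \<bullet> (M *v (C *v w))) =
     (w - \<epsilon> *\<^sub>R (A *v w)) \<bullet> (M *v (v - \<epsilon> *\<^sub>R (A *v v))) + \<epsilon> * ((C *v w) \<bullet> (M *v (C *v v)))"
    by (metis form_commute[OF pos_semidef_symmetric[OF assms(1)]])
qed (use assms in \<open>simp add: pos_semidef_def\<close>)

lemma closed_pos_semidef: "closed {M::real^'n^'n. pos_semidef M}"
proof -
  have "{M::real^'n^'n. pos_semidef M} = {M. transpose M = M} \<inter> (\<Inter>v. {M. 0 \<le> v \<bullet> (M *v v)})"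
    by (auto simp: pos_semidef_def)
  moreover have "closed {M::real^'n^'n. transpose M = M}"
    unfolding transpose_def by (intro closed_Collect_eq continuous_intros)
  moreover have "closed {M::real^'n^'n. 0 \<le> v \<bullet> (M *v v)}" for v
    unfolding inner_outer[symmetric] by (intro closed_Collect_le continuous_intros)
  ultimately show ?thesis by (auto intro!: closed_Int closed_INT)
qed

lemma continuous_perturb: "continuous_on X (perturb \<epsilon> A C)"
  by (intro linear_continuous_on linear_linear[THEN iffD2] linear_perturb)

lemma continuous_lyap_op: "continuous_on X (lyap_op A C)"
  by (intro linear_continuous_on linear_linear[THEN iffD2] linear_lyap_op)

lemma pos_semidef_trace_bound:
  fixes M :: "real^'n^'n"
  assumes "pos_semidef M" shows "norm M \<le> real CARD('n) * (mat 1 \<bullet> M)"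
proof -
  have nn: "0 \<le> M$i$i" for i using assms form_axis[of i M i] unfolding pos_semidef_def by metis
  have tr: "mat 1 \<bullet> M = (\<Sum>i\<in>UNIV. M$i$i)"
    by (simp add: inner_vec_def mat_def if_distrib[of "\<lambda>x. x * _"] cong: if_cong)
  have diag: "M$i$i \<le> mat 1 \<bullet> M" for i
    unfolding tr by (rule member_le_sum) (auto simp: nn)
  have entry: "\<bar>M$i$j\<bar> \<le> mat 1 \<bullet> M" for i j
  proof -
    have "(M$i$j)\<^sup>2 \<le> M$i$i * M$j$j"
      using form_Cauchy_Schwarz[OF assms, of "axis i 1" "axis j 1"] by (simp add: form_axis)
    also have "\<dots> \<le> (mat 1 \<bullet> M) * (mat 1 \<bullet> M)" by (intro mult_mono diag nn order_trans[OF nn diag])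
    finally show ?thesis using order_trans[OF nn diag]
      by (metis abs_le_square_iff abs_of_nonneg power2_eq_square)
  qed
  have "M \<bullet> M = (\<Sum>i\<in>UNIV. \<Sum>j\<in>UNIV. (M$i$j)\<^sup>2)"
    by (simp add: inner_vec_def power2_eq_square)
  also have "\<dots> \<le> (\<Sum>i\<in>(UNIV::'n set). \<Sum>j\<in>(UNIV::'n set). (mat 1 \<bullet> M)\<^sup>2)"
    using entry by (intro sum_mono) (simp add: abs_le_square_iff[symmetric] order_trans[OF nn diag])
  also have "\<dots> = (real CARD('n) * (mat 1 \<bullet> M))\<^sup>2" by (simp add: power2_eq_square)
  finally show ?thesis
    using order_trans[OF nn diag] by (simp add: norm_le_square)
qed

text \<open>
  A compact base of the face that \<open>S\<close> generates in the cone of positive semidefinite matrices.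
\<close>
definition trace_one_face :: "real^'n^'n \<Rightarrow> (real^'n^'n) set" where
  "trace_one_face S = {M. pos_semidef M \<and> mat 1 \<bullet> M = 1 \<and> (\<forall>v. S *v v = 0 \<longrightarrow> M *v v = 0)}"

lemma convex_trace_one_face: "convex (trace_one_face S)"
  by (rule convexI)
     (auto simp: trace_one_face_def inner_add_right form_simps
       intro!: pos_semidef_add pos_semidef_scaleR)

lemma compact_trace_one_face: "compact (trace_one_face (S::real^'n^'n))"
  unfolding compact_eq_bounded_closed
proof
  show "bounded (trace_one_face S)"
    using pos_semidef_trace_bound unfolding bounded_iff trace_one_face_def by fastforce
  have "trace_one_face S = {M. pos_semidef M} \<inter> {M. mat 1 \<bullet> M = 1} \<inter> (\<Inter>v\<in>{v. S *v v = 0}. {M. M *v v = 0})"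
    by (auto simp: trace_one_face_def)
  moreover have "closed {M::real^'n^'n. M *v v = 0}" for v
    unfolding matrix_vector_mult_def by (intro closed_Collect_eq continuous_intros)
  moreover have "closed {M::real^'n^'n. mat 1 \<bullet> M = 1}" by (intro closed_Collect_eq continuous_intros)
  ultimately show "closed (trace_one_face S)" 
    using closed_pos_semidef by (auto intro!: closed_Int closed_INT)
qed

lemma trace_one_face_nonempty:
  assumes "pos_semidef S" "S \<noteq> 0" shows "trace_one_face S \<noteq> {}"
proof -
  have "0 < mat 1 \<bullet> S" using inner_pos_def_pos[OF assms pos_def_mat_1] .
  then have "(1 / (mat 1 \<bullet> S)) *\<^sub>R S \<in> trace_one_face S"
    using assms by (auto simp: trace_one_face_def form_simps intro!: pos_semidef_scaleR)
  then show ?thesis by blast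
qed

lemma pos_semidef_transpose_mult:
  assumes "pos_semidef M" shows "pos_semidef (transpose A ** M ** (A::real^'n^'n))"
  using assms form_commute[OF pos_semidef_symmetric[OF assms]]
  unfolding pos_semidef_def symmetric_iff_form transpose_mult_form by blast

text \<open>
  Let \<open>c\<close> be minimal with \<open>H \<le> c S\<close>. Applying \<open>perturb\<close> to both sides gives \<open>\<rho> H \<le> c (1 + \<kappa> \<epsilon>\<^sup>2) S\<close>,
  since \<open>lyap_op A C S \<le> 0\<close>, and minimality of \<open>c\<close> compares the factors.
\<close>
lemma perturb_eigenvalue_bound:
  fixes S :: "real^'n^'n"
  assumes S: "pos_semidef S" "pos_semidef (- lyap_op A C S)"
    and \<kappa>: "\<And>v. v \<bullet> ((transpose A ** S ** A) *v v) \<le> \<kappa> * (v \<bullet> (S *v v))"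
    and H: "pos_semidef H" "H \<noteq> 0" "\<And>v. S *v v = 0 \<Longrightarrow> H *v v = 0"
    and \<epsilon>: "0 < \<epsilon>" and \<rho>: "0 < \<rho>" "perturb \<epsilon> A C H = \<rho> *\<^sub>R H"
  shows "\<rho> \<le> 1 + \<kappa> * \<epsilon>\<^sup>2"
proof -
  define Cs where "Cs = {c. 0 \<le> c \<and> (\<forall>v. v \<bullet> (H *v v) \<le> c * (v \<bullet> (S *v v)))}"
  have Snn: "0 \<le> v \<bullet> (S *v v)" for v using S unfolding pos_semidef_def by blast
  have ne: "Cs \<noteq> {}" 
    by (rule pos_semidef_dominated[OF S(1) H(1) H(3)]) (auto simp: Cs_def)
  have bdd: "bdd_below Cs" unfolding Cs_def by (rule bdd_belowI[of _ 0]) simp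
  have "Cs = {0..} \<inter> (\<Inter>v. {c. v \<bullet> (H *v v) \<le> c * (v \<bullet> (S *v v))})" by (auto simp: Cs_def)
  moreover have "closed {c. v \<bullet> (H *v v) \<le> c * (v \<bullet> (S *v v))}" for v
    by (intro closed_Collect_le continuous_intros)
  ultimately have "closed Cs" by auto
  define c where "c = Inf Cs"
  have c: "c \<in> Cs" unfolding c_def by (rule closed_contains_Inf[OF ne bdd \<open>closed Cs\<close>])
  obtain v0 where v0: "0 < v0 \<bullet> (H *v v0)" using pos_semidef_nonzero_form[OF H(1,2)] .
  have "c \<noteq> 0"
  proof
    assume "c = 0"
    then have "v0 \<bullet> (H *v v0) \<le> 0" using c unfolding Cs_def by auto
    then show False using v0 by simp
  qed
  then have "0 < c" using c unfolding Cs_def by auto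
  have "pos_semidef (c *\<^sub>R S - H)"
    using c form_commute[OF pos_semidef_symmetric[OF S(1)]] form_commute[OF pos_semidef_symmetric[OF H(1)]]
    unfolding pos_semidef_def symmetric_iff_form Cs_def by (simp add: form_simps)
  then have "pos_semidef (perturb \<epsilon> A C (c *\<^sub>R S - H))" using \<epsilon> by (simp add: pos_semidef_perturb)
  then have le: "\<rho> * (v \<bullet> (H *v v)) \<le> c * (v \<bullet> (perturb \<epsilon> A C S *v v))" for v
    unfolding linear_diff[OF linear_perturb] linear_scale[OF linear_perturb] \<rho>(2)
    by (simp add: pos_semidef_def form_simps)
  have GS: "v \<bullet> (perturb \<epsilon> A C S *v v) \<le> (1 + \<kappa> * \<epsilon>\<^sup>2) * (v \<bullet> (S *v v))" for v
  proof -
    have "v \<bullet> (perturb \<epsilon> A C S *v v) = v \<bullet> (S *v v) + \<epsilon> * (v \<bullet> (lyap_op A C S *v v))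
        + \<epsilon>\<^sup>2 * (v \<bullet> ((transpose A ** S ** A) *v v))"
      unfolding perturb_def by (simp add: matrix_vector_mult_add_rdistrib inner_add_right
          scaleR_matrix_vector_assoc[symmetric])
    moreover have "\<epsilon> * (v \<bullet> (lyap_op A C S *v v)) \<le> 0"
      using S(2) \<epsilon> unfolding pos_semidef_def minus_form by (simp add: mult_nonneg_nonpos)
    moreover have "\<epsilon>\<^sup>2 * (v \<bullet> ((transpose A ** S ** A) *v v)) \<le> \<epsilon>\<^sup>2 * (\<kappa> * (v \<bullet> (S *v v)))"
      by (intro mult_left_mono \<kappa>) simp
    ultimately show ?thesis by (simp add: algebra_simps)
  qed
  have le2: "v \<bullet> (H *v v) \<le> (c * (1 + \<kappa> * \<epsilon>\<^sup>2) / \<rho>) * (v \<bullet> (S *v v))" for v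
  proof -
    have "\<rho> * (v \<bullet> (H *v v)) \<le> c * ((1 + \<kappa> * \<epsilon>\<^sup>2) * (v \<bullet> (S *v v)))"
      using order_trans[OF le mult_left_mono[OF GS]] \<open>0 < c\<close> by simp
    then show ?thesis using \<rho>(1) by (simp add: field_simps)
  qed
  have "0 < 1 + \<kappa> * \<epsilon>\<^sup>2"
  proof -
    have "0 < c * ((1 + \<kappa> * \<epsilon>\<^sup>2) * (v0 \<bullet> (S *v v0)))"
      using order_trans[OF le mult_left_mono[OF GS], of v0] \<open>0 < c\<close> mult_pos_pos[OF \<rho>(1) v0] by simp
    then show ?thesis using \<open>0 < c\<close> Snn[of v0] by (simp add: zero_less_mult_iff)
  qed
  then have "c * (1 + \<kappa> * \<epsilon>\<^sup>2) / \<rho> \<in> Cs" using le2 \<open>0 < c\<close> \<rho>(1) unfolding Cs_def by simp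
  then have "c \<le> c * (1 + \<kappa> * \<epsilon>\<^sup>2) / \<rho>" unfolding c_def by (rule cInf_lower[OF _ bdd])
  then have "c * \<rho> \<le> c * (1 + \<kappa> * \<epsilon>\<^sup>2)" using \<rho>(1) by (simp add: field_simps)
  then show ?thesis using \<open>0 < c\<close> by simp
qed

text \<open>
  A Perron-Frobenius theorem on the face of \<open>S\<close>. This face is invariant because the kernel of \<open>S\<close> is
  invariant under \<open>A\<close> and \<open>C\<close>. Brouwer's theorem for the normalised \<open>perturb\<close> gives eigenvectors
  \<open>H\<^sub>\<epsilon>\<close> with eigenvalues \<open>\<rho>\<close> for which \<open>(\<rho> - 1) / \<epsilon> \<le> \<kappa> \<epsilon>\<close>; as \<open>\<epsilon>\<close> tends to zero, a limit
  point of them is the eigenvector sought.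
\<close>
lemma lyap_nonpos_eigenvalue:
  fixes S :: "real^'n^'n"
  assumes S: "pos_semidef S" "S \<noteq> 0" "pos_semidef (- lyap_op A C S)"
  shows "\<exists>H \<mu>. pos_semidef H \<and> H \<noteq> 0 \<and> lyap_op A C H = \<mu> *\<^sub>R H \<and> \<mu> \<le> 0"
proof -
  define X where "X = trace_one_face S"
  note X = compact_trace_one_face[of S, folded X_def] convex_trace_one_face[of S, folded X_def]
    trace_one_face_nonempty[OF S(1,2), folded X_def]
  define tl where "tl M = mat 1 \<bullet> lyap_op A C M" for M
  define R where "R M = transpose A ** M ** A" for M
  have cont_tl: "continuous_on Y tl" for Y
    unfolding tl_def by (intro continuous_intros continuous_lyap_op)
  have Rlin: "linear R"
    unfolding R_def by (rule linearI) (simp_all add: matrix_eq_iff_form transpose_mult_form form_simps del: matrix_vector_mul_assoc)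
  have cont_R: "continuous_on Y R" for Y
    by (intro linear_continuous_on linear_linear[THEN iffD2] Rlin)
  have "bounded (tl ` X)" by (intro compact_imp_bounded compact_continuous_image cont_tl X)
  then obtain c where c: "\<And>M. M \<in> X \<Longrightarrow> \<bar>tl M\<bar> \<le> c" "0 < c"
    unfolding bounded_pos by (auto simp: real_norm_def)
  have ker: "S *v (C *v v) = 0" "S *v (A *v v) = 0" if "S *v v = 0" for v
    using kernel_invariant[OF S(1,3) that] .
  have "R S *v v = 0" if "S *v v = 0" for v
    using ker[OF that] unfolding R_def by (simp add: matrix_vector_mul_assoc[symmetric] del: transpose_matrix_vector)
  moreover have "pos_semidef (R S)" unfolding R_def by (rule pos_semidef_transpose_mult[OF S(1)])
  ultimately obtain \<kappa> where \<kappa>: "0 \<le> \<kappa>" "\<And>v. v \<bullet> (R S *v v) \<le> \<kappa> * (v \<bullet> (S *v v))"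
    using pos_semidef_dominated[OF S(1), of "R S"] by metis
  have X1: "mat 1 \<bullet> M = 1" "pos_semidef M" "\<And>v. S *v v = 0 \<Longrightarrow> M *v v = 0" "M \<noteq> 0" if "M \<in> X" for M
    using that unfolding X_def trace_one_face_def by auto
  have approx: "\<exists>H\<in>X. \<exists>l. l \<le> \<kappa> * \<epsilon> \<and> lyap_op A C H + \<epsilon> *\<^sub>R R H = l *\<^sub>R H"
    if \<epsilon>: "0 < \<epsilon>" "\<epsilon> * c < 1" for \<epsilon>
  proof -
    define \<tau> where "\<tau> M = mat 1 \<bullet> perturb \<epsilon> A C M" for M
    have \<tau>: "0 < \<tau> M" if "M \<in> X" for M
    proof -
      have "\<tau> M = 1 + \<epsilon> * tl M + \<epsilon>\<^sup>2 * (mat 1 \<bullet> R M)"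
        unfolding \<tau>_def perturb_def tl_def R_def using X1(1)[OF that] by (simp add: inner_add_right)
      moreover have "0 \<le> \<epsilon>\<^sup>2 * (mat 1 \<bullet> R M)"
        unfolding R_def using X1(2)[OF that]
        by (simp add: inner_pos_semidef_nonneg pos_semidef_transpose_mult pos_def_imp_semidef pos_def_mat_1)
      moreover have "\<epsilon> * - tl M \<le> \<epsilon> * c" using c(1)[OF that] \<epsilon> by (intro mult_left_mono) auto
      ultimately show ?thesis using \<epsilon> by simp
    qed
    define f where "f M = (1 / \<tau> M) *\<^sub>R perturb \<epsilon> A C M" for M
    have "continuous_on X f"
      unfolding f_def \<tau>_def using \<tau> unfolding \<tau>_def
      by (intro continuous_intros continuous_perturb) (metis less_irrefl)
    moreover have "f \<in> X \<rightarrow> X"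
    proof
      fix M assume M: "M \<in> X"
      have "perturb \<epsilon> A C M *v v = 0" if "S *v v = 0" for v
      proof -
        have "w \<bullet> (perturb \<epsilon> A C M *v v) = 0" for w
          unfolding perturb_form using ker[OF that] X1(3)[OF M] that by (simp add: form_simps)
        then show ?thesis by (metis inner_eq_zero_iff)
      qed
      then show "f M \<in> X"
        using \<tau>[OF M] X1(2)[OF M] \<epsilon> unfolding f_def X_def trace_one_face_def
        by (simp add: form_simps pos_semidef_scaleR pos_semidef_perturb \<tau>_def)
    qed
    ultimately obtain H where H: "H \<in> X" "f H = H" using brouwer[OF X] by metis
    have \<rho>: "perturb \<epsilon> A C H = \<tau> H *\<^sub>R H"
    proof -
      have "\<tau> H *\<^sub>R f H = perturb \<epsilon> A C H" using \<tau>[OF H(1)] by (simp add: f_def)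
      then show ?thesis using H(2) by simp
    qed
    have "\<tau> H \<le> 1 + \<kappa> * \<epsilon>\<^sup>2"
      using perturb_eigenvalue_bound[OF S(1,3) _ X1(2,4,3)[OF H(1)] \<epsilon>(1) \<tau>[OF H(1)] \<rho>] \<kappa>(2)
      unfolding R_def by blast
    then have "(\<tau> H - 1) / \<epsilon> \<le> \<kappa> * \<epsilon>" using \<epsilon>(1) by (simp add: field_simps power2_eq_square)
    moreover have "lyap_op A C H + \<epsilon> *\<^sub>R R H = ((\<tau> H - 1) / \<epsilon>) *\<^sub>R H"
    proof -
      have "\<epsilon> *\<^sub>R (lyap_op A C H + \<epsilon> *\<^sub>R R H) = perturb \<epsilon> A C H - H"
        by (simp add: perturb_def R_def scaleR_add_right power2_eq_square)
      also have "\<dots> = (\<tau> H - 1) *\<^sub>R H" unfolding \<rho> by (simp add: scaleR_diff_left)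
      finally have "\<epsilon> *\<^sub>R (lyap_op A C H + \<epsilon> *\<^sub>R R H) = (\<tau> H - 1) *\<^sub>R H" .
      then have "(1 / \<epsilon>) *\<^sub>R \<epsilon> *\<^sub>R (lyap_op A C H + \<epsilon> *\<^sub>R R H) = (1 / \<epsilon>) *\<^sub>R (\<tau> H - 1) *\<^sub>R H" by simp
      then show ?thesis using \<epsilon>(1) by simp
    qed
    ultimately show ?thesis using H(1) by blast
  qed
  \<comment> \<open>the factor \<open>1 / (c + 1)\<close> keeps \<open>e k * c < 1\<close>, so that the trace of \<open>perturb\<close> stays positive\<close>
  define e where "e k = 1 / (c + 1) / real (Suc k)" for k
  have e: "0 < e k" "e k * c < 1" for k
  proof -
    show "0 < e k" using c(2) by (simp add: e_def)
    have "(c + 1) * 1 \<le> (c + 1) * real (Suc k)" using c(2) by (intro mult_left_mono) auto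
    then have "c < (c + 1) * real (Suc k)" by simp
    then show "e k * c < 1" using c(2) by (simp add: e_def field_simps)
  qed
  have e0: "e \<longlonglongrightarrow> 0" unfolding e_def
    by (rule real_tendsto_divide_at_top[OF tendsto_const])
       (rule filterlim_compose[OF filterlim_real_sequentially filterlim_Suc])
  obtain Hs ls where Hs: "\<And>k. Hs k \<in> X" "\<And>k. ls k \<le> \<kappa> * e k"
    "\<And>k. lyap_op A C (Hs k) + e k *\<^sub>R R (Hs k) = ls k *\<^sub>R Hs k"
    using approx[OF e] by metis
  obtain H r where H: "H \<in> X" "strict_mono r" "(Hs \<circ> r) \<longlonglongrightarrow> H"
    using X(1) Hs(1) unfolding compact_def by metis
  have lim_e: "(\<lambda>k. e (r k)) \<longlonglongrightarrow> 0" using LIMSEQ_subseq_LIMSEQ[OF e0 H(2)] by (simp add: o_def)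
  have lim_H: "(\<lambda>k. Hs (r k)) \<longlonglongrightarrow> H" using H(3) by (simp add: o_def)
  have lim_L: "(\<lambda>k. lyap_op A C (Hs (r k))) \<longlonglongrightarrow> lyap_op A C H"
    using continuous_on_tendsto_compose[OF continuous_lyap_op[of UNIV] lim_H] by simp
  have lim_R: "(\<lambda>k. R (Hs (r k))) \<longlonglongrightarrow> R H"
    using continuous_on_tendsto_compose[OF cont_R[of UNIV] lim_H] by simp
  have lim: "(\<lambda>k. lyap_op A C (Hs (r k)) + e (r k) *\<^sub>R R (Hs (r k))) \<longlonglongrightarrow> lyap_op A C H"
    using tendsto_add[OF lim_L tendsto_scaleR[OF lim_e lim_R]] by simp
  have "ls k = mat 1 \<bullet> (lyap_op A C (Hs k) + e k *\<^sub>R R (Hs k))" for k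
    unfolding Hs(3) by (simp add: X1(1)[OF Hs(1)])
  then have lim_l: "(\<lambda>k. ls (r k)) \<longlonglongrightarrow> tl H"
    using tendsto_inner[OF tendsto_const[of "mat 1"] lim] by (simp add: tl_def)
  have "(\<lambda>k. ls (r k) *\<^sub>R Hs (r k)) \<longlonglongrightarrow> tl H *\<^sub>R H" by (rule tendsto_scaleR[OF lim_l lim_H])
  then have "lyap_op A C H = tl H *\<^sub>R H" using lim unfolding Hs(3) by (rule LIMSEQ_unique[symmetric])
  moreover have "tl H \<le> \<kappa> * 0"
    by (rule tendsto_le[OF _ tendsto_mult[OF tendsto_const lim_e] lim_l]) (use Hs(2) in auto)
  ultimately show ?thesis using X1(2,4)[OF H(1)] by auto
qed

section \<open>Square integrable functions\<close>

definition sq_int :: "'a measure \<Rightarrow> ('a \<Rightarrow> 'b::euclidean_space) \<Rightarrow> bool" where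
  "sq_int M f \<longleftrightarrow> f \<in> borel_measurable M \<and> integrable M (\<lambda>x. (norm (f x))\<^sup>2)"

lemma sq_intD:
  assumes "sq_int M f"
  shows "f \<in> borel_measurable M" "integrable M (\<lambda>x. (norm (f x))\<^sup>2)"
  using assms unfolding sq_int_def by auto

declare sq_intD(1)[measurable_dest]

lemma norm_add_sq_le: "(norm (a + b :: 'a::real_normed_vector))\<^sup>2 \<le> 2 * (norm a)\<^sup>2 + 2 * (norm b)\<^sup>2"
proof -
  have "(norm (a + b))\<^sup>2 \<le> (norm a + norm b)\<^sup>2" by (intro power_mono norm_triangle_ineq) simp
  also have "\<dots> \<le> 2 * (norm a)\<^sup>2 + 2 * (norm b)\<^sup>2"
    using sum_squares_bound[of "norm a" "norm b"] by (simp add: power2_sum)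
  finally show ?thesis .
qed

lemma norm_diff_sq_le: "(norm (a - b :: 'a::real_normed_vector))\<^sup>2 \<le> 2 * (norm a)\<^sup>2 + 2 * (norm b)\<^sup>2"
  using norm_add_sq_le[of a "- b"] by simp

lemma sq_int_dominated:
  fixes f :: "'a \<Rightarrow> 'b::euclidean_space"
  assumes "f \<in> borel_measurable M" "integrable M g" "\<And>x. x \<in> space M \<Longrightarrow> (norm (f x))\<^sup>2 \<le> g x"
  shows "sq_int M f"
  unfolding sq_int_def
proof
  show "integrable M (\<lambda>x. (norm (f x))\<^sup>2)"
  proof (rule Bochner_Integration.integrable_bound[OF assms(2)])
    show "AE x in M. norm ((norm (f x))\<^sup>2) \<le> norm (g x)"
      using assms(3) by (intro AE_I2) (auto intro: order_trans[OF _ abs_ge_self])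
  qed (use assms(1) in measurable)
qed (rule assms(1))

lemma sq_int_add:
  assumes "sq_int M f" "sq_int M g" shows "sq_int M (\<lambda>x. f x + g x)"
  by (rule sq_int_dominated[where g = "\<lambda>x. 2 * (norm (f x))\<^sup>2 + 2 * (norm (g x))\<^sup>2"])
     (use assms sq_intD(2)[OF assms(1)] sq_intD(2)[OF assms(2)] in \<open>auto simp: norm_add_sq_le\<close>)

lemma sq_int_diff:
  assumes "sq_int M f" "sq_int M g" shows "sq_int M (\<lambda>x. f x - g x)"
  by (rule sq_int_dominated[where g = "\<lambda>x. 2 * (norm (f x))\<^sup>2 + 2 * (norm (g x))\<^sup>2"])
     (use assms sq_intD(2)[OF assms(1)] sq_intD(2)[OF assms(2)] in \<open>auto simp: norm_diff_sq_le\<close>)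

lemma sq_int_zero [simp]: "sq_int M (\<lambda>x. 0)"
  by (simp add: sq_int_def)

lemma sq_int_scaleR:
  assumes "sq_int M f" shows "sq_int M (\<lambda>x. c *\<^sub>R f x)"
  using assms by (auto simp: sq_int_def power_mult_distrib)

lemma sq_int_sum:
  assumes "\<And>i. i \<in> I \<Longrightarrow> sq_int M (f i)" shows "sq_int M (\<lambda>x. \<Sum>i\<in>I. f i x)"
  using assms by (induction I rule: infinite_finite_induct) (auto intro: sq_int_add)

lemma norm_bounded_linear_sq_le:
  assumes "bounded_linear h" shows "(norm (h x))\<^sup>2 \<le> (onorm h)\<^sup>2 * (norm x)\<^sup>2"
  unfolding power_mult_distrib[symmetric] by (intro power_mono onorm[OF assms]) simp

lemma sq_int_bounded_linear:
  assumes h: "bounded_linear h" and f: "sq_int M f" shows "sq_int M (\<lambda>x. h (f x))"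
proof (rule sq_int_dominated)
  have "h \<in> borel_measurable borel"
    using linear_continuous_on[OF h] by (rule borel_measurable_continuous_onI)
  then show "(\<lambda>x. h (f x)) \<in> borel_measurable M" using sq_intD(1)[OF f] by measurable
  show "integrable M (\<lambda>x. (onorm h)\<^sup>2 * (norm (f x))\<^sup>2)" using sq_intD(2)[OF f] by simp
  show "(norm (h (f x)))\<^sup>2 \<le> (onorm h)\<^sup>2 * (norm (f x))\<^sup>2" for x
    by (rule norm_bounded_linear_sq_le[OF h])
qed

lemma sq_int_matrix:
  fixes S :: "real^'n^'m"
  shows "sq_int M f \<Longrightarrow> sq_int M (\<lambda>x. S *v f x)"
  by (rule sq_int_bounded_linear[OF matrix_vector_mul_bounded_linear])

lemma (in finite_measure) sq_int_bounded:
  fixes f :: "'a \<Rightarrow> 'b::euclidean_space"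
  assumes "f \<in> borel_measurable M" "\<And>x. x \<in> space M \<Longrightarrow> norm (f x) \<le> B"
  shows "sq_int M f"
proof (rule sq_int_dominated)
  show "integrable M (\<lambda>x. B\<^sup>2)" by simp
  show "(norm (f x))\<^sup>2 \<le> B\<^sup>2" if "x \<in> space M" for x using assms(2)[OF that] by (simp add: power_mono)
qed (rule assms(1))

lemma sq_int_cong_AE:
  assumes "sq_int M f" "g \<in> borel_measurable M" "AE x in M. f x = g x"
  shows "sq_int M g"
  unfolding sq_int_def
proof
  show "integrable M (\<lambda>x. (norm (g x))\<^sup>2)"
    by (rule integrable_cong_AE_imp[OF sq_intD(2)[OF assms(1)]])
       (use assms in auto)
qed (rule assms(2))

lemma sq_int_iff_nn_integral:
  fixes f :: "'a \<Rightarrow> 'b::euclidean_space"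
  assumes "f \<in> borel_measurable M"
  shows "sq_int M f \<longleftrightarrow> (\<integral>\<^sup>+x. ennreal ((norm (f x))\<^sup>2) \<partial>M) < \<infinity>"
proof -
  have "(\<lambda>x. (norm (f x))\<^sup>2) \<in> borel_measurable M" using assms by measurable
  then show ?thesis using assms by (simp add: sq_int_def integrable_iff_bounded)
qed

lemma sq_int_nn_integral:
  assumes "sq_int M f"
  shows "(\<integral>\<^sup>+x. ennreal ((norm (f x))\<^sup>2) \<partial>M) = ennreal (\<integral>x. (norm (f x))\<^sup>2 \<partial>M)"
  by (rule nn_integral_eq_integral) (use assms in \<open>auto dest: sq_intD\<close>)

lemma integrable_inner:
  assumes f: "sq_int M f" and g: "sq_int M g" shows "integrable M (\<lambda>x. f x \<bullet> g x)"
proof (rule Bochner_Integration.integrable_bound)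
  show "integrable M (\<lambda>x. (norm (f x))\<^sup>2 + (norm (g x))\<^sup>2)" using f g by (auto dest: sq_intD)
  show "(\<lambda>x. f x \<bullet> g x) \<in> borel_measurable M" using f g by measurable
  show "AE x in M. norm (f x \<bullet> g x) \<le> norm ((norm (f x))\<^sup>2 + (norm (g x))\<^sup>2)"
  proof (intro AE_I2)
    fix x
    have "\<bar>f x \<bullet> g x\<bar> \<le> norm (f x) * norm (g x)" by (rule Cauchy_Schwarz_ineq2)
    also have "\<dots> \<le> (norm (f x))\<^sup>2 + (norm (g x))\<^sup>2"
      using sum_squares_bound[of "norm (f x)" "norm (g x)"] mult_nonneg_nonneg[OF norm_ge_zero norm_ge_zero, of "f x" "g x"]
      by linarith
    finally show "norm (f x \<bullet> g x) \<le> norm ((norm (f x))\<^sup>2 + (norm (g x))\<^sup>2)" by simp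
  qed
qed

lemma norm_scaleR_add_scaleR_sq:
  "(norm (s *\<^sub>R a + t *\<^sub>R b :: 'a::real_inner))\<^sup>2 = s\<^sup>2 * (norm a)\<^sup>2 + 2 * s * t * (a \<bullet> b) + t\<^sup>2 * (norm b)\<^sup>2"
  unfolding power2_norm_eq_inner
  by (simp add: inner_add_left inner_add_right inner_commute[of b a] power2_eq_square algebra_simps)

lemma integral_Cauchy_Schwarz:
  assumes f: "sq_int M f" and g: "sq_int M g"
  shows "(\<integral>x. f x \<bullet> g x \<partial>M)\<^sup>2 \<le> (\<integral>x. (norm (f x))\<^sup>2 \<partial>M) * (\<integral>x. (norm (g x))\<^sup>2 \<partial>M)"
proof (rule quadratic_discriminant)
  fix s t :: real
  have "0 \<le> (\<integral>x. (norm (s *\<^sub>R f x + t *\<^sub>R g x))\<^sup>2 \<partial>M)" by simp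
  also have "\<dots> = (\<integral>x. s\<^sup>2 * (norm (f x))\<^sup>2 + 2 * s * t * (f x \<bullet> g x) + t\<^sup>2 * (norm (g x))\<^sup>2 \<partial>M)"
    by (intro Bochner_Integration.integral_cong)
       (simp_all add: norm_scaleR_add_scaleR_sq)
  also have "\<dots> = s\<^sup>2 * (\<integral>x. (norm (f x))\<^sup>2 \<partial>M) + 2 * s * t * (\<integral>x. f x \<bullet> g x \<partial>M) + t\<^sup>2 * (\<integral>x. (norm (g x))\<^sup>2 \<partial>M)"
    using sq_intD(2)[OF f] sq_intD(2)[OF g] integrable_inner[OF f g] by simp
  finally show "0 \<le> s\<^sup>2 * (\<integral>x. (norm (f x))\<^sup>2 \<partial>M) + 2 * s * t * (\<integral>x. f x \<bullet> g x \<partial>M) + t\<^sup>2 * (\<integral>x. (norm (g x))\<^sup>2 \<partial>M)" .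
qed

definition L2_lim :: "'a measure \<Rightarrow> (nat \<Rightarrow> 'a \<Rightarrow> 'b::euclidean_space) \<Rightarrow> ('a \<Rightarrow> 'b) \<Rightarrow> bool" where
  "L2_lim M g f \<longleftrightarrow> (\<forall>m. sq_int M (g m)) \<and> sq_int M f \<and>
     (\<lambda>m. \<integral>x. (norm (f x - g m x))\<^sup>2 \<partial>M) \<longlonglongrightarrow> 0"

text \<open>
  That the distance is finite for some \<open>m\<close> already makes \<open>f\<close> square integrable.
\<close>
lemma L2_limI_nn:
  fixes f :: "'a \<Rightarrow> 'b::euclidean_space"
  assumes g: "\<And>m. sq_int M (g m)" and f: "f \<in> borel_measurable M"
    and lim: "(\<lambda>m. \<integral>\<^sup>+x. ennreal ((norm (f x - g m x))\<^sup>2) \<partial>M) \<longlonglongrightarrow> 0"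
  shows "L2_lim M g f"
proof -
  have meas: "(\<lambda>x. f x - g m x) \<in> borel_measurable M" for m using f sq_intD(1)[OF g] by measurable
  have "eventually (\<lambda>m. (\<integral>\<^sup>+x. ennreal ((norm (f x - g m x))\<^sup>2) \<partial>M) < 1) sequentially"
    using order_tendstoD(2)[OF lim, of 1] by simp
  then obtain m where "(\<integral>\<^sup>+x. ennreal ((norm (f x - g m x))\<^sup>2) \<partial>M) < 1"
    unfolding eventually_sequentially by blast
  then have "sq_int M (\<lambda>x. f x - g m x)"
    unfolding sq_int_iff_nn_integral[OF meas] using ennreal_one_less_top less_trans by fastforce
  from sq_int_add[OF this g[of m]] have fs: "sq_int M f" by simp
  have "(\<lambda>m. ennreal (\<integral>x. (norm (f x - g m x))\<^sup>2 \<partial>M)) \<longlonglongrightarrow> 0"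
    using lim unfolding sq_int_nn_integral[OF sq_int_diff[OF fs g]] .
  then show ?thesis using g fs unfolding L2_lim_def by (subst (asm) ennreal_tendsto_0_iff) auto
qed

lemma L2_limD:
  assumes "L2_lim M g f"
  shows "sq_int M (g m)" "sq_int M f" "(\<lambda>m. \<integral>x. (norm (f x - g m x))\<^sup>2 \<partial>M) \<longlonglongrightarrow> 0"
  using assms unfolding L2_lim_def by auto

lemma tendsto_0_if_sq_le:
  fixes a b :: "nat \<Rightarrow> real"
  assumes "\<And>m. (a m)\<^sup>2 \<le> b m" "b \<longlonglongrightarrow> 0" shows "a \<longlonglongrightarrow> 0"
proof -
  have "(\<lambda>m. (a m)\<^sup>2) \<longlonglongrightarrow> 0"
    by (rule tendsto_sandwich[OF _ _ tendsto_const assms(2)]) (auto simp: assms(1))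
  then have "(\<lambda>m. sqrt ((a m)\<^sup>2)) \<longlonglongrightarrow> sqrt 0" by (rule tendsto_real_sqrt)
  then show ?thesis by (simp add: tendsto_rabs_zero_iff)
qed

text \<open>
  The isometry and the martingale property of the Ito integral are bilinear identities between simple
  integrands; this continuity extends them to limits.
\<close>
lemma L2_lim_inner:
  assumes f: "L2_lim M fm f" and g: "L2_lim M gm g"
  shows "(\<lambda>m. \<integral>x. fm m x \<bullet> gm m x \<partial>M) \<longlonglongrightarrow> (\<integral>x. f x \<bullet> g x \<partial>M)"
proof -
  note sq = L2_limD(1,2)[OF f] L2_limD(1,2)[OF g]
  let ?d = "\<lambda>m x. f x - fm m x" and ?e = "\<lambda>m x. g x - gm m x"
  have sqd: "sq_int M (?d m)" "sq_int M (?e m)" for m by (intro sq_int_diff sq)+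
  have ed: "(\<lambda>m. \<integral>x. ?d m x \<bullet> ?e m x \<partial>M) \<longlonglongrightarrow> 0"
    by (rule tendsto_0_if_sq_le[OF integral_Cauchy_Schwarz[OF sqd]])
       (use tendsto_mult[OF L2_limD(3)[OF f] L2_limD(3)[OF g]] in simp)
  have dg: "(\<lambda>m. \<integral>x. ?d m x \<bullet> g x \<partial>M) \<longlonglongrightarrow> 0"
    by (rule tendsto_0_if_sq_le[OF integral_Cauchy_Schwarz[OF sqd(1) sq(4)]])
       (use tendsto_mult[OF L2_limD(3)[OF f] tendsto_const] in simp)
  have fe: "(\<lambda>m. \<integral>x. f x \<bullet> ?e m x \<partial>M) \<longlonglongrightarrow> 0"
    by (rule tendsto_0_if_sq_le[OF integral_Cauchy_Schwarz[OF sq(2) sqd(2)]])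
       (use tendsto_mult[OF tendsto_const L2_limD(3)[OF g]] in simp)
  have "(\<integral>x. fm m x \<bullet> gm m x \<partial>M) = (\<integral>x. f x \<bullet> g x \<partial>M) - (\<integral>x. ?d m x \<bullet> g x \<partial>M)
      - (\<integral>x. f x \<bullet> ?e m x \<partial>M) + (\<integral>x. ?d m x \<bullet> ?e m x \<partial>M)" for m
  proof -
    have "(\<integral>x. fm m x \<bullet> gm m x \<partial>M) =
      (\<integral>x. f x \<bullet> g x - ?d m x \<bullet> g x - f x \<bullet> ?e m x + ?d m x \<bullet> ?e m x \<partial>M)"
      by (intro Bochner_Integration.integral_cong) (simp_all add: inner_diff_left inner_diff_right)
    also have "\<dots> = (\<integral>x. f x \<bullet> g x \<partial>M) - (\<integral>x. ?d m x \<bullet> g x \<partial>M)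
      - (\<integral>x. f x \<bullet> ?e m x \<partial>M) + (\<integral>x. ?d m x \<bullet> ?e m x \<partial>M)"
      using integrable_inner[OF sq(2,4)] integrable_inner[OF sqd(1) sq(4)] integrable_inner[OF sq(2) sqd(2)]
        integrable_inner[OF sqd] by simp
    finally show ?thesis .
  qed
  moreover have "(\<lambda>m. (\<integral>x. f x \<bullet> g x \<partial>M) - (\<integral>x. ?d m x \<bullet> g x \<partial>M)
      - (\<integral>x. f x \<bullet> ?e m x \<partial>M) + (\<integral>x. ?d m x \<bullet> ?e m x \<partial>M)) \<longlonglongrightarrow> (\<integral>x. f x \<bullet> g x \<partial>M) - 0 - 0 + 0"
    by (intro tendsto_intros ed dg fe)
  ultimately show ?thesis by simp
qed

lemma L2_lim_const: "sq_int M f \<Longrightarrow> L2_lim M (\<lambda>m. f) f"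
  by (simp add: L2_lim_def)

lemma L2_lim_bounded_linear:
  assumes h: "bounded_linear h" and f: "L2_lim M fm f"
  shows "L2_lim M (\<lambda>m x. h (fm m x)) (\<lambda>x. h (f x))"
  unfolding L2_lim_def
proof (intro conjI allI sq_int_bounded_linear[OF h] L2_limD[OF f])
  interpret h: bounded_linear h by (rule h)
  show "(\<lambda>m. \<integral>x. (norm (h (f x) - h (fm m x)))\<^sup>2 \<partial>M) \<longlonglongrightarrow> 0"
  proof (rule tendsto_sandwich[OF _ _ tendsto_const])
    show "\<forall>\<^sub>F m in sequentially. (\<integral>x. (norm (h (f x) - h (fm m x)))\<^sup>2 \<partial>M)
        \<le> (onorm h)\<^sup>2 * (\<integral>x. (norm (f x - fm m x))\<^sup>2 \<partial>M)"
    proof (intro always_eventually allI)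
      fix m
      have sq: "sq_int M (\<lambda>x. f x - fm m x)" by (intro sq_int_diff L2_limD[OF f])
      have "(\<integral>x. (norm (h (f x - fm m x)))\<^sup>2 \<partial>M) \<le> (\<integral>x. (onorm h)\<^sup>2 * (norm (f x - fm m x))\<^sup>2 \<partial>M)"
        using sq_intD(2)[OF sq] sq_intD(2)[OF sq_int_bounded_linear[OF h sq]]
        by (intro integral_mono) (auto simp: power_mult_distrib intro!: norm_bounded_linear_sq_le h)
      then show "(\<integral>x. (norm (h (f x) - h (fm m x)))\<^sup>2 \<partial>M)
        \<le> (onorm h)\<^sup>2 * (\<integral>x. (norm (f x - fm m x))\<^sup>2 \<partial>M)" by (simp add: h.diff)
    qed
    show "(\<lambda>m. (onorm h)\<^sup>2 * (\<integral>x. (norm (f x - fm m x))\<^sup>2 \<partial>M)) \<longlonglongrightarrow> 0"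
      using tendsto_mult[OF tendsto_const L2_limD(3)[OF f]] by simp
  qed simp
qed

lemma integral_norm_diff_sq_le:
  assumes "sq_int M f" "sq_int M g" "sq_int M h"
  shows "(\<integral>x. (norm (f x - h x))\<^sup>2 \<partial>M) \<le> 2 * (\<integral>x. (norm (f x - g x))\<^sup>2 \<partial>M) + 2 * (\<integral>x. (norm (g x - h x))\<^sup>2 \<partial>M)"
proof -
  note i = sq_intD(2)[OF sq_int_diff[OF assms(1,2)]] sq_intD(2)[OF sq_int_diff[OF assms(2,3)]]
    sq_intD(2)[OF sq_int_diff[OF assms(1,3)]]
  have "(\<integral>x. (norm (f x - h x))\<^sup>2 \<partial>M) \<le> (\<integral>x. 2 * (norm (f x - g x))\<^sup>2 + 2 * (norm (g x - h x))\<^sup>2 \<partial>M)"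
  proof (rule integral_mono)
    show "(norm (f x - h x))\<^sup>2 \<le> 2 * (norm (f x - g x))\<^sup>2 + 2 * (norm (g x - h x))\<^sup>2" for x
      using norm_add_sq_le[of "f x - g x" "g x - h x"] by simp
  qed (use i in simp_all)
  also have "\<dots> = 2 * (\<integral>x. (norm (f x - g x))\<^sup>2 \<partial>M) + 2 * (\<integral>x. (norm (g x - h x))\<^sup>2 \<partial>M)"
    using i by simp
  finally show ?thesis .
qed

lemma L2_lim_replace:
  assumes f: "L2_lim M fm f" and g: "\<And>m. sq_int M (gm m)"
    and lim: "(\<lambda>m. \<integral>x. (norm (fm m x - gm m x))\<^sup>2 \<partial>M) \<longlonglongrightarrow> 0"
  shows "L2_lim M gm f"
  unfolding L2_lim_def
proof (intro conjI allI g L2_limD[OF f])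
  let ?u = "\<lambda>m. 2 * (\<integral>x. (norm (f x - fm m x))\<^sup>2 \<partial>M) + 2 * (\<integral>x. (norm (fm m x - gm m x))\<^sup>2 \<partial>M)"
  have u: "?u \<longlonglongrightarrow> 0"
    using tendsto_add[OF tendsto_mult[OF tendsto_const L2_limD(3)[OF f]] tendsto_mult[OF tendsto_const lim]] by simp
  show "(\<lambda>m. \<integral>x. (norm (f x - gm m x))\<^sup>2 \<partial>M) \<longlonglongrightarrow> 0"
  proof (rule tendsto_sandwich[OF _ _ tendsto_const u])
    show "\<forall>\<^sub>F m in sequentially. (\<integral>x. (norm (f x - gm m x))\<^sup>2 \<partial>M) \<le> ?u m"
      by (intro always_eventually allI integral_norm_diff_sq_le L2_limD[OF f] g)
  qed simp
qed

section \<open>Increments of Brownian motion\<close>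

lemma integral_add4:
  fixes f1 f2 f3 f4 :: "'a \<Rightarrow> real"
  assumes "integrable M f1" "integrable M f2" "integrable M f3" "integrable M f4"
  shows "(\<integral>x. f1 x + f2 x + f3 x + f4 x \<partial>M) = (\<integral>x. f1 x \<partial>M) + (\<integral>x. f2 x \<partial>M) + (\<integral>x. f3 x \<partial>M) + (\<integral>x. f4 x \<partial>M)"
  using assms by simp

locale brownian =
  fixes M :: "'a measure" and F :: "real \<Rightarrow> 'a measure" and W :: "real \<Rightarrow> 'a \<Rightarrow> real"
  assumes bm: "std_brownian_motion M F W"

sublocale brownian \<subseteq> prob_space M
  using bm unfolding std_brownian_motion_def by blast

context brownian
begin

lemma subalgebra_F: "0 \<le> t \<Longrightarrow> subalgebra M (F t)"
  using bm unfolding std_brownian_motion_def filtration_on_def by blast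

lemma space_F: "0 \<le> t \<Longrightarrow> space (F t) = space M"
  using subalgebra_F unfolding subalgebra_def by blast

lemma measurable_F: "0 \<le> t \<Longrightarrow> f \<in> measurable (F t) N \<Longrightarrow> f \<in> measurable M N"
  using measurable_from_subalg[OF subalgebra_F] .

lemma measurable_F_mono:
  assumes "0 \<le> s" "s \<le> t" "f \<in> measurable (F s) N" shows "f \<in> measurable (F t) N"
proof (rule measurable_from_subalg[OF _ assms(3)])
  show "subalgebra (F t) (F s)"
    using bm assms(1,2) space_F[of s] space_F[of t]
    unfolding std_brownian_motion_def filtration_on_def subalgebra_def by auto
qed

lemma W_measurable_F: "0 \<le> s \<Longrightarrow> s \<le> t \<Longrightarrow> W s \<in> borel_measurable (F t)"
  using bm measurable_F_mono[of s t "W s"] unfolding std_brownian_motion_def by blast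

lemma W_measurable [measurable]: "0 \<le> t \<Longrightarrow> W t \<in> borel_measurable M"
  using measurable_F[OF _ W_measurable_F] by blast

lemma increment_moments:
  assumes "0 \<le> s" "s < t"
  shows "integrable M (\<lambda>\<omega>. W t \<omega> - W s \<omega>)" "expectation (\<lambda>\<omega>. W t \<omega> - W s \<omega>) = 0"
    "integrable M (\<lambda>\<omega>. (W t \<omega> - W s \<omega>)\<^sup>2)" "expectation (\<lambda>\<omega>. (W t \<omega> - W s \<omega>)\<^sup>2) = t - s"
proof -
  have pos: "0 < sqrt (t - s)" using assms by simp
  have D: "distributed M lborel (\<lambda>\<omega>. W t \<omega> - W s \<omega>) (normal_density 0 (sqrt (t - s)))"
    using bm assms unfolding std_brownian_motion_def by blast
  show "integrable M (\<lambda>\<omega>. W t \<omega> - W s \<omega>)"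
    using distributed_integrable[OF D, of "\<lambda>x. x"] integrable_normal_moment_nz_1[OF pos, of 0] by simp
  show E: "expectation (\<lambda>\<omega>. W t \<omega> - W s \<omega>) = 0" by (rule normal_distributed_expectation[OF pos D])
  show "integrable M (\<lambda>\<omega>. (W t \<omega> - W s \<omega>)\<^sup>2)"
    using distributed_integrable[OF D, of "\<lambda>x. x\<^sup>2"] integrable_normal_moment[OF pos, of 0 2] by simp
  show "expectation (\<lambda>\<omega>. (W t \<omega> - W s \<omega>)\<^sup>2) = t - s"
    using normal_distributed_variance[OF pos D] E assms by simp
qed

lemma increment_indep:
  assumes "0 \<le> s" "s < t" "g \<in> borel_measurable (F s)"
  shows "indep_var borel g borel (\<lambda>\<omega>. W t \<omega> - W s \<omega>)"
  unfolding indep_var_eq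
proof (intro conjI)
  show "random_variable borel g" using measurable_F[OF assms(1,3)] .
  show "random_variable borel (\<lambda>\<omega>. W t \<omega> - W s \<omega>)"
    using assms by (intro borel_measurable_diff W_measurable) auto
  have "indep_set (sets (F s)) (sets (vimage_algebra (space M) (\<lambda>\<omega>. W t \<omega> - W s \<omega>) borel))"
    using bm assms unfolding std_brownian_motion_def by blast
  moreover have "sigma_sets (space M) {g -` A \<inter> space M |A. A \<in> sets borel} \<subseteq> sets (F s)"
  proof -
    have "{g -` A \<inter> space M |A. A \<in> sets borel} \<subseteq> sets (F s)"
      using measurable_sets[OF assms(3)] space_F[OF assms(1)] by auto
    then show ?thesis using sets.sigma_sets_subset[of _ "F s"] space_F[OF assms(1)] by simp
  qed
  ultimately show "indep_set (sigma_sets (space M) {g -` A \<inter> space M |A. A \<in> sets borel})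
      (sigma_sets (space M) {(\<lambda>\<omega>. W t \<omega> - W s \<omega>) -` A \<inter> space M |A. A \<in> sets borel})"
    unfolding indep_set_def sets_vimage_algebra
    by (rule_tac indep_sets_mono_sets) (auto split: bool.split)
qed

text \<open>
  Independence of an increment from the past enters through these moments against an integrable
  factor known at time \<open>s\<close>.
\<close>
lemma increment_mult:
  assumes st: "0 \<le> s" "s \<le> t" and g: "g \<in> borel_measurable (F s)" "integrable M g"
  shows "integrable M (\<lambda>\<omega>. (W t \<omega> - W s \<omega>) * g \<omega>)" "expectation (\<lambda>\<omega>. (W t \<omega> - W s \<omega>) * g \<omega>) = 0"
    "integrable M (\<lambda>\<omega>. (W t \<omega> - W s \<omega>)\<^sup>2 * g \<omega>)"
    "expectation (\<lambda>\<omega>. (W t \<omega> - W s \<omega>)\<^sup>2 * g \<omega>) = (t - s) * expectation g"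
proof -
  have "integrable M (\<lambda>\<omega>. (W t \<omega> - W s \<omega>) * g \<omega>) \<and> expectation (\<lambda>\<omega>. (W t \<omega> - W s \<omega>) * g \<omega>) = 0 \<and>
    integrable M (\<lambda>\<omega>. (W t \<omega> - W s \<omega>)\<^sup>2 * g \<omega>) \<and>
    expectation (\<lambda>\<omega>. (W t \<omega> - W s \<omega>)\<^sup>2 * g \<omega>) = (t - s) * expectation g"
  proof (cases "s = t")
    case False
    then have "s < t" using st by simp
    note m = increment_moments[OF st(1) this]
    have i: "indep_var borel g borel (\<lambda>\<omega>. W t \<omega> - W s \<omega>)" by (rule increment_indep[OF st(1) \<open>s < t\<close> g(1)])
    have i2: "indep_var borel g borel (\<lambda>\<omega>. (W t \<omega> - W s \<omega>)\<^sup>2)"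
      using indep_var_compose[OF i, of "\<lambda>x. x" borel "\<lambda>x. x\<^sup>2" borel] by (simp add: comp_def)
    show ?thesis
      using indep_var_integrable[OF i g(2) m(1)] indep_var_lebesgue_integral[OF i g(2) m(1)]
        indep_var_integrable[OF i2 g(2) m(3)] indep_var_lebesgue_integral[OF i2 g(2) m(3)] m
      by (simp add: mult.commute)
  qed simp
  then show "integrable M (\<lambda>\<omega>. (W t \<omega> - W s \<omega>) * g \<omega>)" "expectation (\<lambda>\<omega>. (W t \<omega> - W s \<omega>) * g \<omega>) = 0"
    "integrable M (\<lambda>\<omega>. (W t \<omega> - W s \<omega>)\<^sup>2 * g \<omega>)"
    "expectation (\<lambda>\<omega>. (W t \<omega> - W s \<omega>)\<^sup>2 * g \<omega>) = (t - s) * expectation g" by blast+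
qed

text \<open>
  The coefficients that an increment of \<open>W\<close> starting at time \<open>s\<close> may carry.
\<close>
definition adapted_sq :: "real \<Rightarrow> ('a \<Rightarrow> 'b::euclidean_space) \<Rightarrow> bool" where
  "adapted_sq s f \<longleftrightarrow> f \<in> borel_measurable (F s) \<and> sq_int M f"

lemma adapted_sqD:
  assumes "adapted_sq s f" shows "f \<in> borel_measurable (F s)" "sq_int M f"
  using assms unfolding adapted_sq_def by auto

lemma adapted_sq_mono: "0 \<le> s \<Longrightarrow> s \<le> t \<Longrightarrow> adapted_sq s f \<Longrightarrow> adapted_sq t f"
  unfolding adapted_sq_def using measurable_F_mono by blast

lemma adapted_sq_increment:
  fixes \<xi> :: "'a \<Rightarrow> 'b::euclidean_space"
  assumes "0 \<le> s" "s \<le> t" "adapted_sq s \<xi>"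
  shows "adapted_sq t (\<lambda>\<omega>. (W t \<omega> - W s \<omega>) *\<^sub>R \<xi> \<omega>)"
proof -
  note \<xi> = adapted_sqD[OF assms(3)]
  have "\<xi> \<in> borel_measurable (F t)" using measurable_F_mono[OF assms(1,2) \<xi>(1)] .
  moreover have "W t \<in> borel_measurable (F t)" "W s \<in> borel_measurable (F t)"
    using W_measurable_F assms(1,2) by auto
  ultimately have meas: "(\<lambda>\<omega>. (W t \<omega> - W s \<omega>) *\<^sub>R \<xi> \<omega>) \<in> borel_measurable (F t)" by measurable
  moreover have "(\<lambda>\<omega>. (W t \<omega> - W s \<omega>) *\<^sub>R \<xi> \<omega>) \<in> borel_measurable M"
    by (rule measurable_F[OF _ meas]) (use assms in simp)
  moreover have "(\<lambda>\<omega>. (norm (\<xi> \<omega>))\<^sup>2) \<in> borel_measurable (F s)" using \<xi>(1) by measurable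
  from increment_mult(3)[OF assms(1,2) this sq_intD(2)[OF \<xi>(2)]]
  have "integrable M (\<lambda>\<omega>. (norm ((W t \<omega> - W s \<omega>) *\<^sub>R \<xi> \<omega>))\<^sup>2)" by (simp add: power_mult_distrib)
  ultimately show ?thesis unfolding adapted_sq_def sq_int_def by blast
qed

lemma adapted_sq_inner:
  fixes f g :: "'a \<Rightarrow> 'b::euclidean_space"
  assumes "adapted_sq s f" "adapted_sq s g"
  shows "(\<lambda>\<omega>. f \<omega> \<bullet> g \<omega>) \<in> borel_measurable (F s)" "integrable M (\<lambda>\<omega>. f \<omega> \<bullet> g \<omega>)"
  using adapted_sqD[OF assms(1)] adapted_sqD[OF assms(2)] by (auto intro: integrable_inner)

lemma increment_orthogonal:
  fixes \<xi> \<zeta> :: "'a \<Rightarrow> 'b::euclidean_space"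
  assumes "0 \<le> s" "s \<le> t" "adapted_sq s \<xi>" "adapted_sq s \<zeta>"
  shows "expectation (\<lambda>\<omega>. \<zeta> \<omega> \<bullet> ((W t \<omega> - W s \<omega>) *\<^sub>R \<xi> \<omega>)) = 0"
  using increment_mult(2)[OF assms(1,2) adapted_sq_inner[OF assms(4,3)]] by simp

lemma increment_variance:
  fixes \<xi> \<zeta> :: "'a \<Rightarrow> 'b::euclidean_space"
  assumes "0 \<le> s" "s \<le> t" "adapted_sq s \<xi>" "adapted_sq s \<zeta>"
  shows "expectation (\<lambda>\<omega>. ((W t \<omega> - W s \<omega>) *\<^sub>R \<xi> \<omega>) \<bullet> ((W t \<omega> - W s \<omega>) *\<^sub>R \<zeta> \<omega>))
    = (t - s) * expectation (\<lambda>\<omega>. \<xi> \<omega> \<bullet> \<zeta> \<omega>)"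
  using increment_mult(4)[OF assms(1,2) adapted_sq_inner[OF assms(3,4)]]
  by (simp add: power2_eq_square ac_simps)

text \<open>
  With \<open>e = min b d\<close>, the first increment is cut at \<open>c\<close> and at \<open>e\<close>, the second one at \<open>e\<close>. The two pieces
  over \<open>(c, e]\<close> contribute their variance \<open>e - c\<close>. Every other product is empty or contains an increment that
  starts when the rest of the product is already known, and so has mean zero. As the two intervals are unrelated, simple
  integrands on different partitions can be paired term by term.
\<close>
lemma increment_covariance_ordered:
  fixes \<xi> \<zeta> :: "'a \<Rightarrow> 'b::euclidean_space"
  assumes "0 \<le> a" "a \<le> b" "a \<le> c" "c \<le> d" and \<xi>: "adapted_sq a \<xi>" and \<zeta>: "adapted_sq c \<zeta>"
  shows "expectation (\<lambda>\<omega>. ((W b \<omega> - W a \<omega>) *\<^sub>R \<xi> \<omega>) \<bullet> ((W d \<omega> - W c \<omega>) *\<^sub>R \<zeta> \<omega>))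
    = max 0 (min b d - c) * expectation (\<lambda>\<omega>. \<xi> \<omega> \<bullet> \<zeta> \<omega>)"
proof (cases "b \<le> c")
  case True
  have "adapted_sq c (\<lambda>\<omega>. (W b \<omega> - W a \<omega>) *\<^sub>R \<xi> \<omega>)"
    by (rule adapted_sq_mono[OF _ True adapted_sq_increment[OF assms(1,2) \<xi>]]) (use assms in simp)
  from increment_orthogonal[OF _ assms(4) \<zeta> this] assms True show ?thesis by simp
next
  case False
  define e where "e = min b d"
  have e: "0 \<le> c" "c \<le> e" "e \<le> b" "e \<le> d" using assms False by (auto simp: e_def)
  have \<xi>c: "adapted_sq c \<xi>" by (rule adapted_sq_mono[OF assms(1,3) \<xi>])
  have \<xi>': "adapted_sq c (\<lambda>\<omega>. (W c \<omega> - W a \<omega>) *\<^sub>R \<xi> \<omega>)"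
    by (rule adapted_sq_increment[OF assms(1,3) \<xi>])
  have \<xi>e: "adapted_sq e (\<lambda>\<omega>. (W e \<omega> - W c \<omega>) *\<^sub>R \<xi> \<omega>)" by (rule adapted_sq_increment[OF e(1,2) \<xi>c])
  have \<zeta>e: "adapted_sq e (\<lambda>\<omega>. (W e \<omega> - W c \<omega>) *\<^sub>R \<zeta> \<omega>)" by (rule adapted_sq_increment[OF e(1,2) \<zeta>])
  have e0: "0 \<le> e" using e by simp
  have \<xi>eb: "sq_int M (\<lambda>\<omega>. (W b \<omega> - W e \<omega>) *\<^sub>R \<xi> \<omega>)"
    using adapted_sq_increment[OF e0 e(3) adapted_sq_mono[OF e(1,2) \<xi>c]] by (rule adapted_sqD)
  have \<zeta>ed: "sq_int M (\<lambda>\<omega>. (W d \<omega> - W e \<omega>) *\<^sub>R \<zeta> \<omega>)"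
    using adapted_sq_increment[OF e0 e(4) adapted_sq_mono[OF e(1,2) \<zeta>]] by (rule adapted_sqD)
  have \<zeta>cd: "sq_int M (\<lambda>\<omega>. (W d \<omega> - W c \<omega>) *\<^sub>R \<zeta> \<omega>)"
    using adapted_sq_increment[OF e(1) assms(4) \<zeta>] by (rule adapted_sqD)
  have be: "b = e \<or> d = e" by (auto simp: e_def min_def)
  have split: "((W b \<omega> - W a \<omega>) *\<^sub>R \<xi> \<omega>) \<bullet> ((W d \<omega> - W c \<omega>) *\<^sub>R \<zeta> \<omega>) =
    ((W c \<omega> - W a \<omega>) *\<^sub>R \<xi> \<omega>) \<bullet> ((W d \<omega> - W c \<omega>) *\<^sub>R \<zeta> \<omega>)
    + ((W e \<omega> - W c \<omega>) *\<^sub>R \<xi> \<omega>) \<bullet> ((W e \<omega> - W c \<omega>) *\<^sub>R \<zeta> \<omega>)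
    + ((W e \<omega> - W c \<omega>) *\<^sub>R \<zeta> \<omega>) \<bullet> ((W b \<omega> - W e \<omega>) *\<^sub>R \<xi> \<omega>)
    + ((W e \<omega> - W c \<omega>) *\<^sub>R \<xi> \<omega>) \<bullet> ((W d \<omega> - W e \<omega>) *\<^sub>R \<zeta> \<omega>)" for \<omega>
    using be by (auto simp: inner_commute[of "\<zeta> \<omega>"] algebra_simps)
  have "expectation (\<lambda>\<omega>. ((W b \<omega> - W a \<omega>) *\<^sub>R \<xi> \<omega>) \<bullet> ((W d \<omega> - W c \<omega>) *\<^sub>R \<zeta> \<omega>)) =
    expectation (\<lambda>\<omega>. ((W c \<omega> - W a \<omega>) *\<^sub>R \<xi> \<omega>) \<bullet> ((W d \<omega> - W c \<omega>) *\<^sub>R \<zeta> \<omega>))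
    + expectation (\<lambda>\<omega>. ((W e \<omega> - W c \<omega>) *\<^sub>R \<xi> \<omega>) \<bullet> ((W e \<omega> - W c \<omega>) *\<^sub>R \<zeta> \<omega>))
    + expectation (\<lambda>\<omega>. ((W e \<omega> - W c \<omega>) *\<^sub>R \<zeta> \<omega>) \<bullet> ((W b \<omega> - W e \<omega>) *\<^sub>R \<xi> \<omega>))
    + expectation (\<lambda>\<omega>. ((W e \<omega> - W c \<omega>) *\<^sub>R \<xi> \<omega>) \<bullet> ((W d \<omega> - W e \<omega>) *\<^sub>R \<zeta> \<omega>))"
    unfolding split
    by (intro integral_add4 integrable_inner adapted_sqD(2)[OF \<xi>'] adapted_sqD(2)[OF \<xi>e]
        adapted_sqD(2)[OF \<zeta>e] \<xi>eb \<zeta>ed \<zeta>cd)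
  also have "\<dots> = 0 + (e - c) * expectation (\<lambda>\<omega>. \<xi> \<omega> \<bullet> \<zeta> \<omega>) + 0 + 0"
    using increment_orthogonal[OF e(1) assms(4) \<zeta> \<xi>'] increment_variance[OF e(1,2) \<xi>c \<zeta>]
      increment_orthogonal[OF e0 e(3) adapted_sq_mono[OF e(1,2) \<xi>c] \<zeta>e]
      increment_orthogonal[OF e0 e(4) adapted_sq_mono[OF e(1,2) \<zeta>] \<xi>e]
    by presburger
  finally show ?thesis using e unfolding e_def[symmetric] by simp
qed

lemma increment_covariance:
  fixes \<xi> \<zeta> :: "'a \<Rightarrow> 'b::euclidean_space"
  assumes "0 \<le> a" "a \<le> b" "0 \<le> c" "c \<le> d" and \<xi>: "adapted_sq a \<xi>" and \<zeta>: "adapted_sq c \<zeta>"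
  shows "expectation (\<lambda>\<omega>. ((W b \<omega> - W a \<omega>) *\<^sub>R \<xi> \<omega>) \<bullet> ((W d \<omega> - W c \<omega>) *\<^sub>R \<zeta> \<omega>))
    = measure lborel ({a<..b} \<inter> {c<..d}) * expectation (\<lambda>\<omega>. \<xi> \<omega> \<bullet> \<zeta> \<omega>)"
proof -
  have meas: "measure lborel ({a<..b} \<inter> {c<..d}) = max 0 (min b d - max a c)"
  proof -
    have "{a<..b} \<inter> {c<..d} = {max a c<..min b d}" by auto
    moreover have "measure lborel {l<..u} = max 0 (u - l)" for l u :: real
      by (cases "l \<le> u") auto
    ultimately show ?thesis by simp
  qed
  show ?thesis
  proof (cases "a \<le> c")
    case True
    then show ?thesis unfolding meas
      using increment_covariance_ordered[OF assms(1,2) True assms(4) \<xi> \<zeta>] by (simp add: max_def)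
  next
    case False
    then have ca: "c \<le> a" by simp
    show ?thesis unfolding meas
      using increment_covariance_ordered[OF assms(3,4) ca assms(2) \<zeta> \<xi>] ca
      by (simp add: max_def inner_commute[of "\<xi> _"] min.commute mult.left_commute[of "W d _ - W c _"])
  qed
qed

end

section \<open>Processes as functions of time and chance\<close>

definition time_lborel :: "real \<Rightarrow> real measure" where
  "time_lborel T = restrict_space lborel {0..T}"

lemma space_time_lborel [simp]: "space (time_lborel T) = {0..T}"
  by (simp add: time_lborel_def space_restrict_space)

lemma sets_time_lborel [measurable_cong]: "sets (time_lborel T) = sets (restrict_space borel {0..T})"
  by (simp add: time_lborel_def sets_restrict_space)

lemma measurable_time_lborel: "f \<in> borel_measurable borel \<Longrightarrow> f \<in> borel_measurable (time_lborel T)"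
  unfolding time_lborel_def by (rule measurable_restrict_space1) simp

lemma finite_time_lborel: "finite_measure (time_lborel T)"
  by (rule finite_measureI)
     (cases "0 \<le> T", simp_all add: time_lborel_def space_restrict_space emeasure_restrict_space)

lemma integral_time_lborel:
  fixes f :: "real \<Rightarrow> 'b::euclidean_space"
  shows "(\<integral>s. f s \<partial>time_lborel T) = (LINT s:{0..T}|lborel. f s)"
  unfolding time_lborel_def set_lebesgue_integral_def by (rule integral_restrict_space) simp

lemma nn_integral_time_lborel: "(\<integral>\<^sup>+s. f s \<partial>time_lborel T) = (\<integral>\<^sup>+s\<in>{0..T}. f s \<partial>lborel)"
  unfolding time_lborel_def by (rule nn_integral_restrict_space) simp

lemma inner_double_sum:
  "(\<Sum>i<k. a i) \<bullet> (\<Sum>j<l. b j) = (\<Sum>i<(k::nat). \<Sum>j<(l::nat). a i \<bullet> b j)"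
  by (simp only: inner_sum_left) (simp only: inner_sum_right)

lemma integral_double_sum:
  fixes f :: "nat \<Rightarrow> nat \<Rightarrow> 'c \<Rightarrow> real"
  assumes "\<And>i j. i < k \<Longrightarrow> j < l \<Longrightarrow> integrable N (f i j)"
  shows "(\<integral>x. (\<Sum>i<k. \<Sum>j<l. f i j x) \<partial>N) = (\<Sum>i<k. \<Sum>j<l. (\<integral>x. f i j x \<partial>N))"
proof -
  have "(\<integral>x. (\<Sum>i<k. \<Sum>j<l. f i j x) \<partial>N) = (\<Sum>i<k. (\<integral>x. (\<Sum>j<l. f i j x) \<partial>N))"
    using assms by (intro Bochner_Integration.integral_sum Bochner_Integration.integrable_sum) simp
  also have "\<dots> = (\<Sum>i<k. \<Sum>j<l. (\<integral>x. f i j x \<partial>N))"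
    using assms by (intro sum.cong refl Bochner_Integration.integral_sum) simp
  finally show ?thesis .
qed

context brownian
begin

text \<open>
  Processes on \<open>[0, T]\<close> are functions on this space, and the distance of integrands in the Ito isometry is
  the mean square distance over it.
\<close>
definition NT :: "real \<Rightarrow> (real \<times> 'a) measure" where "NT T = time_lborel T \<Otimes>\<^sub>M M"

lemma NT_pair: "pair_sigma_finite (time_lborel T) M"
proof -
  interpret T: finite_measure "time_lborel T" by (rule finite_time_lborel)
  show ?thesis by unfold_locales
qed

lemma finite_NT: "finite_measure (NT T)"
  unfolding NT_def by (intro finite_measure_pair_measure finite_time_lborel finite_measure_axioms)

lemma prog_measurable_NT:
  assumes "prog_measurable F Y" "0 \<le> T"
  shows "case_prod Y \<in> borel_measurable (NT T)"
proof -
  have Y: "case_prod Y \<in> borel_measurable (restrict_space borel {0..T} \<Otimes>\<^sub>M F T)"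
    using assms unfolding prog_measurable_def by blast
  have "id \<in> measurable M (F T)"
    using measurable_from_subalg[OF subalgebra_F[OF assms(2)], of id "F T"] by simp
  then have "(\<lambda>p. id (snd p)) \<in> measurable (NT T) (F T)" unfolding NT_def by measurable
  moreover have "fst \<in> measurable (NT T) (restrict_space borel {0..T})" unfolding NT_def by measurable
  ultimately have "(\<lambda>p. (fst p, id (snd p))) \<in> measurable (NT T) (restrict_space borel {0..T} \<Otimes>\<^sub>M F T)"
    by (intro measurable_Pair)
  from measurable_compose[OF this Y] show ?thesis by (simp add: case_prod_beta)
qed

lemma prog_measurable_adapted:
  assumes "prog_measurable F Y" "0 \<le> t"
  shows "Y t \<in> borel_measurable (F t)"
proof -
  have Y: "case_prod Y \<in> borel_measurable (restrict_space borel {0..t} \<Otimes>\<^sub>M F t)"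
    using assms unfolding prog_measurable_def by blast
  have "(\<lambda>\<omega>. (t, \<omega>)) \<in> measurable (F t) (restrict_space borel {0..t} \<Otimes>\<^sub>M F t)"
    by (rule measurable_Pair1') (simp add: space_restrict_space assms)
  from measurable_compose[OF this Y] show ?thesis by simp
qed

lemma nn_integral_NT:
  assumes "case_prod f \<in> borel_measurable (NT T)"
  shows "(\<integral>\<^sup>+\<omega>. (\<integral>\<^sup>+s\<in>{0..T}. f s \<omega> \<partial>lborel) \<partial>M) = (\<integral>\<^sup>+p. case_prod f p \<partial>NT T)"
proof -
  interpret pair_sigma_finite "time_lborel T" M by (rule NT_pair)
  show ?thesis using nn_integral_snd[of "case_prod f"] assms
    unfolding NT_def by (simp add: nn_integral_time_lborel)
qed

lemma nn_integral_NT':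
  assumes "case_prod f \<in> borel_measurable (NT T)"
  shows "(\<integral>\<^sup>+s\<in>{0..T}. (\<integral>\<^sup>+\<omega>. f s \<omega> \<partial>M) \<partial>lborel) = (\<integral>\<^sup>+p. case_prod f p \<partial>NT T)"
  using nn_integral_fst[of "case_prod f" "time_lborel T"] assms
  unfolding NT_def by (simp add: nn_integral_time_lborel)

lemma NT_product:
  fixes f :: "real \<Rightarrow> real" and g :: "'a \<Rightarrow> real"
  assumes f: "integrable (time_lborel T) f" and g: "integrable M g"
  shows "integrable (NT T) (\<lambda>p. f (fst p) * g (snd p))"
    "(\<integral>p. f (fst p) * g (snd p) \<partial>NT T) = (\<integral>s. f s \<partial>time_lborel T) * expectation g"
proof -
  interpret T: pair_sigma_finite "time_lborel T" M by (rule NT_pair)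
  have "integrable (time_lborel T \<Otimes>\<^sub>M M) (\<lambda>(s, \<omega>). f s * g \<omega>)"
    by (rule T.Fubini_integrable) (use f g in \<open>auto simp: abs_mult split_beta\<close>)
  then show i: "integrable (NT T) (\<lambda>p. f (fst p) * g (snd p))" by (simp add: NT_def case_prod_unfold)
  have "(\<integral>s. (\<integral>\<omega>. f s * g \<omega> \<partial>M) \<partial>time_lborel T) = (\<integral>p. f (fst p) * g (snd p) \<partial>NT T)"
    using T.integral_fst'[of "\<lambda>p. f (fst p) * g (snd p)"] i unfolding NT_def by simp
  then show "(\<integral>p. f (fst p) * g (snd p) \<partial>NT T) = (\<integral>s. f s \<partial>time_lborel T) * expectation g" by simp
qed

lemma integrable_indicator_time: "A \<in> sets borel \<Longrightarrow> integrable (time_lborel T) (indicator A :: real \<Rightarrow> real)"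
proof -
  assume A: "A \<in> sets borel"
  interpret finite_measure "time_lborel T" by (rule finite_time_lborel)
  show ?thesis
    by (rule integrable_const_bound[of _ 1]) (use A in \<open>auto intro!: measurable_time_lborel simp: indicator_def\<close>)
qed

lemma integral_indicator_time:
  assumes "A \<in> sets borel" "A \<subseteq> {0..T}"
  shows "(\<integral>s. (indicator A s :: real) \<partial>time_lborel T) = measure lborel A"
proof -
  have "A \<inter> {0..T} = A" using assms(2) by blast
  then show ?thesis by (simp add: time_lborel_def measure_restrict_space assms(2))
qed

section \<open>Simple integrands\<close>

text \<open>
  The coefficients are square integrable where those of \<open>simple_on\<close> are bounded: the Euler scheme below
  has unbounded ones.
\<close>
definition simple_sq :: "real \<Rightarrow> nat \<Rightarrow> (nat \<Rightarrow> real) \<Rightarrow> (nat \<Rightarrow> 'a \<Rightarrow> 'b::euclidean_space) \<Rightarrow> bool" where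
  "simple_sq T k u \<xi> \<longleftrightarrow> 0 \<le> u 0 \<and> (\<forall>i<k. u i \<le> u (Suc i)) \<and> u k \<le> T \<and> (\<forall>i<k. adapted_sq (u i) (\<xi> i))"

lemma mono_partition:
  fixes u :: "nat \<Rightarrow> real"
  assumes "\<forall>i<k. u i \<le> u (Suc i)" "i \<le> j" "j \<le> k" shows "u i \<le> u j"
  using assms(2,3)
proof (induction j rule: dec_induct)
  case (step j)
  then show ?case using assms(1) by (metis Suc_le_lessD less_imp_le_nat order_trans)
qed simp

lemma simple_sqD:
  assumes "simple_sq T k u \<xi>" "i < k"
  shows "0 \<le> u i" "u i \<le> u (Suc i)" "u (Suc i) \<le> T" "adapted_sq (u i) (\<xi> i)"
  using assms mono_partition[of k u 0 i] mono_partition[of k u "Suc i" k]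
  unfolding simple_sq_def by auto

lemma simple_on_simple_sq:
  fixes \<xi> :: "nat \<Rightarrow> 'a \<Rightarrow> 'b::euclidean_space"
  assumes "simple_on F T k u \<xi>" shows "simple_sq T k u \<xi>"
  unfolding simple_sq_def
proof (intro conjI allI impI)
  show "0 \<le> u 0" "u k \<le> T" and mono: "\<And>i. i < k \<Longrightarrow> u i \<le> u (Suc i)"
    using assms unfolding simple_on_def by auto
  fix i assume i: "i < k"
  have u: "0 \<le> u i" using mono_partition[of k u 0 i] \<open>0 \<le> u 0\<close> mono i by auto
  obtain B where B: "\<xi> i \<in> borel_measurable (F (u i))" "\<And>\<omega>. \<omega> \<in> space M \<Longrightarrow> norm (\<xi> i \<omega>) \<le> B"
    using assms i space_F[OF u] unfolding simple_on_def by metis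
  show "adapted_sq (u i) (\<xi> i)"
    unfolding adapted_sq_def using B(1) sq_int_bounded[OF measurable_F[OF u B(1)] B(2)] by blast
qed

lemma simple_ito_sq_int:
  assumes "simple_sq T k u \<xi>" shows "sq_int M (simple_ito W k u \<xi>)"
  unfolding simple_ito_def
  using adapted_sqD(2)[OF adapted_sq_increment[OF simple_sqD(1,2,4)[OF assms]]]
  by (intro sq_int_sum) simp

lemma indicator_term_sq_int:
  fixes \<xi> :: "'a \<Rightarrow> 'b::euclidean_space"
  assumes "sq_int M \<xi>"
  shows "sq_int (NT T) (\<lambda>p. indicator {a<..b} (fst p) *\<^sub>R \<xi> (snd p))"
proof (rule sq_int_dominated)
  show "(\<lambda>p. indicator {a<..b} (fst p) *\<^sub>R \<xi> (snd p)) \<in> borel_measurable (NT T)"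
  proof -
    have [measurable]: "(indicator {a<..b} :: real \<Rightarrow> real) \<in> borel_measurable (time_lborel T)"
      by (intro measurable_time_lborel) simp
    note [measurable] = sq_intD(1)[OF assms]
    show ?thesis unfolding NT_def by measurable
  qed
  show "integrable (NT T) (\<lambda>p. indicator {a<..b} (fst p) * (norm (\<xi> (snd p)))\<^sup>2)"
    by (rule NT_product(1)[OF integrable_indicator_time sq_intD(2)[OF assms]]) simp
qed (simp add: indicator_def)

lemma simple_val_sq_int:
  assumes "simple_sq T' k u \<xi>" shows "sq_int (NT T) (\<lambda>p. simple_val k u \<xi> (fst p) (snd p))"
  unfolding simple_val_def
  using adapted_sqD(2)[OF simple_sqD(4)[OF assms]]
  by (intro sq_int_sum indicator_term_sq_int) simp

lemma simple_isometry:
  assumes \<xi>: "simple_sq T k u \<xi>" and \<zeta>: "simple_sq T l v \<zeta>"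
  shows "expectation (\<lambda>\<omega>. simple_ito W k u \<xi> \<omega> \<bullet> simple_ito W l v \<zeta> \<omega>) =
    (\<integral>p. simple_val k u \<xi> (fst p) (snd p) \<bullet> simple_val l v \<zeta> (fst p) (snd p) \<partial>NT T)"
proof -
  define c where "c i j = measure lborel ({u i<..u (Suc i)} \<inter> {v j<..v (Suc j)}) * expectation (\<lambda>\<omega>. \<xi> i \<omega> \<bullet> \<zeta> j \<omega>)" for i j
  note x = simple_sqD[OF \<xi>] and z = simple_sqD[OF \<zeta>]
  have "expectation (\<lambda>\<omega>. simple_ito W k u \<xi> \<omega> \<bullet> simple_ito W l v \<zeta> \<omega>) =
    expectation (\<lambda>\<omega>. \<Sum>i<k. \<Sum>j<l. ((W (u (Suc i)) \<omega> - W (u i) \<omega>) *\<^sub>R \<xi> i \<omega>) \<bullet> ((W (v (Suc j)) \<omega> - W (v j) \<omega>) *\<^sub>R \<zeta> j \<omega>))"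
    unfolding simple_ito_def inner_double_sum ..
  also have "\<dots> = (\<Sum>i<k. \<Sum>j<l. expectation (\<lambda>\<omega>. ((W (u (Suc i)) \<omega> - W (u i) \<omega>) *\<^sub>R \<xi> i \<omega>) \<bullet> ((W (v (Suc j)) \<omega> - W (v j) \<omega>) *\<^sub>R \<zeta> j \<omega>)))"
    by (intro integral_double_sum integrable_inner adapted_sqD(2)[OF adapted_sq_increment] x z)
  also have "\<dots> = (\<Sum>i<k. \<Sum>j<l. c i j)"
    unfolding c_def by (intro sum.cong refl increment_covariance x z) auto
  also have "\<dots> = (\<Sum>i<k. \<Sum>j<l. (\<integral>p. (indicator {u i<..u (Suc i)} (fst p) *\<^sub>R \<xi> i (snd p)) \<bullet> (indicator {v j<..v (Suc j)} (fst p) *\<^sub>R \<zeta> j (snd p)) \<partial>NT T))"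
  proof (intro sum.cong refl)
    fix i j assume ij: "i \<in> {..<k}" "j \<in> {..<l}"
    let ?A = "{u i<..u (Suc i)} \<inter> {v j<..v (Suc j)}"
    have "?A \<subseteq> {0..T}" using x[of i] ij by auto
    then have "(\<integral>s. indicator ?A s \<partial>time_lborel T) = measure lborel ?A"
      by (intro integral_indicator_time) auto
    then have "c i j = (\<integral>p. indicator ?A (fst p) * (\<xi> i (snd p) \<bullet> \<zeta> j (snd p)) \<partial>NT T)"
      unfolding c_def using ij
      by (subst NT_product(2)[OF integrable_indicator_time integrable_inner[OF adapted_sqD(2)[OF x(4)] adapted_sqD(2)[OF z(4)]]]) auto
    also have "\<dots> = (\<integral>p. (indicator {u i<..u (Suc i)} (fst p) *\<^sub>R \<xi> i (snd p)) \<bullet> (indicator {v j<..v (Suc j)} (fst p) *\<^sub>R \<zeta> j (snd p)) \<partial>NT T)"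
      by (intro Bochner_Integration.integral_cong refl) (auto simp: indicator_def)
    finally show "c i j = \<dots>" .
  qed
  also have "\<dots> = (\<integral>p. (\<Sum>i<k. \<Sum>j<l. (indicator {u i<..u (Suc i)} (fst p) *\<^sub>R \<xi> i (snd p)) \<bullet> (indicator {v j<..v (Suc j)} (fst p) *\<^sub>R \<zeta> j (snd p))) \<partial>NT T)"
    by (intro integral_double_sum[symmetric] integrable_inner indicator_term_sq_int
        adapted_sqD(2)[OF x(4)] adapted_sqD(2)[OF z(4)])
  also have "\<dots> = (\<integral>p. simple_val k u \<xi> (fst p) (snd p) \<bullet> simple_val l v \<zeta> (fst p) (snd p) \<partial>NT T)"
    unfolding simple_val_def inner_double_sum ..
  finally show ?thesis .
qed

lemma simple_isometry_diff:
  assumes \<xi>: "simple_sq T k u \<xi>" and \<zeta>: "simple_sq T l v \<zeta>"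
  shows "expectation (\<lambda>\<omega>. (norm (simple_ito W k u \<xi> \<omega> - simple_ito W l v \<zeta> \<omega>))\<^sup>2) =
    (\<integral>p. (norm (simple_val k u \<xi> (fst p) (snd p) - simple_val l v \<zeta> (fst p) (snd p)))\<^sup>2 \<partial>NT T)"
proof -
  have expand: "(\<integral>x. (norm (f x - g x))\<^sup>2 \<partial>N) = (\<integral>x. f x \<bullet> f x \<partial>N) - 2 * (\<integral>x. f x \<bullet> g x \<partial>N) + (\<integral>x. g x \<bullet> g x \<partial>N)"
    if "sq_int N f" "sq_int N g" for f g :: "'c \<Rightarrow> 'b" and N
  proof -
    have "(\<integral>x. (norm (f x - g x))\<^sup>2 \<partial>N) = (\<integral>x. f x \<bullet> f x - 2 * (f x \<bullet> g x) + g x \<bullet> g x \<partial>N)"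
      by (simp add: power2_norm_eq_inner inner_diff_left inner_diff_right inner_commute algebra_simps)
    also have "\<dots> = (\<integral>x. f x \<bullet> f x \<partial>N) - 2 * (\<integral>x. f x \<bullet> g x \<partial>N) + (\<integral>x. g x \<bullet> g x \<partial>N)"
      using that by (simp add: integrable_inner)
    finally show ?thesis .
  qed
  show ?thesis
    unfolding expand[OF simple_ito_sq_int[OF \<xi>] simple_ito_sq_int[OF \<zeta>]]
      expand[OF simple_val_sq_int[OF \<xi>] simple_val_sq_int[OF \<zeta>]]
      simple_isometry[OF \<xi> \<xi>] simple_isometry[OF \<xi> \<zeta>] simple_isometry[OF \<zeta> \<zeta>] ..
qed

section \<open>The Ito integral\<close>

definition stop_partition :: "real \<Rightarrow> (nat \<Rightarrow> real) \<Rightarrow> nat \<Rightarrow> real" where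
  "stop_partition s u i = min (u i) s"

text \<open>
  An integrand is switched off at time \<open>s\<close>. Coefficients that become known after \<open>s\<close> are replaced by zero:
  they sit on a degenerate interval, but would spoil measurability at time \<open>s\<close>.
\<close>
definition stop_coeff :: "real \<Rightarrow> (nat \<Rightarrow> real) \<Rightarrow> (nat \<Rightarrow> 'a \<Rightarrow> 'b::euclidean_space) \<Rightarrow> nat \<Rightarrow> 'a \<Rightarrow> 'b" where
  "stop_coeff s u \<xi> i = (if u i \<le> s then \<xi> i else (\<lambda>\<omega>. 0))"

lemma adapted_sq_zero: "adapted_sq s (\<lambda>\<omega>. 0)"
  by (simp add: adapted_sq_def)

lemma adapted_sq_const: "adapted_sq s (\<lambda>\<omega>. c)"
  unfolding adapted_sq_def by (auto intro: sq_int_bounded)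

lemma simple_sq_stop:
  assumes "simple_sq T k u \<xi>" "0 \<le> s"
  shows "simple_sq s k (stop_partition s u) (stop_coeff s u \<xi>)"
proof -
  have "adapted_sq (stop_partition s u i) (stop_coeff s u \<xi> i)" if "i < k" for i
    using simple_sqD(4)[OF assms(1) that]
    by (auto simp: stop_partition_def stop_coeff_def min_def adapted_sq_zero)
  moreover have "stop_partition s u i \<le> stop_partition s u (Suc i)" if "i < k" for i
    using simple_sqD(2)[OF assms(1) that] by (auto simp: stop_partition_def)
  moreover have "0 \<le> u 0" using assms(1) unfolding simple_sq_def by blast
  ultimately show ?thesis using assms(2) unfolding simple_sq_def by (auto simp: stop_partition_def)
qed

lemma simple_val_stop:
  assumes "r \<le> s"
  shows "simple_val k (stop_partition s u) (stop_coeff s u \<xi>) r \<omega> = simple_val k u \<xi> r \<omega>"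
  unfolding simple_val_def
  by (intro sum.cong refl) (use assms in \<open>auto simp: stop_partition_def stop_coeff_def indicator_def min_def\<close>)

text \<open>
  The parts of the increments after time \<open>s\<close> are orthogonal to \<open>\<eta>\<close>.
\<close>
lemma simple_ito_stop_inner:
  fixes \<xi> :: "nat \<Rightarrow> 'a \<Rightarrow> 'b::euclidean_space"
  assumes \<xi>: "simple_sq T k u \<xi>" and s: "0 \<le> s" and \<eta>: "adapted_sq s \<eta>"
  shows "expectation (\<lambda>\<omega>. \<eta> \<omega> \<bullet> simple_ito W k u \<xi> \<omega>) =
    expectation (\<lambda>\<omega>. \<eta> \<omega> \<bullet> simple_ito W k (stop_partition s u) (stop_coeff s u \<xi>) \<omega>)"
proof -
  note x = simple_sqD[OF \<xi>] and x' = simple_sqD[OF simple_sq_stop[OF \<xi> s]]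
  note \<eta>s = adapted_sqD(2)[OF \<eta>]
  have expand: "expectation (\<lambda>\<omega>. \<eta> \<omega> \<bullet> simple_ito W k v \<zeta> \<omega>) =
      (\<Sum>i<k. expectation (\<lambda>\<omega>. \<eta> \<omega> \<bullet> ((W (v (Suc i)) \<omega> - W (v i) \<omega>) *\<^sub>R \<zeta> i \<omega>)))"
    if "simple_sq S k v \<zeta>" for S v and \<zeta> :: "nat \<Rightarrow> 'a \<Rightarrow> 'b"
    unfolding simple_ito_def inner_sum_right
    by (intro Bochner_Integration.integral_sum integrable_inner \<eta>s
        adapted_sqD(2)[OF adapted_sq_increment] simple_sqD[OF that]) auto
  show ?thesis unfolding expand[OF \<xi>] expand[OF simple_sq_stop[OF \<xi> s]]
  proof (intro sum.cong refl)
    fix i assume "i \<in> {..<k}"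
    then have i: "i < k" by simp
    let ?a = "u i" and ?b = "u (Suc i)"
    show "expectation (\<lambda>\<omega>. \<eta> \<omega> \<bullet> ((W ?b \<omega> - W ?a \<omega>) *\<^sub>R \<xi> i \<omega>)) =
      expectation (\<lambda>\<omega>. \<eta> \<omega> \<bullet> ((W (stop_partition s u (Suc i)) \<omega> - W (stop_partition s u i) \<omega>) *\<^sub>R stop_coeff s u \<xi> i \<omega>))"
    proof (cases "?a \<le> s")
      case True
      show ?thesis
      proof (cases "?b \<le> s")
        case False
        have \<xi>s: "adapted_sq s (\<xi> i)" by (rule adapted_sq_mono[OF x(1)[OF i] True x(4)[OF i]])
        have sb: "s \<le> ?b" using False by simp
        have "expectation (\<lambda>\<omega>. \<eta> \<omega> \<bullet> ((W ?b \<omega> - W ?a \<omega>) *\<^sub>R \<xi> i \<omega>)) =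
          expectation (\<lambda>\<omega>. \<eta> \<omega> \<bullet> ((W s \<omega> - W ?a \<omega>) *\<^sub>R \<xi> i \<omega>) + \<eta> \<omega> \<bullet> ((W ?b \<omega> - W s \<omega>) *\<^sub>R \<xi> i \<omega>))"
          by (intro Bochner_Integration.integral_cong refl) (simp add: algebra_simps)
        also have "\<dots> = expectation (\<lambda>\<omega>. \<eta> \<omega> \<bullet> ((W s \<omega> - W ?a \<omega>) *\<^sub>R \<xi> i \<omega>)) + expectation (\<lambda>\<omega>. \<eta> \<omega> \<bullet> ((W ?b \<omega> - W s \<omega>) *\<^sub>R \<xi> i \<omega>))"
          by (intro Bochner_Integration.integral_add integrable_inner \<eta>s
              adapted_sqD(2)[OF adapted_sq_increment] x(1,4)[OF i] True s sb \<xi>s)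
        also have "\<dots> = expectation (\<lambda>\<omega>. \<eta> \<omega> \<bullet> ((W s \<omega> - W ?a \<omega>) *\<^sub>R \<xi> i \<omega>))"
          using increment_orthogonal[OF s sb \<xi>s \<eta>] by linarith
        finally show ?thesis using True False by (simp add: stop_partition_def stop_coeff_def min_def)
      qed (use True in \<open>simp add: stop_partition_def stop_coeff_def\<close>)
    next
      case False
      then have "adapted_sq ?a \<eta>" by (intro adapted_sq_mono[OF s _ \<eta>]) simp
      from increment_orthogonal[OF x(1)[OF i] x(2)[OF i] x(4)[OF i] this] False show ?thesis
        by (simp add: stop_coeff_def)
    qed
  qed
qed

text \<open>
  An approximation on \<open>[0, T]\<close> also approximates on every shorter interval, which is what the comparison of
  integrals over different intervals needs.
\<close>
lemma has_ito_approx: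
  fixes Y :: "real \<Rightarrow> 'a \<Rightarrow> 'b::euclidean_space"
  assumes "has_ito_integral M F W T Y I" "0 \<le> T"
  obtains k u \<xi> where "\<And>m. simple_sq T (k m) (u m) (\<xi> m)"
    "L2_lim M (\<lambda>m. simple_ito W (k m) (u m) (\<xi> m)) I"
    "\<And>s. 0 \<le> s \<Longrightarrow> s \<le> T \<Longrightarrow> L2_lim (NT s) (\<lambda>m p. simple_val (k m) (u m) (\<xi> m) (fst p) (snd p)) (case_prod Y)"
proof -
  obtain k u and \<xi> :: "nat \<Rightarrow> nat \<Rightarrow> 'a \<Rightarrow> 'b" where so: "\<forall>m. simple_on F T (k m) (u m) (\<xi> m)"
    and lY: "(\<lambda>m. \<integral>\<^sup>+\<omega>. (\<integral>\<^sup>+s\<in>{0..T}.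
            ennreal ((norm (Y s \<omega> - simple_val (k m) (u m) (\<xi> m) s \<omega>))\<^sup>2) \<partial>lborel) \<partial>M) \<longlonglongrightarrow> 0"
    and lI: "(\<lambda>m. \<integral>\<^sup>+\<omega>. ennreal ((norm (I \<omega> - simple_ito W (k m) (u m) (\<xi> m) \<omega>))\<^sup>2) \<partial>M) \<longlonglongrightarrow> 0"
    using assms(1) unfolding has_ito_integral_def by (elim conjE exE) (rule that)
  have I: "I \<in> borel_measurable M" and Y: "prog_measurable F Y"
    using assms(1) unfolding has_ito_integral_def by simp_all
  have sq: "simple_sq T (k m) (u m) (\<xi> m)" for m by (rule simple_on_simple_sq[OF so[rule_format]])
  show ?thesis
  proof (rule that)
    show "simple_sq T (k m) (u m) (\<xi> m)" for m by (rule sq)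
    show "L2_lim M (\<lambda>m. simple_ito W (k m) (u m) (\<xi> m)) I"
      by (rule L2_limI_nn[OF simple_ito_sq_int[OF sq] I lI])
    fix s assume s: "0 \<le> s" "s \<le> T"
    show "L2_lim (NT s) (\<lambda>m p. simple_val (k m) (u m) (\<xi> m) (fst p) (snd p)) (case_prod Y)"
    proof (rule L2_limI_nn[OF simple_val_sq_int[OF sq] prog_measurable_NT[OF Y s(1)]])
      let ?e = "\<lambda>m s \<omega>. ennreal ((norm (Y s \<omega> - simple_val (k m) (u m) (\<xi> m) s \<omega>))\<^sup>2)"
      have meas: "case_prod (?e m) \<in> borel_measurable (NT s)" for m
      proof -
        note [measurable] = prog_measurable_NT[OF Y s(1)] sq_intD(1)[OF simple_val_sq_int[OF sq[of m], of s]]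
        have "(\<lambda>p. ennreal ((norm (case_prod Y p - simple_val (k m) (u m) (\<xi> m) (fst p) (snd p)))\<^sup>2)) \<in> borel_measurable (NT s)"
          by measurable
        then show ?thesis by (simp add: case_prod_unfold)
      qed
      have eq: "(\<integral>\<^sup>+p. ennreal ((norm (case_prod Y p - simple_val (k m) (u m) (\<xi> m) (fst p) (snd p)))\<^sup>2) \<partial>NT s)
        = (\<integral>\<^sup>+\<omega>. (\<integral>\<^sup>+r\<in>{0..s}. ?e m r \<omega> \<partial>lborel) \<partial>M)" for m
        unfolding nn_integral_NT[OF meas] by (simp add: case_prod_unfold)
      show "(\<lambda>m. \<integral>\<^sup>+p. ennreal ((norm (case_prod Y p - simple_val (k m) (u m) (\<xi> m) (fst p) (snd p)))\<^sup>2) \<partial>NT s) \<longlonglongrightarrow> 0"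
        unfolding eq
      proof (rule tendsto_sandwich[OF _ _ tendsto_const lY])
        show "\<forall>\<^sub>F m in sequentially. (\<integral>\<^sup>+\<omega>. (\<integral>\<^sup>+r\<in>{0..s}. ?e m r \<omega> \<partial>lborel) \<partial>M) \<le> (\<integral>\<^sup>+\<omega>. (\<integral>\<^sup>+r\<in>{0..T}. ?e m r \<omega> \<partial>lborel) \<partial>M)"
          using s by (intro always_eventually allI nn_integral_mono) (auto simp: indicator_def)
      qed simp
    qed
  qed
qed

lemma has_ito_sq_int:
  assumes "has_ito_integral M F W T Y I" "0 \<le> T"
  shows "sq_int M I" "sq_int (NT T) (case_prod Y)"
proof -
  show "sq_int M I" by (rule has_ito_approx[OF assms]) (rule L2_limD(2))
  show "sq_int (NT T) (case_prod Y)"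
    by (rule has_ito_approx[OF assms]) (rule L2_limD(2)[OF _], use assms(2) in blast)
qed

lemma simple_ito_matrix:
  fixes S :: "real^'n^'m"
  shows "S *v simple_ito W k u \<xi> \<omega> = simple_ito W k u (\<lambda>i \<omega>. S *v \<xi> i \<omega>) \<omega>"
  unfolding simple_ito_def by (simp add: linear_sum[OF matrix_vector_mul_linear] matrix_vector_mult_scaleR)

lemma simple_val_matrix:
  fixes S :: "real^'n^'m"
  shows "S *v simple_val k u \<xi> s \<omega> = simple_val k u (\<lambda>i \<omega>. S *v \<xi> i \<omega>) s \<omega>"
  unfolding simple_val_def by (simp add: linear_sum[OF matrix_vector_mul_linear] matrix_vector_mult_scaleR)

lemma adapted_sq_matrix:
  fixes S :: "real^'n^'m"
  assumes "adapted_sq s f" shows "adapted_sq s (\<lambda>\<omega>. S *v f \<omega>)"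
proof -
  have "(\<lambda>x. S *v x) \<in> borel_measurable borel"
    by (intro borel_measurable_continuous_onI linear_continuous_on matrix_vector_mul_bounded_linear)
  from measurable_compose[OF adapted_sqD(1)[OF assms] this] show ?thesis
    unfolding adapted_sq_def using sq_int_matrix[OF adapted_sqD(2)[OF assms]] by blast
qed

text \<open>
  The weight \<open>S\<close> is there because the isometry is used for the quadratic form of a Lyapunov matrix.
\<close>
theorem ito_isometry:
  fixes S :: "real^'n^'n"
  assumes "has_ito_integral M F W T Y I" "0 \<le> T"
  shows "expectation (\<lambda>\<omega>. I \<omega> \<bullet> (S *v I \<omega>)) = (\<integral>p. case_prod Y p \<bullet> (S *v case_prod Y p) \<partial>NT T)"
proof -
  obtain k u \<xi> where sq: "\<And>m. simple_sq T (k m) (u m) (\<xi> m)"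
    and lI: "L2_lim M (\<lambda>m. simple_ito W (k m) (u m) (\<xi> m)) I"
    and lY: "\<And>s. 0 \<le> s \<Longrightarrow> s \<le> T \<Longrightarrow> L2_lim (NT s) (\<lambda>m p. simple_val (k m) (u m) (\<xi> m) (fst p) (snd p)) (case_prod Y)"
    by (rule has_ito_approx[OF assms]) blast
  have S: "bounded_linear ((*v) S)" by (rule matrix_vector_mul_bounded_linear)
  have sq': "simple_sq T (k m) (u m) (\<lambda>i \<omega>. S *v \<xi> m i \<omega>)" for m
    using sq[of m] unfolding simple_sq_def by (auto intro: adapted_sq_matrix)
  have "expectation (\<lambda>\<omega>. simple_ito W (k m) (u m) (\<xi> m) \<omega> \<bullet> (S *v simple_ito W (k m) (u m) (\<xi> m) \<omega>)) =
    (\<integral>p. simple_val (k m) (u m) (\<xi> m) (fst p) (snd p) \<bullet> (S *v simple_val (k m) (u m) (\<xi> m) (fst p) (snd p)) \<partial>NT T)" for m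
    unfolding simple_ito_matrix simple_val_matrix by (rule simple_isometry[OF sq sq'])
  moreover note L2_lim_inner[OF lI L2_lim_bounded_linear[OF S lI]]
    L2_lim_inner[OF lY[OF assms(2) order_refl] L2_lim_bounded_linear[OF S lY[OF assms(2) order_refl]]]
  ultimately show ?thesis using LIMSEQ_unique by simp
qed

text \<open>
  The integrals up to \<open>T\<close> and up to \<open>s\<close> are limits along unrelated approximations. Stopping the first
  approximation at \<open>s\<close> gives a sequence that converges to \<open>J\<close> as well: by the isometry its distance from the
  second approximation is the distance of the integrands on \<open>[0, s]\<close>, and both of these converge to \<open>Y\<close>.
\<close>
theorem ito_martingale:
  fixes Y :: "real \<Rightarrow> 'a \<Rightarrow> 'b::euclidean_space"
  assumes I: "has_ito_integral M F W T Y I" and J: "has_ito_integral M F W s Y J"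
    and s: "0 \<le> s" "s \<le> T" and \<eta>: "adapted_sq s \<eta>"
  shows "expectation (\<lambda>\<omega>. \<eta> \<omega> \<bullet> I \<omega>) = expectation (\<lambda>\<omega>. \<eta> \<omega> \<bullet> J \<omega>)"
proof -
  have T: "0 \<le> T" using s by simp
  obtain k u \<xi> where sq: "\<And>m. simple_sq T (k m) (u m) (\<xi> m)"
    and lI: "L2_lim M (\<lambda>m. simple_ito W (k m) (u m) (\<xi> m)) I"
    and lY: "\<And>s. 0 \<le> s \<Longrightarrow> s \<le> T \<Longrightarrow> L2_lim (NT s) (\<lambda>m p. simple_val (k m) (u m) (\<xi> m) (fst p) (snd p)) (case_prod Y)"
    by (rule has_ito_approx[OF I T]) blast
  obtain l v \<zeta> where sqz: "\<And>m. simple_sq s (l m) (v m) (\<zeta> m)"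
    and lJ: "L2_lim M (\<lambda>m. simple_ito W (l m) (v m) (\<zeta> m)) J"
    and lZ: "\<And>r. 0 \<le> r \<Longrightarrow> r \<le> s \<Longrightarrow> L2_lim (NT r) (\<lambda>m p. simple_val (l m) (v m) (\<zeta> m) (fst p) (snd p)) (case_prod Y)"
    by (rule has_ito_approx[OF J s(1)]) blast
  let ?u = "\<lambda>m. stop_partition s (u m)" and ?\<xi> = "\<lambda>m. stop_coeff s (u m) (\<xi> m)"
  have sq': "simple_sq s (k m) (?u m) (?\<xi> m)" for m by (rule simple_sq_stop[OF sq s(1)])
  have "L2_lim M (\<lambda>m. simple_ito W (k m) (?u m) (?\<xi> m)) J"
  proof (rule L2_lim_replace[OF lJ simple_ito_sq_int[OF sq']])
    have eq: "expectation (\<lambda>\<omega>. (norm (simple_ito W (l m) (v m) (\<zeta> m) \<omega> - simple_ito W (k m) (?u m) (?\<xi> m) \<omega>))\<^sup>2) =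
      (\<integral>p. (norm (simple_val (l m) (v m) (\<zeta> m) (fst p) (snd p) - simple_val (k m) (u m) (\<xi> m) (fst p) (snd p)))\<^sup>2 \<partial>NT s)" for m
      unfolding simple_isometry_diff[OF sqz sq']
      by (intro Bochner_Integration.integral_cong refl) (auto simp: NT_def space_pair_measure simple_val_stop)
    let ?b = "\<lambda>m. 2 * (\<integral>p. (norm (simple_val (l m) (v m) (\<zeta> m) (fst p) (snd p) - case_prod Y p))\<^sup>2 \<partial>NT s)
      + 2 * (\<integral>p. (norm (case_prod Y p - simple_val (k m) (u m) (\<xi> m) (fst p) (snd p)))\<^sup>2 \<partial>NT s)"
    have "?b \<longlonglongrightarrow> 2 * 0 + 2 * 0"
      by (intro tendsto_intros)
         (use L2_limD(3)[OF lZ[OF s(1) order_refl]] L2_limD(3)[OF lY[OF s]] in \<open>simp_all add: norm_minus_commute\<close>)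
    then have b: "?b \<longlonglongrightarrow> 0" by simp
    show "(\<lambda>m. expectation (\<lambda>\<omega>. (norm (simple_ito W (l m) (v m) (\<zeta> m) \<omega> - simple_ito W (k m) (?u m) (?\<xi> m) \<omega>))\<^sup>2)) \<longlonglongrightarrow> 0"
      unfolding eq
    proof (rule tendsto_sandwich[OF _ _ tendsto_const b])
      show "\<forall>\<^sub>F m in sequentially. (\<integral>p. (norm (simple_val (l m) (v m) (\<zeta> m) (fst p) (snd p) - simple_val (k m) (u m) (\<xi> m) (fst p) (snd p)))\<^sup>2 \<partial>NT s) \<le> ?b m"
        by (intro always_eventually allI integral_norm_diff_sq_le simple_val_sq_int[OF sqz] simple_val_sq_int[OF sq] L2_limD(2)[OF lY[OF s]])
    qed simp
  qed
  from L2_lim_inner[OF L2_lim_const[OF adapted_sqD(2)[OF \<eta>]] this]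
  have "(\<lambda>m. expectation (\<lambda>\<omega>. \<eta> \<omega> \<bullet> simple_ito W (k m) (u m) (\<xi> m) \<omega>)) \<longlonglongrightarrow> expectation (\<lambda>\<omega>. \<eta> \<omega> \<bullet> J \<omega>)"
    unfolding simple_ito_stop_inner[OF sq s(1) \<eta>, symmetric] .
  moreover note L2_lim_inner[OF L2_lim_const[OF adapted_sqD(2)[OF \<eta>]] lI]
  ultimately show ?thesis using LIMSEQ_unique by blast
qed

lemma ito_mean:
  fixes Y :: "real \<Rightarrow> 'a \<Rightarrow> 'b::euclidean_space"
  assumes I: "has_ito_integral M F W T Y I" and T: "0 \<le> T"
  shows "expectation (\<lambda>\<omega>. c \<bullet> I \<omega>) = 0"
proof -
  obtain k u \<xi> where sq: "\<And>m. simple_sq T (k m) (u m) (\<xi> m)"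
    and lI: "L2_lim M (\<lambda>m. simple_ito W (k m) (u m) (\<xi> m)) I"
    by (rule has_ito_approx[OF I T]) blast
  have "expectation (\<lambda>\<omega>. c \<bullet> simple_ito W (k m) (u m) (\<xi> m) \<omega>) = 0" for m
  proof -
    have u: "stop_partition 0 (u m) i = 0" if "i \<le> k m" for i
    proof -
      have "0 \<le> u m 0" "\<forall>i<k m. u m i \<le> u m (Suc i)" using sq[of m] unfolding simple_sq_def by auto
      then have "0 \<le> u m i" using mono_partition[of "k m" "u m" 0 i] that by simp
      then show ?thesis by (simp add: stop_partition_def)
    qed
    then have "simple_ito W (k m) (stop_partition 0 (u m)) (stop_coeff 0 (u m) (\<xi> m)) \<omega> = 0" for \<omega>
      unfolding simple_ito_def by (intro sum.neutral) auto
    then show ?thesis using simple_ito_stop_inner[OF sq order_refl adapted_sq_const] by simp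
  qed
  moreover have "(\<lambda>m. expectation (\<lambda>\<omega>. c \<bullet> simple_ito W (k m) (u m) (\<xi> m) \<omega>)) \<longlonglongrightarrow> expectation (\<lambda>\<omega>. c \<bullet> I \<omega>)"
    by (rule L2_lim_inner[OF L2_lim_const[OF adapted_sqD(2)[OF adapted_sq_const[of 0 c]]] lI])
  ultimately show ?thesis using LIMSEQ_unique[OF _ tendsto_const] by simp
qed

end

section \<open>Second moments of closed-loop solutions\<close>

text \<open>
  The product rule along a path of bounded variation; no second order term appears.
\<close>
lemma time_integral_FTC_form:
  fixes b :: "real \<Rightarrow> real^'n" and S :: "real^'n^'n"
  assumes T: "0 \<le> T" and b: "continuous_on {0..T} b" and S: "transpose S = S"
    and D: "\<And>t. t \<in> {0..T} \<Longrightarrow> D t = x + (LINT s:{0..t}|lborel. b s)"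
  shows "D T \<bullet> (S *v D T) = x \<bullet> (S *v x) + (LINT s:{0..T}|lborel. 2 * (b s \<bullet> (S *v D s)))"
proof -
  have Db: "D t = x + integral {0..t} b" if "t \<in> {0..T}" for t
  proof -
    have "set_integrable lborel {0..t} b"
      by (intro borel_integrable_atLeastAtMost' continuous_on_subset[OF b]) (use that in auto)
    then show ?thesis using D[OF that] set_borel_integral_eq_integral(2) by fastforce
  qed
  have dD: "(D has_vector_derivative b t) (at t within {0..T})" if t: "t \<in> {0..T}" for t
  proof -
    have "((\<lambda>t. x + integral {0..t} b) has_vector_derivative 0 + b t) (at t within {0..T})"
      by (intro has_vector_derivative_add has_vector_derivative_const integral_has_vector_derivative[OF b t])
    then show ?thesis using has_vector_derivative_transform[OF t Db] by simp
  qed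
  have contD: "continuous_on {0..T} D"
    using dD has_vector_derivative_continuous continuous_on_eq_continuous_within by blast
  have dF: "((\<lambda>t. D t \<bullet> (S *v D t)) has_vector_derivative (2 * (b t \<bullet> (S *v D t)))) (at t within {0..T})"
    if t: "0 \<le> t" "t \<le> T" for t
  proof -
    have "((\<lambda>t. S *v D t) has_vector_derivative S *v b t) (at t within {0..T})"
      using t by (intro bounded_linear.has_vector_derivative[OF matrix_vector_mul_bounded_linear] dD) auto
    from bounded_bilinear.has_vector_derivative[OF bounded_bilinear_inner dD this]
    have "((\<lambda>t. D t \<bullet> (S *v D t)) has_vector_derivative (D t \<bullet> (S *v b t) + b t \<bullet> (S *v D t))) (at t within {0..T})"
      using t by simp
    moreover have "D t \<bullet> (S *v b t) = b t \<bullet> (S *v D t)" by (rule form_commute[OF S])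
    ultimately show ?thesis by simp
  qed
  have "continuous_on {0..T} (\<lambda>t. 2 * (b t \<bullet> (S *v D t)))"
    by (intro continuous_intros b bounded_linear.continuous_on[OF matrix_vector_mul_bounded_linear] contD)
  from integral_FTC_Icc[OF T dF this]
  have "(LINT s:{0..T}|lborel. 2 * (b s \<bullet> (S *v D s))) = D T \<bullet> (S *v D T) - D 0 \<bullet> (S *v D 0)"
    unfolding set_lebesgue_integral_def by simp
  moreover have "D 0 = x" using Db[of 0] T by simp
  ultimately show ?thesis by simp
qed

text \<open>
  Cauchy-Schwarz with the constant function. If \<open>f\<close> is not square integrable, the right-hand side is
  infinite, except for \<open>T = 0\<close>, where the interval is a null set.
\<close>
lemma time_integral_sq_le:
  fixes f :: "real \<Rightarrow> 'b::euclidean_space"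
  assumes "f \<in> borel_measurable (time_lborel T)" "0 \<le> T"
  shows "ennreal ((norm (\<integral>s. f s \<partial>time_lborel T))\<^sup>2) \<le> ennreal T * (\<integral>\<^sup>+s. ennreal ((norm (f s))\<^sup>2) \<partial>time_lborel T)"
proof (cases "sq_int (time_lborel T) f")
  case True
  interpret finite_measure "time_lborel T" by (rule finite_time_lborel)
  have one: "sq_int (time_lborel T) (\<lambda>s. 1::real)" by (rule sq_int_bounded[of _ 1]) auto
  have nf: "sq_int (time_lborel T) (\<lambda>s. norm (f s))"
    using True unfolding sq_int_def by auto
  have "measure (time_lborel T) {0..T} = T"
    using assms(2) by (simp add: time_lborel_def measure_restrict_space)
  then have m: "(\<integral>s. (norm (1::real))\<^sup>2 \<partial>time_lborel T) = T" by simp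
  have "norm (\<integral>s. f s \<partial>time_lborel T) \<le> (\<integral>s. norm (f s) \<bullet> 1 \<partial>time_lborel T)"
    using integral_norm_bound[of "time_lborel T" f] by simp
  then have "(norm (\<integral>s. f s \<partial>time_lborel T))\<^sup>2 \<le> (\<integral>s. norm (f s) \<bullet> 1 \<partial>time_lborel T)\<^sup>2"
    by (intro power_mono) auto
  also have "\<dots> \<le> (\<integral>s. (norm (norm (f s)))\<^sup>2 \<partial>time_lborel T) * (\<integral>s. (norm (1::real))\<^sup>2 \<partial>time_lborel T)"
    by (rule integral_Cauchy_Schwarz[OF nf one])
  also have "\<dots> = T * (\<integral>s. (norm (f s))\<^sup>2 \<partial>time_lborel T)" unfolding m by simp
  finally show ?thesis
    unfolding sq_int_nn_integral[OF True] using assms(2) by (simp add: ennreal_mult[symmetric])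
next
  case False
  then have inf: "(\<integral>\<^sup>+s. ennreal ((norm (f s))\<^sup>2) \<partial>time_lborel T) = \<infinity>"
    using sq_int_iff_nn_integral[OF assms(1)] by (simp add: not_less top_unique)
  show ?thesis
  proof (cases "T = 0")
    case True
    have "(\<integral>\<^sup>+s. ennreal ((norm (f s))\<^sup>2) \<partial>time_lborel 0) = 0"
      unfolding nn_integral_time_lborel by (rule nn_integral_null_set) (simp add: null_sets_def)
    then show ?thesis using inf True by simp
  next
    case False
    then have "ennreal T * \<infinity> = \<infinity>" using assms(2) by (simp add: ennreal_mult_eq_top_iff ennreal_top_mult)
    then show ?thesis unfolding inf by simp
  qed
qed

lemma set_integral_time_lborel:
  fixes f :: "real \<Rightarrow> 'b::euclidean_space"
  assumes "t \<le> T"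
  shows "(LINT s:{0..t}|lborel. f s) = (\<integral>s. indicator {0..t} s *\<^sub>R f s \<partial>time_lborel T)"
  unfolding integral_time_lborel set_lebesgue_integral_def
  by (intro Bochner_Integration.integral_cong refl) (use assms in \<open>auto simp: indicator_def\<close>)

context brownian
begin

lemma time_integral_measurable:
  fixes Y :: "real \<Rightarrow> 'a \<Rightarrow> 'b::euclidean_space"
  assumes Y: "case_prod Y \<in> borel_measurable (NT T)"
  shows "(\<lambda>p. LINT s:{0..fst p}|lborel. Y s (snd p)) \<in> borel_measurable (NT T)"
proof -
  interpret finite_measure "time_lborel T" by (rule finite_time_lborel)
  have "(\<lambda>q. (if snd q \<le> fst (fst q) then 1 else 0) *\<^sub>R case_prod Y (snd q, snd (fst q))) \<in> borel_measurable (NT T \<Otimes>\<^sub>M time_lborel T)"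
  proof -
    have id: "(\<lambda>s. s) \<in> borel_measurable (time_lborel T)" by (rule measurable_time_lborel) simp
    have "(\<lambda>q. fst (fst q)) \<in> measurable (NT T \<Otimes>\<^sub>M time_lborel T) (time_lborel T)"
      unfolding NT_def by measurable
    from measurable_compose[OF this id]
    have [measurable]: "(\<lambda>q. fst (fst q)) \<in> borel_measurable (NT T \<Otimes>\<^sub>M time_lborel T)" .
    have [measurable]: "(\<lambda>q. snd q) \<in> borel_measurable (NT T \<Otimes>\<^sub>M time_lborel T)"
      by (rule measurable_compose[OF measurable_snd id])
    have "(\<lambda>q. (snd q, snd (fst q))) \<in> measurable (NT T \<Otimes>\<^sub>M time_lborel T) (NT T)"
      unfolding NT_def by measurable
    from measurable_compose[OF this Y]
    have [measurable]: "(\<lambda>q. case_prod Y (snd q, snd (fst q))) \<in> borel_measurable (NT T \<Otimes>\<^sub>M time_lborel T)" .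
    show ?thesis by measurable
  qed
  then have "(\<lambda>p. \<integral>s. (if s \<le> fst p then 1 else 0) *\<^sub>R case_prod Y (s, snd p) \<partial>time_lborel T) \<in> borel_measurable (NT T)"
    using borel_measurable_lebesgue_integral[of "\<lambda>p s. (if s \<le> fst p then 1 else 0) *\<^sub>R case_prod Y (s, snd p)" "NT T"]
    by (simp add: case_prod_unfold)
  moreover have "(\<integral>s. (if s \<le> fst p then 1 else 0) *\<^sub>R case_prod Y (s, snd p) \<partial>time_lborel T) =
      (LINT s:{0..fst p}|lborel. Y s (snd p))" if "p \<in> space (NT T)" for p
  proof -
    have "fst p \<le> T" using that by (auto simp: NT_def space_pair_measure)
    from set_integral_time_lborel[OF this, of "\<lambda>s. Y s (snd p)"] show ?thesis
      by (simp, intro Bochner_Integration.integral_cong) (auto simp: indicator_def)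
  qed
  ultimately show ?thesis by (subst measurable_cong) auto
qed

lemma NT_section:
  assumes "f \<in> borel_measurable (NT T)" "\<omega> \<in> space M"
  shows "(\<lambda>s. f (s, \<omega>)) \<in> borel_measurable (time_lborel T)"
proof -
  have "(\<lambda>s. (s, \<omega>)) \<in> measurable (time_lborel T) (NT T)" unfolding NT_def using assms(2) by measurable
  from measurable_compose[OF this assms(1)] show ?thesis .
qed

lemma NT_section':
  assumes "f \<in> borel_measurable (NT T)" "s \<in> {0..T}"
  shows "(\<lambda>\<omega>. f (s, \<omega>)) \<in> borel_measurable M"
proof -
  have "(\<lambda>\<omega>. (s, \<omega>)) \<in> measurable M (NT T)" unfolding NT_def
    by (rule measurable_Pair1') (use assms(2) in simp)
  from measurable_compose[OF this assms(1)] show ?thesis .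
qed

lemma time_integral_nn_bound:
  fixes Y :: "real \<Rightarrow> 'a \<Rightarrow> 'b::euclidean_space"
  assumes Y: "case_prod Y \<in> borel_measurable (NT T)" and t: "0 \<le> t" "t \<le> T"
  shows "(\<integral>\<^sup>+\<omega>. ennreal ((norm (LINT s:{0..t}|lborel. Y s \<omega>))\<^sup>2) \<partial>M)
    \<le> ennreal T * (\<integral>\<^sup>+p. ennreal ((norm (case_prod Y p))\<^sup>2) \<partial>NT T)"
proof -
  have meas: "(\<lambda>p. ennreal ((norm (case_prod Y p))\<^sup>2)) \<in> borel_measurable (NT T)" using Y by measurable
  have "(\<integral>\<^sup>+\<omega>. ennreal ((norm (LINT s:{0..t}|lborel. Y s \<omega>))\<^sup>2) \<partial>M)
    \<le> (\<integral>\<^sup>+\<omega>. ennreal T * (\<integral>\<^sup>+s. ennreal ((norm (Y s \<omega>))\<^sup>2) \<partial>time_lborel T) \<partial>M)"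
  proof (rule nn_integral_mono)
    fix \<omega> assume \<omega>: "\<omega> \<in> space M"
    have m: "(\<lambda>s. indicator {0..t} s *\<^sub>R Y s \<omega>) \<in> borel_measurable (time_lborel T)"
    proof -
      have [measurable]: "(indicator {0..t} :: real \<Rightarrow> real) \<in> borel_measurable (time_lborel T)"
        by (intro measurable_time_lborel) simp
      have [measurable]: "(\<lambda>s. Y s \<omega>) \<in> borel_measurable (time_lborel T)" using NT_section[OF Y \<omega>] by simp
      show ?thesis by measurable
    qed
    have "ennreal ((norm (LINT s:{0..t}|lborel. Y s \<omega>))\<^sup>2) \<le> ennreal T * (\<integral>\<^sup>+s. ennreal ((norm (indicator {0..t} s *\<^sub>R Y s \<omega>))\<^sup>2) \<partial>time_lborel T)"
      unfolding set_integral_time_lborel[OF t(2)] by (rule time_integral_sq_le[OF m]) (use t in simp)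
    also have "\<dots> \<le> ennreal T * (\<integral>\<^sup>+s. ennreal ((norm (Y s \<omega>))\<^sup>2) \<partial>time_lborel T)"
      by (intro mult_left_mono nn_integral_mono) (auto simp: indicator_def)
    finally show "ennreal ((norm (LINT s:{0..t}|lborel. Y s \<omega>))\<^sup>2) \<le> ennreal T * (\<integral>\<^sup>+s. ennreal ((norm (Y s \<omega>))\<^sup>2) \<partial>time_lborel T)" .
  qed
  also have "\<dots> = ennreal T * (\<integral>\<^sup>+\<omega>. (\<integral>\<^sup>+s. ennreal ((norm (Y s \<omega>))\<^sup>2) \<partial>time_lborel T) \<partial>M)"
  proof (rule nn_integral_cmult)
    interpret pair_sigma_finite "time_lborel T" M by (rule NT_pair)
    have [measurable]: "(\<lambda>p. ennreal ((norm (Y (snd p) (fst p)))\<^sup>2)) \<in> borel_measurable (M \<Otimes>\<^sub>M time_lborel T)"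
      using measurable_compose[OF measurable_pair_swap' meas[unfolded NT_def]] by (simp add: case_prod_unfold)
    show "(\<lambda>\<omega>. \<integral>\<^sup>+s. ennreal ((norm (Y s \<omega>))\<^sup>2) \<partial>time_lborel T) \<in> borel_measurable M"
      using M1.borel_measurable_nn_integral[of "\<lambda>\<omega> s. ennreal ((norm (Y s \<omega>))\<^sup>2)" M] by (simp add: case_prod_unfold)
  qed
  also have "(\<integral>\<^sup>+\<omega>. (\<integral>\<^sup>+s. ennreal ((norm (Y s \<omega>))\<^sup>2) \<partial>time_lborel T) \<partial>M) = (\<integral>\<^sup>+p. ennreal ((norm (case_prod Y p))\<^sup>2) \<partial>NT T)"
    using nn_integral_NT[of "\<lambda>s \<omega>. ennreal ((norm (Y s \<omega>))\<^sup>2)" T] meas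
    by (simp add: nn_integral_time_lborel case_prod_unfold)
  finally show ?thesis .
qed

lemma time_integral_sq_int:
  fixes Y :: "real \<Rightarrow> 'a \<Rightarrow> 'b::euclidean_space"
  assumes Y: "sq_int (NT T) (case_prod Y)" and T: "0 \<le> T"
  shows "t \<in> {0..T} \<Longrightarrow> sq_int M (\<lambda>\<omega>. LINT s:{0..t}|lborel. Y s \<omega>)"
    "sq_int (NT T) (\<lambda>p. LINT s:{0..fst p}|lborel. Y s (snd p))"
proof -
  note m = time_integral_measurable[OF sq_intD(1)[OF Y]]
  define c where "c = ennreal T * (\<integral>\<^sup>+p. ennreal ((norm (case_prod Y p))\<^sup>2) \<partial>NT T)"
  have c: "c < \<infinity>"
    using Y unfolding c_def sq_int_iff_nn_integral[OF sq_intD(1)[OF Y]] by (simp add: ennreal_mult_less_top)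
  have b: "(\<integral>\<^sup>+\<omega>. ennreal ((norm (LINT s:{0..t}|lborel. Y s \<omega>))\<^sup>2) \<partial>M) \<le> c" if "t \<in> {0..T}" for t
    unfolding c_def using time_integral_nn_bound[OF sq_intD(1)[OF Y]] that by simp
  show "sq_int M (\<lambda>\<omega>. LINT s:{0..t}|lborel. Y s \<omega>)" if t: "t \<in> {0..T}" for t
    using NT_section'[OF m t] b[OF t] c by (subst sq_int_iff_nn_integral) auto
  have "(\<integral>\<^sup>+p. ennreal ((norm (LINT s:{0..fst p}|lborel. Y s (snd p)))\<^sup>2) \<partial>NT T)
    = (\<integral>\<^sup>+t. (\<integral>\<^sup>+\<omega>. ennreal ((norm (LINT s:{0..t}|lborel. Y s \<omega>))\<^sup>2) \<partial>M) \<partial>time_lborel T)"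
    using nn_integral_NT'[of "\<lambda>t \<omega>. ennreal ((norm (LINT s:{0..t}|lborel. Y s \<omega>))\<^sup>2)" T] m
    by (simp add: nn_integral_time_lborel case_prod_unfold)
  also have "\<dots> \<le> (\<integral>\<^sup>+t. c \<partial>time_lborel T)" by (intro nn_integral_mono b) simp
  also have "\<dots> < \<infinity>"
    using c finite_measure.emeasure_finite[OF finite_time_lborel, of T "{0..T}"]
    by (simp add: ennreal_mult_less_top less_top)
  finally show "sq_int (NT T) (\<lambda>p. LINT s:{0..fst p}|lborel. Y s (snd p))"
    using m by (subst sq_int_iff_nn_integral) auto
qed

lemma sq_int_NT_lift:
  fixes f :: "'a \<Rightarrow> 'b::euclidean_space"
  assumes "sq_int M f" shows "sq_int (NT T) (\<lambda>p. f (snd p))"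
proof (rule sq_int_dominated)
  show "(\<lambda>p. f (snd p)) \<in> borel_measurable (NT T)"
    unfolding NT_def using measurable_compose[OF measurable_snd sq_intD(1)[OF assms]] .
  have "integrable (time_lborel T) (\<lambda>s. 1::real)"
    using finite_measure.integrable_const[OF finite_time_lborel] .
  from NT_product(1)[OF this sq_intD(2)[OF assms]]
  show "integrable (NT T) (\<lambda>p. (norm (f (snd p)))\<^sup>2)" by simp
qed simp

lemma NT_Fubini:
  fixes f :: "real \<times> 'a \<Rightarrow> real"
  assumes "integrable (NT T) f"
  shows "(\<integral>p. f p \<partial>NT T) = (\<integral>\<omega>. (\<integral>s. f (s, \<omega>) \<partial>time_lborel T) \<partial>M)"
    "(\<integral>p. f p \<partial>NT T) = (\<integral>s. (\<integral>\<omega>. f (s, \<omega>) \<partial>M) \<partial>time_lborel T)"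
    "AE \<omega> in M. integrable (time_lborel T) (\<lambda>s. f (s, \<omega>))"
proof -
  interpret pair_sigma_finite "time_lborel T" M by (rule NT_pair)
  have f: "integrable (time_lborel T \<Otimes>\<^sub>M M) (case_prod (\<lambda>s \<omega>. f (s, \<omega>)))"
    using assms by (simp add: NT_def)
  show "(\<integral>p. f p \<partial>NT T) = (\<integral>\<omega>. (\<integral>s. f (s, \<omega>) \<partial>time_lborel T) \<partial>M)"
    using integral_snd[OF f] by (simp add: NT_def)
  show "(\<integral>p. f p \<partial>NT T) = (\<integral>s. (\<integral>\<omega>. f (s, \<omega>) \<partial>M) \<partial>time_lborel T)"
    using integral_fst[OF f] by (simp add: NT_def)
  show "AE \<omega> in M. integrable (time_lborel T) (\<lambda>s. f (s, \<omega>))" by (rule AE_integrable_snd[OF f])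
qed

lemma locally_square_integrable_NT:
  assumes "prog_measurable F Y" "locally_square_integrable M Y" "0 \<le> T"
  shows "sq_int (NT T) (case_prod Y)"
proof -
  note Y = prog_measurable_NT[OF assms(1,3)]
  have "(\<integral>\<^sup>+p. ennreal ((norm (case_prod Y p))\<^sup>2) \<partial>NT T) = (\<integral>\<^sup>+\<omega>. (\<integral>\<^sup>+s\<in>{0..T}. ennreal ((norm (Y s \<omega>))\<^sup>2) \<partial>lborel) \<partial>M)"
    using nn_integral_NT[of "\<lambda>s \<omega>. ennreal ((norm (Y s \<omega>))\<^sup>2)" T] Y by (simp add: case_prod_unfold)
  also have "\<dots> < \<infinity>" using assms(2,3) unfolding locally_square_integrable_def by blast
  finally show ?thesis using Y by (subst sq_int_iff_nn_integral) auto
qed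

text \<open>
  Write \<open>X = D + I\<close> with the drift part \<open>D t = x + \<integral>\<^sub>0\<^sup>t b s ds\<close>, \<open>b = (A + C K) X\<close>, and the Ito integral
  \<open>I\<close> of \<open>z = K X\<close>. The form of \<open>D T\<close> is differentiated along each path, the form of \<open>I T\<close> is given by
  the isometry. In the mixed term the martingale property replaces \<open>I T\<close>, paired with \<open>b s\<close>, by
  \<open>I s = X s - D s\<close>. The contributions of \<open>D\<close> cancel, and \<open>2 b \<bullet> S X + z \<bullet> S z\<close> is the form of
  \<open>lyap_op (- (A + C K)) K S\<close> at \<open>X\<close>.
\<close>
theorem closed_loop_second_moment:
  fixes S A C K :: "real^'n^'n"
  assumes sol: "closed_loop_solution M F W A C K x X" and S: "transpose S = S" and T: "0 \<le> T"
  shows "sq_int M (X T)" "sq_int (NT T) (case_prod X)"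
    "expectation (\<lambda>\<omega>. X T \<omega> \<bullet> (S *v X T \<omega>)) =
      x \<bullet> (S *v x) + (\<integral>p. case_prod X p \<bullet> (lyap_op (- (A + C ** K)) K S *v case_prod X p) \<partial>NT T)"
proof -
  define B where "B = A + C ** K"
  define b where "b s \<omega> = B *v X s \<omega>" for s \<omega>
  define z where "z s \<omega> = K *v X s \<omega>" for s \<omega>
  have AE_cont: "AE \<omega> in M. continuous_on {0..} (\<lambda>t. X t \<omega>)"
    and X_prog: "prog_measurable F X" and X_lsq: "locally_square_integrable M X"
    using sol unfolding closed_loop_solution_def controlled_solution_def by blast+
  define D where "D t \<omega> = x + (LINT s:{0..t}|lborel. b s \<omega>)" for t \<omega>
  have b_eq: "A *v X s \<omega> + C *v (K *v X s \<omega>) = b s \<omega>" for s \<omega>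
    by (simp add: b_def B_def matrix_vector_mult_add_rdistrib matrix_vector_mul_assoc)
  have "\<exists>I. has_ito_integral M F W t z I \<and> (AE \<omega> in M. X t \<omega> = D t \<omega> + I \<omega>)" if "0 \<le> t" for t
    using sol that unfolding closed_loop_solution_def controlled_solution_def b_eq D_def z_def by blast
  then obtain I where I: "\<And>t. 0 \<le> t \<Longrightarrow> has_ito_integral M F W t z (I t)"
    and X_eq: "\<And>t. 0 \<le> t \<Longrightarrow> AE \<omega> in M. X t \<omega> = D t \<omega> + I t \<omega>" by metis
  have XN: "sq_int (NT t) (case_prod X)" if "0 \<le> t" for t
    by (rule locally_square_integrable_NT[OF X_prog X_lsq that])
  have bN: "sq_int (NT t) (case_prod b)" if "0 \<le> t" for t
    using sq_int_matrix[OF XN[OF that], of B] by (simp add: b_def case_prod_unfold)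
  have const: "sq_int N (\<lambda>_. x)" if "finite_measure N" for N :: "'z measure"
    using finite_measure.sq_int_bounded[OF that, of "\<lambda>_. x"] by auto
  have DM: "sq_int M (D t)" if "0 \<le> t" for t
    unfolding D_def using time_integral_sq_int(1)[OF bN[OF that] that, of t] that
    by (intro sq_int_add const finite_measure_axioms) auto
  have DN: "sq_int (NT t) (\<lambda>p. D (fst p) (snd p))" if "0 \<le> t" for t
    unfolding D_def by (intro sq_int_add const finite_NT time_integral_sq_int(2)[OF bN[OF that] that])
  have IM: "sq_int M (I t)" if "0 \<le> t" for t by (rule has_ito_sq_int(1)[OF I[OF that] that])
  have XM: "sq_int M (X t)" if t: "0 \<le> t" for t
  proof (rule sq_int_cong_AE[OF sq_int_add[OF DM[OF t] IM[OF t]]])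
    show "X t \<in> borel_measurable M"
      by (rule measurable_F[OF t prog_measurable_adapted[OF X_prog t]])
    show "AE \<omega> in M. D t \<omega> + I t \<omega> = X t \<omega>" using X_eq[OF t] by eventually_elim simp
  qed
  show "sq_int M (X T)" "sq_int (NT T) (case_prod X)" by (rule XM[OF T], rule XN[OF T])
  have bad: "adapted_sq t (b t)" if t: "0 \<le> t" for t
    unfolding b_def
    by (rule adapted_sq_matrix) (use prog_measurable_adapted[OF X_prog t] XM[OF t] in \<open>simp add: adapted_sq_def\<close>)
  note bT = bN[OF T] and DT = DN[OF T]
  have bp: "case_prod b p = b (fst p) (snd p)" for p by (simp add: case_prod_unfold)
  note bT' = bT[unfolded case_prod_unfold] and XT' = XN[OF T, unfolded case_prod_unfold]

  \<comment> \<open>continuity of the paths of \<open>X\<close> makes the drift part differentiable in time\<close>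
  have DD: "expectation (\<lambda>\<omega>. D T \<omega> \<bullet> (S *v D T \<omega>)) =
    x \<bullet> (S *v x) + (\<integral>p. 2 * (b (fst p) (snd p) \<bullet> (S *v D (fst p) (snd p))) \<partial>NT T)"
  proof -
    have i: "integrable (NT T) (\<lambda>p. 2 * (b (fst p) (snd p) \<bullet> (S *v D (fst p) (snd p))))"
      by (intro integrable_mult_right integrable_inner bT' sq_int_matrix DT)
    have "AE \<omega> in M. D T \<omega> \<bullet> (S *v D T \<omega>) = x \<bullet> (S *v x) + (\<integral>s. 2 * (b s \<omega> \<bullet> (S *v D s \<omega>)) \<partial>time_lborel T)"
      using AE_cont
    proof eventually_elim
      fix \<omega> assume "continuous_on {0..} (\<lambda>t. X t \<omega>)"
      then have "continuous_on {0..T} (\<lambda>t. b t \<omega>)"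
        unfolding b_def by (intro bounded_linear.continuous_on[OF matrix_vector_mul_bounded_linear])
          (auto elim: continuous_on_subset)
      from time_integral_FTC_form[OF T this S, of "\<lambda>t. D t \<omega>" x]
      show "D T \<omega> \<bullet> (S *v D T \<omega>) = x \<bullet> (S *v x) + (\<integral>s. 2 * (b s \<omega> \<bullet> (S *v D s \<omega>)) \<partial>time_lborel T)"
        by (simp add: D_def integral_time_lborel)
    qed
    moreover have "D T \<in> borel_measurable M" using sq_intD(1)[OF DM[OF T]] .
    moreover have mS: "(\<lambda>\<omega>. S *v D T \<omega>) \<in> borel_measurable M" using sq_intD(1)[OF sq_int_matrix[OF DM[OF T]]] .
    moreover have int2: "integrable M (\<lambda>\<omega>. \<integral>s. 2 * (b s \<omega> \<bullet> (S *v D s \<omega>)) \<partial>time_lborel T)"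
    proof -
      interpret pair_sigma_finite "time_lborel T" M by (rule NT_pair)
      show ?thesis using integrable_snd[of "\<lambda>s \<omega>. 2 * (b s \<omega> \<bullet> (S *v D s \<omega>))"] i
        unfolding NT_def case_prod_unfold by simp
    qed
    ultimately have "expectation (\<lambda>\<omega>. D T \<omega> \<bullet> (S *v D T \<omega>)) =
      expectation (\<lambda>\<omega>. x \<bullet> (S *v x) + (\<integral>s. 2 * (b s \<omega> \<bullet> (S *v D s \<omega>)) \<partial>time_lborel T))"
      by (intro integral_cong_AE borel_measurable_inner borel_measurable_add borel_measurable_const borel_measurable_integrable[OF int2])
    also have "\<dots> = x \<bullet> (S *v x) + expectation (\<lambda>\<omega>. (\<integral>s. 2 * (b s \<omega> \<bullet> (S *v D s \<omega>)) \<partial>time_lborel T))"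
      using int2 by (simp add: prob_space)
    also have "\<dots> = x \<bullet> (S *v x) + (\<integral>p. 2 * (b (fst p) (snd p) \<bullet> (S *v D (fst p) (snd p))) \<partial>NT T)"
      using NT_Fubini(1)[OF i] by simp
    finally show ?thesis .
  qed

  have II: "expectation (\<lambda>\<omega>. I T \<omega> \<bullet> (S *v I T \<omega>)) = (\<integral>p. z (fst p) (snd p) \<bullet> (S *v z (fst p) (snd p)) \<partial>NT T)"
    using ito_isometry[OF I[OF T] T, of S] by (simp add: case_prod_unfold)

  have DI: "expectation (\<lambda>\<omega>. D T \<omega> \<bullet> (S *v I T \<omega>)) =
    (\<integral>p. b (fst p) (snd p) \<bullet> (S *v (X (fst p) (snd p) - D (fst p) (snd p))) \<partial>NT T)"
  proof -
    let ?SI = "\<lambda>\<omega>. S *v I T \<omega>"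
    have SI: "sq_int M ?SI" by (intro sq_int_matrix IM T)
    have i: "integrable (NT T) (\<lambda>p. b (fst p) (snd p) \<bullet> ?SI (snd p))"
      by (intro integrable_inner bT' sq_int_NT_lift[OF SI])
    have i2: "integrable (NT T) (\<lambda>p. b (fst p) (snd p) \<bullet> (S *v (X (fst p) (snd p) - D (fst p) (snd p))))"
      by (intro integrable_inner bT' sq_int_matrix sq_int_diff XT' DT)
    \<comment> \<open>needed to take the time integral out of the inner product with \<open>S (I T)\<close>\<close>
    have bint: "AE \<omega> in M. integrable (time_lborel T) (\<lambda>s. b s \<omega>)"
      using AE_cont
    proof eventually_elim
      fix \<omega> assume "continuous_on {0..} (\<lambda>t. X t \<omega>)"
      then have "continuous_on {0..T} (\<lambda>t. b t \<omega>)"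
        unfolding b_def by (intro bounded_linear.continuous_on[OF matrix_vector_mul_bounded_linear])
          (auto elim: continuous_on_subset)
      then have "set_integrable lborel {0..T} (\<lambda>t. b t \<omega>)" by (rule borel_integrable_atLeastAtMost')
      then show "integrable (time_lborel T) (\<lambda>s. b s \<omega>)"
        unfolding time_lborel_def set_integrable_def by (subst integrable_restrict_space) auto
    qed
    have "AE \<omega> in M. D T \<omega> \<bullet> ?SI \<omega> = x \<bullet> ?SI \<omega> + (\<integral>s. b s \<omega> \<bullet> ?SI \<omega> \<partial>time_lborel T)"
      using bint
    proof eventually_elim
      fix \<omega> assume "integrable (time_lborel T) (\<lambda>s. b s \<omega>)"
      then have "(\<integral>s. b s \<omega> \<bullet> ?SI \<omega> \<partial>time_lborel T) = (\<integral>s. b s \<omega> \<partial>time_lborel T) \<bullet> ?SI \<omega>"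
        by (intro integral_inner_left) simp
      then show "D T \<omega> \<bullet> ?SI \<omega> = x \<bullet> ?SI \<omega> + (\<integral>s. b s \<omega> \<bullet> ?SI \<omega> \<partial>time_lborel T)"
        by (simp add: D_def inner_add_left integral_time_lborel[symmetric])
    qed
    moreover have int2: "integrable M (\<lambda>\<omega>. \<integral>s. b s \<omega> \<bullet> ?SI \<omega> \<partial>time_lborel T)"
    proof -
      interpret pair_sigma_finite "time_lborel T" M by (rule NT_pair)
      show ?thesis using integrable_snd[of "\<lambda>s \<omega>. b s \<omega> \<bullet> ?SI \<omega>"] i
        unfolding NT_def case_prod_unfold by simp
    qed
    moreover have xS: "integrable M (\<lambda>\<omega>. x \<bullet> ?SI \<omega>)"
      by (intro integrable_inner const finite_measure_axioms SI)
    ultimately have "expectation (\<lambda>\<omega>. D T \<omega> \<bullet> ?SI \<omega>) =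
      expectation (\<lambda>\<omega>. x \<bullet> ?SI \<omega> + (\<integral>s. b s \<omega> \<bullet> ?SI \<omega> \<partial>time_lborel T))"
      by (intro integral_cong_AE borel_measurable_add borel_measurable_integrable[OF int2] borel_measurable_integrable[OF xS]
          borel_measurable_integrable[OF integrable_inner[OF DM[OF T] SI]])
    also have "\<dots> = expectation (\<lambda>\<omega>. x \<bullet> ?SI \<omega>) + expectation (\<lambda>\<omega>. (\<integral>s. b s \<omega> \<bullet> ?SI \<omega> \<partial>time_lborel T))"
      by (rule Bochner_Integration.integral_add[OF xS int2])
    also have "expectation (\<lambda>\<omega>. x \<bullet> ?SI \<omega>) = 0"
      using ito_mean[OF I[OF T] T, of "transpose S *v x"]
      by (simp only: transpose_form)
    also have "0 + expectation (\<lambda>\<omega>. (\<integral>s. b s \<omega> \<bullet> ?SI \<omega> \<partial>time_lborel T)) = (\<integral>s. expectation (\<lambda>\<omega>. b s \<omega> \<bullet> ?SI \<omega>) \<partial>time_lborel T)"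
      using NT_Fubini(1,2)[OF i] by simp
    also have "\<dots> = (\<integral>s. expectation (\<lambda>\<omega>. b s \<omega> \<bullet> (S *v (X s \<omega> - D s \<omega>))) \<partial>time_lborel T)"
    proof (rule Bochner_Integration.integral_cong[OF refl])
      fix s assume "s \<in> space (time_lborel T)"
      then have s: "0 \<le> s" "s \<le> T" by auto
      let ?\<eta> = "\<lambda>\<omega>. transpose S *v b s \<omega>"
      have "expectation (\<lambda>\<omega>. ?\<eta> \<omega> \<bullet> I T \<omega>) = expectation (\<lambda>\<omega>. ?\<eta> \<omega> \<bullet> I s \<omega>)"
        by (rule ito_martingale[OF I[OF T] I[OF s(1)] s adapted_sq_matrix[OF bad[OF s(1)]]])
      then have "expectation (\<lambda>\<omega>. b s \<omega> \<bullet> ?SI \<omega>) = expectation (\<lambda>\<omega>. b s \<omega> \<bullet> (S *v I s \<omega>))"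
        by (simp only: transpose_form)
      also have "\<dots> = expectation (\<lambda>\<omega>. b s \<omega> \<bullet> (S *v (X s \<omega> - D s \<omega>)))"
      proof (rule integral_cong_AE)
        show "AE \<omega> in M. b s \<omega> \<bullet> (S *v I s \<omega>) = b s \<omega> \<bullet> (S *v (X s \<omega> - D s \<omega>))"
          using X_eq[OF s(1)] by eventually_elim simp
      qed (intro borel_measurable_integrable integrable_inner sq_int_matrix sq_int_diff IM XM DM adapted_sqD(2)[OF bad] s)+
      finally show "expectation (\<lambda>\<omega>. b s \<omega> \<bullet> ?SI \<omega>) = expectation (\<lambda>\<omega>. b s \<omega> \<bullet> (S *v (X s \<omega> - D s \<omega>)))" .
    qed
    also have "\<dots> = (\<integral>p. b (fst p) (snd p) \<bullet> (S *v (X (fst p) (snd p) - D (fst p) (snd p))) \<partial>NT T)"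
      using NT_Fubini(2)[OF i2] by simp
    finally show ?thesis .
  qed

  let ?f1 = "\<lambda>\<omega>. D T \<omega> \<bullet> (S *v D T \<omega>)" and ?f2 = "\<lambda>\<omega>. D T \<omega> \<bullet> (S *v I T \<omega>)" and ?f3 = "\<lambda>\<omega>. I T \<omega> \<bullet> (S *v I T \<omega>)"
  have i1: "integrable M ?f1" and i2: "integrable M ?f2" and i3: "integrable M ?f3"
    by (intro integrable_inner sq_int_matrix DM IM T)+
  have "expectation (\<lambda>\<omega>. X T \<omega> \<bullet> (S *v X T \<omega>)) = expectation (\<lambda>\<omega>. ?f1 \<omega> + 2 * ?f2 \<omega> + ?f3 \<omega>)"
  proof (rule integral_cong_AE)
    show "AE \<omega> in M. X T \<omega> \<bullet> (S *v X T \<omega>) = ?f1 \<omega> + 2 * ?f2 \<omega> + ?f3 \<omega>"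
      using X_eq[OF T]
    proof eventually_elim
      fix \<omega> assume "X T \<omega> = D T \<omega> + I T \<omega>"
      then show "X T \<omega> \<bullet> (S *v X T \<omega>) = ?f1 \<omega> + 2 * ?f2 \<omega> + ?f3 \<omega>"
        using form_commute[OF S, of "D T \<omega>" "I T \<omega>"] by (simp add: form_simps)
    qed
  qed (use i1 i2 i3 in \<open>auto intro!: borel_measurable_integrable integrable_inner sq_int_matrix XM T\<close>)
  also have "\<dots> = expectation ?f1 + 2 * expectation ?f2 + expectation ?f3" using i1 i2 i3 by simp
  also have "\<dots> = x \<bullet> (S *v x) + (\<integral>p. 2 * (b (fst p) (snd p) \<bullet> (S *v D (fst p) (snd p)))
      + 2 * (b (fst p) (snd p) \<bullet> (S *v (X (fst p) (snd p) - D (fst p) (snd p))))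
      + z (fst p) (snd p) \<bullet> (S *v z (fst p) (snd p)) \<partial>NT T)"
  proof -
    have zT: "sq_int (NT T) (\<lambda>p. z (fst p) (snd p))" unfolding z_def by (intro sq_int_matrix XT')
    have "integrable (NT T) (\<lambda>p. b (fst p) (snd p) \<bullet> (S *v D (fst p) (snd p)))"
      "integrable (NT T) (\<lambda>p. b (fst p) (snd p) \<bullet> (S *v (X (fst p) (snd p) - D (fst p) (snd p))))"
      "integrable (NT T) (\<lambda>p. z (fst p) (snd p) \<bullet> (S *v z (fst p) (snd p)))"
      by (intro integrable_inner bT' sq_int_matrix DT sq_int_diff XT' zT)+
    then show ?thesis unfolding DD II DI by simp
  qed
  also have "\<dots> = x \<bullet> (S *v x) + (\<integral>p. case_prod X p \<bullet> (lyap_op (- (A + C ** K)) K S *v case_prod X p) \<partial>NT T)"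
  proof -
    have "2 * (b s \<omega> \<bullet> (S *v D s \<omega>)) + 2 * (b s \<omega> \<bullet> (S *v (X s \<omega> - D s \<omega>))) + z s \<omega> \<bullet> (S *v z s \<omega>)
      = X s \<omega> \<bullet> (lyap_op (- (A + C ** K)) K S *v X s \<omega>)" for s \<omega>
      unfolding lyap_op_form B_def[symmetric] b_def z_def
      using form_commute[OF S, of "X s \<omega>" "B *v X s \<omega>"] by (simp add: form_simps)
    then show ?thesis by (simp add: case_prod_unfold)
  qed
  finally show "expectation (\<lambda>\<omega>. X T \<omega> \<bullet> (S *v X T \<omega>)) =
      x \<bullet> (S *v x) + (\<integral>p. case_prod X p \<bullet> (lyap_op (- (A + C ** K)) K S *v case_prod X p) \<partial>NT T)" .
qed

end

section \<open>Stability and Lyapunov inequalities\<close>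

lemma norm_outer: "norm (outer v) = (norm v)\<^sup>2"
proof -
  have "outer v \<bullet> outer v = ((norm v)\<^sup>2)\<^sup>2"
    using inner_outer[of "outer v" v] outer_form[of v v v] by (simp add: dot_square_norm power2_eq_square)
  then have "(norm (outer v))\<^sup>2 = ((norm v)\<^sup>2)\<^sup>2" by (simp add: power2_norm_eq_inner)
  then show ?thesis by (rule power2_eq_imp_eq) auto
qed

lemma continuous_outer: "continuous_on UNIV (outer :: real^'n \<Rightarrow> real^'n^'n)"
  unfolding outer_def by (intro continuous_intros)

lemma pos_def_perturbation:
  fixes N R :: "real^'n^'n"
  assumes N: "pos_def N" and R: "transpose R = R"
  obtains \<epsilon> where "0 < \<epsilon>" "pos_def (N - \<epsilon> *\<^sub>R R)"
proof -
  obtain \<delta> where \<delta>: "0 < \<delta>" "\<And>v. \<delta> * (v \<bullet> v) \<le> v \<bullet> (N *v v)" 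
    by (rule pos_def_lower_bound[OF N]) (rule that)
  define c where "c = onorm ((*v) R)"
  have c: "0 \<le> c" unfolding c_def by (rule onorm_pos_le[OF matrix_vector_mul_bounded_linear])
  define \<epsilon> where "\<epsilon> = \<delta> / (c + 1)"
  have \<epsilon>: "0 < \<epsilon>" using \<delta>(1) c by (simp add: \<epsilon>_def)
  have \<epsilon>c: "\<epsilon> * c < \<delta>" using \<delta>(1) c by (simp add: \<epsilon>_def field_simps)
  have "0 < v \<bullet> ((N - \<epsilon> *\<^sub>R R) *v v)" if "v \<noteq> 0" for v
  proof -
    have "v \<bullet> (R *v v) \<le> c * (v \<bullet> v)" unfolding c_def using form_le_norm[of v R] by simp
    then have "\<epsilon> * (v \<bullet> (R *v v)) \<le> \<epsilon> * (c * (v \<bullet> v))" using \<epsilon> by (intro mult_left_mono) auto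
    moreover have "(\<epsilon> * c) * (v \<bullet> v) < \<delta> * (v \<bullet> v)" using \<epsilon>c that by (intro mult_strict_right_mono) auto
    moreover have "v \<bullet> ((N - \<epsilon> *\<^sub>R R) *v v) = v \<bullet> (N *v v) - \<epsilon> * (v \<bullet> (R *v v))" by (simp add: form_simps)
    ultimately show ?thesis using \<delta>(2)[of v] by (simp add: mult.assoc)
  qed
  moreover have "transpose (N - \<epsilon> *\<^sub>R R) = N - \<epsilon> *\<^sub>R R"
    using form_commute[OF pos_def_symmetric[OF N]] form_commute[OF R]
    unfolding symmetric_iff_form by (simp add: form_simps)
  ultimately show ?thesis using that[OF \<epsilon>] unfolding pos_def_def by blast
qed

context brownian
begin

lemma nn_integral_half_line:
  fixes X :: "real \<Rightarrow> 'a \<Rightarrow> 'b::euclidean_space"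
  assumes X: "prog_measurable F X"
    and le: "\<And>n::nat. (\<integral>\<^sup>+\<omega>. (\<integral>\<^sup>+s\<in>{0..real n}. ennreal ((norm (X s \<omega>))\<^sup>2) \<partial>lborel) \<partial>M) \<le> c"
  shows "(\<integral>\<^sup>+\<omega>. (\<integral>\<^sup>+s\<in>{0..}. ennreal ((norm (X s \<omega>))\<^sup>2) \<partial>lborel) \<partial>M) \<le> c"
proof -
  let ?g = "\<lambda>s \<omega>. ennreal ((norm (X s \<omega>))\<^sup>2)"
  let ?f = "\<lambda>(n::nat) \<omega>. \<integral>\<^sup>+s\<in>{0..real n}. ?g s \<omega> \<partial>lborel"
  have gm: "(\<lambda>p. ?g (fst p) (snd p)) \<in> borel_measurable (NT (real n))" for n
  proof -
    have [measurable]: "case_prod X \<in> borel_measurable (NT (real n))" by (rule prog_measurable_NT[OF X]) simp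
    have "(\<lambda>p. ennreal ((norm (case_prod X p))\<^sup>2)) \<in> borel_measurable (NT (real n))" by measurable
    then show ?thesis by (simp add: case_prod_unfold)
  qed
  have fm: "?f n \<in> borel_measurable M" for n
  proof -
    interpret pair_sigma_finite "time_lborel (real n)" M by (rule NT_pair)
    have "(\<lambda>q. ?g (snd q) (fst q)) \<in> borel_measurable (M \<Otimes>\<^sub>M time_lborel (real n))"
      using measurable_compose[OF measurable_pair_swap' gm[unfolded NT_def]] by (simp add: case_prod_unfold)
    then show ?thesis
      using M1.borel_measurable_nn_integral[of "\<lambda>\<omega> s. ?g s \<omega>" M]
      by (simp add: case_prod_unfold nn_integral_time_lborel)
  qed
  have inc: "incseq (\<lambda>n s. ?g s \<omega> * indicator {0..real n} s)" for \<omega>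
    by (rule incseq_SucI) (auto simp: le_fun_def indicator_def)
  have sup: "(\<integral>\<^sup>+s\<in>{0..}. ?g s \<omega> \<partial>lborel) = (SUP n. ?f n \<omega>)" if \<omega>: "\<omega> \<in> space M" for \<omega>
  proof -
    have eq: "?g s \<omega> * indicator {0..} s = (SUP n. ?g s \<omega> * indicator {0..real n} s)" for s
    proof (rule antisym)
      obtain n :: nat where "s \<le> real n" using real_arch_simple by blast
      then have "?g s \<omega> * indicator {0..} s \<le> ?g s \<omega> * indicator {0..real n} s" by (auto simp: indicator_def)
      also have "\<dots> \<le> (SUP n. ?g s \<omega> * indicator {0..real n} s)" by (rule SUP_upper) simp
      finally show "?g s \<omega> * indicator {0..} s \<le> (SUP n. ?g s \<omega> * indicator {0..real n} s)" .
    qed (auto intro!: SUP_least simp: indicator_def)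
    have "(\<lambda>s. ?g s \<omega> * indicator {0..real n} s) \<in> borel_measurable lborel" for n
      using NT_section[OF gm \<omega>, of n] unfolding time_lborel_def
      by (subst (asm) borel_measurable_restrict_space_iff_ennreal) auto
    then show ?thesis unfolding eq by (intro nn_integral_monotone_convergence_SUP inc)
  qed
  have "(\<integral>\<^sup>+\<omega>. (\<integral>\<^sup>+s\<in>{0..}. ?g s \<omega> \<partial>lborel) \<partial>M) = (\<integral>\<^sup>+\<omega>. (SUP n. ?f n \<omega>) \<partial>M)"
    by (intro nn_integral_cong sup)
  also have "\<dots> = (SUP n. \<integral>\<^sup>+\<omega>. ?f n \<omega> \<partial>M)"
    by (intro nn_integral_monotone_convergence_SUP fm incseq_SucI le_funI nn_integral_mono) (auto simp: indicator_def)
  also have "\<dots> \<le> c" by (intro SUP_least le)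
  finally show ?thesis .
qed

lemma NT_norm_sq:
  assumes "sq_int (NT T) (case_prod X)"
  shows "(\<integral>\<^sup>+\<omega>. (\<integral>\<^sup>+s\<in>{0..T}. ennreal ((norm (X s \<omega>))\<^sup>2) \<partial>lborel) \<partial>M) = ennreal (\<integral>p. (norm (case_prod X p))\<^sup>2 \<partial>NT T)"
proof -
  note [measurable] = sq_intD(1)[OF assms]
  have "(\<lambda>p. ennreal ((norm (case_prod X p))\<^sup>2)) \<in> borel_measurable (NT T)" by measurable
  then have "(\<integral>\<^sup>+\<omega>. (\<integral>\<^sup>+s\<in>{0..T}. ennreal ((norm (X s \<omega>))\<^sup>2) \<partial>lborel) \<partial>M) = (\<integral>\<^sup>+p. ennreal ((norm (case_prod X p))\<^sup>2) \<partial>NT T)"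
    using nn_integral_NT[of "\<lambda>s \<omega>. ennreal ((norm (X s \<omega>))\<^sup>2)" T] by (simp add: case_prod_unfold)
  then show ?thesis using sq_int_nn_integral[OF assms] by simp
qed

text \<open>
  In the second moment identity with weight \<open>S\<close> the left-hand side is nonnegative, while the integrand on the
  right is at most \<open>- \<delta> |X|\<^sup>2\<close>. This bounds the integral of \<open>|X|\<^sup>2\<close> uniformly in the time horizon.
\<close>
theorem sq_integrable_if_lyap:
  fixes S :: "real^'n^'n"
  assumes S: "pos_def S" "pos_def (- lyap_op (- (A + C ** K)) K S)"
    and sol: "closed_loop_solution M F W A C K x X"
  shows "(\<integral>\<^sup>+\<omega>. (\<integral>\<^sup>+s\<in>{0..}. ennreal ((norm (X s \<omega>))\<^sup>2) \<partial>lborel) \<partial>M) < \<infinity>"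
proof -
  define R where "R = lyap_op (- (A + C ** K)) K S"
  obtain \<delta> where \<delta>: "0 < \<delta>" "\<And>v. \<delta> * (v \<bullet> v) \<le> v \<bullet> ((- R) *v v)"
    using pos_def_lower_bound[OF S(2)] unfolding R_def by metis
  have X: "prog_measurable F X"
    using sol unfolding closed_loop_solution_def controlled_solution_def by blast
  have "(\<integral>\<^sup>+\<omega>. (\<integral>\<^sup>+s\<in>{0..T}. ennreal ((norm (X s \<omega>))\<^sup>2) \<partial>lborel) \<partial>M) \<le> ennreal ((x \<bullet> (S *v x)) / \<delta>)"
    if T: "0 \<le> T" for T
  proof -
    note m = closed_loop_second_moment[OF sol pos_def_symmetric[OF S(1)] T, folded R_def]
    have i: "integrable (NT T) (\<lambda>p. case_prod X p \<bullet> (R *v case_prod X p))"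
      by (intro integrable_inner sq_int_matrix m)
    have "0 \<le> expectation (\<lambda>\<omega>. X T \<omega> \<bullet> (S *v X T \<omega>))"
      using pos_def_imp_semidef[OF S(1)] unfolding pos_semidef_def by simp
    also have "\<dots> = x \<bullet> (S *v x) + (\<integral>p. case_prod X p \<bullet> (R *v case_prod X p) \<partial>NT T)" by (rule m(3))
    also have "(\<integral>p. case_prod X p \<bullet> (R *v case_prod X p) \<partial>NT T) \<le> (\<integral>p. - \<delta> * (norm (case_prod X p))\<^sup>2 \<partial>NT T)"
    proof (rule integral_mono[OF i])
      show "integrable (NT T) (\<lambda>p. - \<delta> * (norm (case_prod X p))\<^sup>2)" using sq_intD(2)[OF m(2)] by simp
      show "case_prod X p \<bullet> (R *v case_prod X p) \<le> - \<delta> * (norm (case_prod X p))\<^sup>2" for p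
        using \<delta>(2)[of "case_prod X p"] unfolding minus_form by (simp add: dot_square_norm)
    qed
    finally have "(\<integral>p. (norm (case_prod X p))\<^sup>2 \<partial>NT T) \<le> (x \<bullet> (S *v x)) / \<delta>"
      using \<delta>(1) by (simp add: field_simps)
    then show ?thesis unfolding NT_norm_sq[OF m(2)] by (rule ennreal_leI)
  qed
  then have "(\<integral>\<^sup>+\<omega>. (\<integral>\<^sup>+s\<in>{0..}. ennreal ((norm (X s \<omega>))\<^sup>2) \<partial>lborel) \<partial>M) \<le> ennreal ((x \<bullet> (S *v x)) / \<delta>)"
    by (intro nn_integral_half_line[OF X]) simp
  then show ?thesis by (rule le_less_trans) simp
qed

text \<open>
  \<open>P\<close> collects the second moments up to time \<open>T\<close> of the solutions \<open>X k\<close> that start at the basis vectors. Paired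
  with the outer square of \<open>v\<close>, the second moment identity gives
  \<open>v \<bullet> L P v \<le> q T (v \<bullet> v) - v \<bullet> v\<close>, where \<open>q T\<close> is the sum of the second moments at time \<open>T\<close> and \<open>L\<close> the
  adjoint closed-loop operator. Stability makes \<open>q\<close> integrable over the half-line, so \<open>q T < 1\<close> for some
  \<open>T\<close>. A small multiple of the identity is added to make \<open>P\<close> definite.
\<close>
theorem lyap_if_stable:
  fixes A C K :: "real^'n^'n"
  assumes stable: "L2_stable_closed_loop M F W A C K"
  shows "\<exists>P. pos_def P \<and> pos_def (- lyap_adj_op (- (A + C ** K)) K P)"
proof -
  define D where "D = - (A + C ** K)"
  let ?nn = "\<lambda>Y. (\<integral>\<^sup>+\<omega>. (\<integral>\<^sup>+s\<in>{0..}. ennreal ((norm (Y s \<omega>))\<^sup>2) \<partial>lborel) \<partial>M)"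
  have "\<forall>k::'n. \<exists>X. closed_loop_solution M F W A C K (axis k 1) X \<and> ?nn X < \<infinity>"
    using stable unfolding L2_stable_closed_loop_def by blast
  from choice[OF this] obtain X
    where X: "\<forall>k::'n. closed_loop_solution M F W A C K (axis k 1) (X k) \<and> ?nn (X k) < \<infinity>" ..
  have sol: "closed_loop_solution M F W A C K (axis k 1) (X k)" and fin: "?nn (X k) < \<infinity>" for k
    using X by simp_all
  note mom = closed_loop_second_moment[OF sol]
  have sym1: "transpose (mat 1 :: real^'n^'n) = mat 1" by simp
  note sqM = mom(1)[OF sym1] and sqN = mom(2)[OF sym1]
  define c where "c k = enn2real (?nn (X k))" for k
  have c: "(\<integral>p. (norm (case_prod (X k) p))\<^sup>2 \<partial>NT T) \<le> c k" if T: "0 \<le> T" for k T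
  proof -
    have "ennreal (\<integral>p. (norm (case_prod (X k) p))\<^sup>2 \<partial>NT T) \<le> ?nn (X k)"
      unfolding NT_norm_sq[OF sqN[OF T], symmetric]
      by (intro nn_integral_mono) (auto simp: indicator_def)
    also have "\<dots> = ennreal (c k)" unfolding c_def using fin[of k] by simp
    finally show ?thesis by (subst (asm) ennreal_le_iff) (auto simp: c_def)
  qed
  define q where "q s = (\<Sum>k\<in>UNIV. expectation (\<lambda>\<omega>. (norm (X k s \<omega>))\<^sup>2))" for s
  have "\<exists>T\<ge>0. q T < 1"
  proof (rule ccontr)
    assume "\<not> ?thesis"
    then have q1: "1 \<le> q s" if "0 \<le> s" for s using that by force
    have "T \<le> (\<Sum>k\<in>UNIV. c k)" if T: "0 \<le> T" for T
    proof -
      interpret pair_sigma_finite "time_lborel T" M by (rule NT_pair)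
      have i: "integrable (NT T) (\<lambda>p. (norm (case_prod (X k) p))\<^sup>2)" for k using sq_intD(2)[OF sqN[OF T]] .
      have ik: "integrable (time_lborel T) (\<lambda>s. expectation (\<lambda>\<omega>. (norm (X k s \<omega>))\<^sup>2))" for k
        using integrable_fst[of "\<lambda>s \<omega>. (norm (X k s \<omega>))\<^sup>2"] i[of k] unfolding NT_def by (simp add: case_prod_unfold)
      have "T = (\<integral>s. 1 \<partial>time_lborel T)" using T by (simp add: time_lborel_def measure_restrict_space space_restrict_space)
      also have "\<dots> \<le> (\<integral>s. q s \<partial>time_lborel T)"
        unfolding q_def
        by (rule integral_mono) (use q1 in \<open>auto simp: q_def intro!: ik Bochner_Integration.integrable_sum finite_measure.integrable_const[OF finite_time_lborel]\<close>)
      also have "\<dots> = (\<Sum>k\<in>UNIV. (\<integral>s. expectation (\<lambda>\<omega>. (norm (X k s \<omega>))\<^sup>2) \<partial>time_lborel T))"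
        unfolding q_def by (rule Bochner_Integration.integral_sum) (rule ik)
      also have "\<dots> = (\<Sum>k\<in>UNIV. (\<integral>p. (norm (case_prod (X k) p))\<^sup>2 \<partial>NT T))"
        by (intro sum.cong refl) (use NT_Fubini(2)[OF i] in simp)
      also have "\<dots> \<le> (\<Sum>k\<in>UNIV. c k)" by (intro sum_mono c T)
      finally show ?thesis .
    qed
    from this[of "\<bar>\<Sum>k\<in>UNIV. c k\<bar> + 1"] show False by simp
  qed
  then obtain T where T: "0 \<le> T" "q T < 1" by blast
  \<comment> \<open>the matrix valued integrand is integrable because the norm of \<open>outer v\<close> is \<open>(norm v)\<^sup>2\<close>\<close>
  have iN: "integrable (NT T) (\<lambda>p. outer (case_prod (X k) p))" for k
  proof (rule Bochner_Integration.integrable_bound[OF sq_intD(2)[OF sqN[OF T(1), of k]]])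
    show "(\<lambda>p. outer (case_prod (X k) p)) \<in> borel_measurable (NT T)"
      by (rule measurable_compose[OF sq_intD(1)[OF sqN[OF T(1)]] borel_measurable_continuous_onI[OF continuous_outer]])
  qed (simp add: norm_outer)
  define P where "P = (\<Sum>k\<in>UNIV. (\<integral>p. outer (case_prod (X k) p) \<partial>NT T))"
  have P: "P \<bullet> N = (\<Sum>k\<in>UNIV. (\<integral>p. case_prod (X k) p \<bullet> (N *v case_prod (X k) p) \<partial>NT T))" for N
    unfolding P_def inner_sum_left
  proof (intro sum.cong refl)
    fix k
    have "(\<integral>p. outer (case_prod (X k) p) \<partial>NT T) \<bullet> N = (\<integral>p. outer (case_prod (X k) p) \<bullet> N \<partial>NT T)"
      by (rule integral_inner_left[symmetric]) (rule iN)
    then show "(\<integral>p. outer (case_prod (X k) p) \<partial>NT T) \<bullet> N = (\<integral>p. case_prod (X k) p \<bullet> (N *v case_prod (X k) p) \<partial>NT T)"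
      by (simp add: inner_commute[of _ N] inner_outer)
  qed
  have symP: "transpose P = P"
  proof -
    have "P $ i $ j = P $ j $ i" for i j
    proof -
      have "P $ i $ j = P \<bullet> axis i (axis j 1)" "P $ j $ i = P \<bullet> axis j (axis i 1)"
        by (simp_all add: inner_axis)
      moreover have "P \<bullet> N = P \<bullet> transpose N" for N unfolding P by (simp only: form_transpose)
      moreover have "transpose (axis i (axis j 1)) = (axis j (axis i 1) :: real^'n^'n)"
        by (auto simp: transpose_def axis_def vec_eq_iff)
      ultimately show ?thesis by metis
    qed
    then show ?thesis by (simp add: transpose_def vec_eq_iff)
  qed
  have "pos_semidef P"
    unfolding pos_semidef_def
  proof (intro conjI allI symP)
    fix v
    have "v \<bullet> (P *v v) = P \<bullet> outer v" by (rule inner_outer[symmetric])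
    also have "0 \<le> \<dots>" unfolding P outer_form
      by (intro sum_nonneg integral_nonneg_AE) (simp add: inner_commute[of v])
    finally show "0 \<le> v \<bullet> (P *v v)" .
  qed
  have "pos_def (- lyap_adj_op D K P)"
    unfolding pos_def_def
  proof (intro conjI allI impI)
    show "transpose (- lyap_adj_op D K P) = - lyap_adj_op D K P" by (simp add: lyap_adj_op_symmetric symP)
    fix v :: "real^'n" assume v: "v \<noteq> 0"
    have "v \<bullet> (lyap_adj_op D K P *v v) = P \<bullet> lyap_op D K (outer v)"
      unfolding inner_outer[symmetric] lyap_adjoint ..
    also have "\<dots> = (\<Sum>k\<in>UNIV. expectation (\<lambda>\<omega>. X k T \<omega> \<bullet> (outer v *v X k T \<omega>)) - axis k 1 \<bullet> (outer v *v axis k 1))"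
      unfolding P D_def
      using mom(3)[OF pos_semidef_symmetric[OF pos_semidef_outer[of v]] T(1)] by (intro sum.cong refl) simp
    also have "\<dots> = (\<Sum>k\<in>UNIV. expectation (\<lambda>\<omega>. X k T \<omega> \<bullet> (outer v *v X k T \<omega>))) - v \<bullet> v"
    proof -
      have "axis k 1 \<bullet> (outer v *v axis k 1) = v $ k * v $ k" for k
        by (simp add: outer_form inner_axis inner_axis')
      moreover have "v \<bullet> v = (\<Sum>k\<in>UNIV. v $ k * v $ k)" by (simp add: inner_vec_def)
      ultimately show ?thesis by (simp only: sum_subtractf)
    qed
    also have "(\<Sum>k\<in>UNIV. expectation (\<lambda>\<omega>. X k T \<omega> \<bullet> (outer v *v X k T \<omega>))) \<le> (\<Sum>k\<in>UNIV. expectation (\<lambda>\<omega>. (norm (X k T \<omega>))\<^sup>2 * (v \<bullet> v)))"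
    proof (intro sum_mono integral_mono)
      fix k
      show "integrable M (\<lambda>\<omega>. X k T \<omega> \<bullet> (outer v *v X k T \<omega>))"
        by (intro integrable_inner sq_int_matrix sqM T)
      show "integrable M (\<lambda>\<omega>. (norm (X k T \<omega>))\<^sup>2 * (v \<bullet> v))" using sq_intD(2)[OF sqM[OF T(1)]] by simp
      show "X k T \<omega> \<bullet> (outer v *v X k T \<omega>) \<le> (norm (X k T \<omega>))\<^sup>2 * (v \<bullet> v)" for \<omega>
        using Cauchy_Schwarz_ineq[of "X k T \<omega>" v]
        by (simp add: outer_form inner_commute[of v] power2_eq_square dot_square_norm)
    qed
    also have "\<dots> = q T * (v \<bullet> v)" unfolding q_def by (simp add: sum_distrib_right)
    finally have "v \<bullet> (lyap_adj_op D K P *v v) \<le> (q T - 1) * (v \<bullet> v)" by (simp add: left_diff_distrib)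
    also have "\<dots> < 0" using T(2) v by (intro mult_neg_pos) auto
    finally show "0 < v \<bullet> ((- lyap_adj_op D K P) *v v)" by simp
  qed
  then obtain \<epsilon> where \<epsilon>: "0 < \<epsilon>" "pos_def (- lyap_adj_op D K P - \<epsilon> *\<^sub>R lyap_adj_op D K (mat 1))"
    using pos_def_perturbation[OF _ lyap_adj_op_symmetric[OF sym1]] by metis
  have "- lyap_adj_op D K P - \<epsilon> *\<^sub>R lyap_adj_op D K (mat 1) = - lyap_adj_op D K (\<epsilon> *\<^sub>R mat 1 + P)"
    by (simp add: linear_add[OF linear_lyap_adj_op] linear_scale[OF linear_lyap_adj_op])
  moreover have "pos_def (\<epsilon> *\<^sub>R mat 1 + P)"
    by (intro pos_def_add pos_def_scaleR pos_def_mat_1 \<epsilon>(1)) fact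
  ultimately show ?thesis using \<epsilon>(2) unfolding D_def by metis
qed

end

context brownian
begin

section \<open>Mean square estimates\<close>

abbreviation ms :: "('a \<Rightarrow> 'b::euclidean_space) \<Rightarrow> real" where
  "ms f \<equiv> expectation (\<lambda>\<omega>. (norm (f \<omega>))\<^sup>2)"

lemma adapted_sq_add: "adapted_sq s f \<Longrightarrow> adapted_sq s g \<Longrightarrow> adapted_sq s (\<lambda>\<omega>. f \<omega> + g \<omega>)"
  unfolding adapted_sq_def by (auto intro: sq_int_add)

lemma adapted_sq_diff: "adapted_sq s f \<Longrightarrow> adapted_sq s g \<Longrightarrow> adapted_sq s (\<lambda>\<omega>. f \<omega> - g \<omega>)"
  unfolding adapted_sq_def by (auto intro: sq_int_diff)

lemma adapted_sq_scaleR: "adapted_sq s f \<Longrightarrow> adapted_sq s (\<lambda>\<omega>. c *\<^sub>R f \<omega>)"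
  unfolding adapted_sq_def by (auto intro: sq_int_scaleR)

lemma ms_mono:
  assumes "sq_int M f" "sq_int M g" "\<And>\<omega>. \<omega> \<in> space M \<Longrightarrow> (norm (f \<omega>))\<^sup>2 \<le> c * (norm (g \<omega>))\<^sup>2"
  shows "ms f \<le> c * ms g"
proof -
  have "ms f \<le> expectation (\<lambda>\<omega>. c * (norm (g \<omega>))\<^sup>2)"
    using sq_intD(2)[OF assms(1)] sq_intD(2)[OF assms(2)] assms(3) by (intro integral_mono) auto
  then show ?thesis by simp
qed

lemma ms_matrix_le:
  fixes R :: "real^'n^'m"
  assumes "sq_int M f" shows "ms (\<lambda>\<omega>. R *v f \<omega>) \<le> (onorm ((*v) R))\<^sup>2 * ms f"
  by (intro ms_mono sq_int_matrix assms norm_bounded_linear_sq_le matrix_vector_mul_bounded_linear)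

lemma ms_add_le:
  assumes "sq_int M f" "sq_int M g" shows "ms (\<lambda>\<omega>. f \<omega> + g \<omega>) \<le> 2 * ms f + 2 * ms g"
  using integral_norm_diff_sq_le[of M "\<lambda>\<omega>. f \<omega> + g \<omega>" g "\<lambda>_. 0"] assms sq_int_add[OF assms] by simp

lemma ms_add_increment:
  fixes f q :: "'a \<Rightarrow> 'b::euclidean_space"
  assumes st: "0 \<le> s" "s \<le> t" and f: "adapted_sq s f" and q: "adapted_sq s q"
  shows "ms (\<lambda>\<omega>. f \<omega> + (W t \<omega> - W s \<omega>) *\<^sub>R q \<omega>) = ms f + (t - s) * ms q"
proof -
  let ?g = "\<lambda>\<omega>. (W t \<omega> - W s \<omega>) *\<^sub>R q \<omega>"
  note sq = adapted_sqD(2)[OF f] adapted_sqD(2)[OF adapted_sq_increment[OF st q]]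
  have sq_sum: "(a + b) \<bullet> (a + b) = a \<bullet> a + 2 * (a \<bullet> b) + b \<bullet> b" for a b :: 'b
    by (simp add: inner_add_left inner_add_right inner_commute)
  have "ms (\<lambda>\<omega>. f \<omega> + ?g \<omega>) = expectation (\<lambda>\<omega>. f \<omega> \<bullet> f \<omega> + 2 * (f \<omega> \<bullet> ?g \<omega>) + ?g \<omega> \<bullet> ?g \<omega>)"
    unfolding power2_norm_eq_inner
    by (intro Bochner_Integration.integral_cong refl)
       (simp only: sq_sum)
  also have "\<dots> = expectation (\<lambda>\<omega>. f \<omega> \<bullet> f \<omega>) + 2 * expectation (\<lambda>\<omega>. f \<omega> \<bullet> ?g \<omega>) + expectation (\<lambda>\<omega>. ?g \<omega> \<bullet> ?g \<omega>)"
    using integrable_inner[OF sq(1,1)] integrable_inner[OF sq] integrable_inner[OF sq(2,2)] by simp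
  also have "\<dots> = ms f + (t - s) * ms q"
    unfolding increment_orthogonal[OF st q f] increment_variance[OF st q q] power2_norm_eq_inner by simp
  finally show ?thesis .
qed

text \<open>
  The cost of one step of the scheme, relative to the mean square of the point where the coefficients
  are evaluated.
\<close>
definition step_const :: "real^'n^'n \<Rightarrow> real^'n^'n \<Rightarrow> real" where
  "step_const B K = 2 * (onorm ((*v) B))\<^sup>2 + (onorm ((*v) K))\<^sup>2"

lemma step_const_nonneg: "0 \<le> step_const B K" by (simp add: step_const_def)

text \<open>
  A step from \<open>p\<close> with coefficients evaluated at \<open>q\<close>; for \<open>p = q\<close> it is a step of the scheme, and the difference
  of two schemes has this form with \<open>q \<noteq> p\<close>. The noise is orthogonal to the rest. In the square of
  \<open>p + (t - s) B q\<close> the mixed term is split evenly, which leaves a factor \<open>1 + (t - s)\<close> that stays bounded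
  when iterated.
\<close>
lemma euler_step:
  fixes B K :: "real^'n^'n"
  assumes st: "0 \<le> s" "s \<le> t" "t - s \<le> 1" and p: "adapted_sq s p" and q: "adapted_sq s q"
  shows "adapted_sq t (\<lambda>\<omega>. p \<omega> + (t - s) *\<^sub>R (B *v q \<omega>) + (W t \<omega> - W s \<omega>) *\<^sub>R (K *v q \<omega>))"
    "ms (\<lambda>\<omega>. p \<omega> + (t - s) *\<^sub>R (B *v q \<omega>) + (W t \<omega> - W s \<omega>) *\<^sub>R (K *v q \<omega>))
      \<le> (1 + (t - s)) * ms p + (t - s) * (step_const B K * ms q)"
proof -
  let ?f = "\<lambda>\<omega>. p \<omega> + (t - s) *\<^sub>R (B *v q \<omega>)"
  have f: "adapted_sq s ?f" by (intro adapted_sq_add adapted_sq_scaleR adapted_sq_matrix p q)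
  have Kq: "adapted_sq s (\<lambda>\<omega>. K *v q \<omega>)" by (rule adapted_sq_matrix[OF q])
  show "adapted_sq t (\<lambda>\<omega>. ?f \<omega> + (W t \<omega> - W s \<omega>) *\<^sub>R (K *v q \<omega>))"
    by (intro adapted_sq_add adapted_sq_increment adapted_sq_mono[OF st(1,2) f] st Kq)
  have sq: "sq_int M p" "sq_int M (\<lambda>\<omega>. B *v q \<omega>)" "sq_int M ?f"
    using adapted_sqD(2)[OF p] adapted_sqD(2)[OF adapted_sq_matrix[OF q, of B]] adapted_sqD(2)[OF f] .
  have "ms ?f \<le> expectation (\<lambda>\<omega>. (1 + (t - s)) * (norm (p \<omega>))\<^sup>2 + 2 * (t - s) * (norm (B *v q \<omega>))\<^sup>2)"
  proof (rule integral_mono)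
    fix \<omega>
    let ?a = "p \<omega>" and ?b = "B *v q \<omega>"
    define \<tau> where "\<tau> = t - s"
    have \<tau>: "0 \<le> \<tau>" "\<tau> \<le> 1" using st by (simp_all add: \<tau>_def)
    have "(norm (?a + \<tau> *\<^sub>R ?b))\<^sup>2 = (norm ?a)\<^sup>2 + 2 * \<tau> * (?a \<bullet> ?b) + \<tau>\<^sup>2 * (norm ?b)\<^sup>2"
      using norm_scaleR_add_scaleR_sq[of 1 ?a \<tau> ?b] by simp
    moreover have "\<tau> * (2 * (?a \<bullet> ?b)) \<le> \<tau> * ((norm ?a)\<^sup>2 + (norm ?b)\<^sup>2)"
    proof (rule mult_left_mono)
      have "?a \<bullet> ?b \<le> norm ?a * norm ?b" by (rule norm_cauchy_schwarz)
      then show "2 * (?a \<bullet> ?b) \<le> (norm ?a)\<^sup>2 + (norm ?b)\<^sup>2"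
        using sum_squares_bound[of "norm ?a" "norm ?b"] by linarith
    qed (rule \<tau>)
    moreover have "\<tau>\<^sup>2 * (norm ?b)\<^sup>2 \<le> \<tau> * (norm ?b)\<^sup>2"
    proof (rule mult_right_mono)
      show "\<tau>\<^sup>2 \<le> \<tau>" unfolding power2_eq_square using mult_left_mono[OF \<tau>(2,1)] by simp
    qed simp
    ultimately have "(norm (?a + \<tau> *\<^sub>R ?b))\<^sup>2 \<le> (1 + \<tau>) * (norm ?a)\<^sup>2 + 2 * \<tau> * (norm ?b)\<^sup>2"
      by (simp add: algebra_simps)
    then show "(norm (?a + (t - s) *\<^sub>R ?b))\<^sup>2 \<le> (1 + (t - s)) * (norm ?a)\<^sup>2 + 2 * (t - s) * (norm ?b)\<^sup>2"
      unfolding \<tau>_def .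
  qed (use sq_intD(2)[OF sq(1)] sq_intD(2)[OF sq(2)] sq_intD(2)[OF sq(3)] in simp_all)
  also have "\<dots> = (1 + (t - s)) * ms p + 2 * (t - s) * ms (\<lambda>\<omega>. B *v q \<omega>)"
    using sq_intD(2)[OF sq(1)] sq_intD(2)[OF sq(2)] by simp
  finally have 1: "ms ?f \<le> (1 + (t - s)) * ms p + 2 * (t - s) * ms (\<lambda>\<omega>. B *v q \<omega>)" .
  have 2: "(t - s) * ms (\<lambda>\<omega>. B *v q \<omega>) \<le> (t - s) * ((onorm ((*v) B))\<^sup>2 * ms q)"
    "(t - s) * ms (\<lambda>\<omega>. K *v q \<omega>) \<le> (t - s) * ((onorm ((*v) K))\<^sup>2 * ms q)"
    by (rule mult_left_mono[OF ms_matrix_le[OF adapted_sqD(2)[OF q]]], use st in simp)+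
  have "ms (\<lambda>\<omega>. ?f \<omega> + (W t \<omega> - W s \<omega>) *\<^sub>R (K *v q \<omega>)) = ms ?f + (t - s) * ms (\<lambda>\<omega>. K *v q \<omega>)"
    by (rule ms_add_increment[OF st(1,2) f Kq])
  also have "\<dots> \<le> (1 + (t - s)) * ms p + (t - s) * (step_const B K * ms q)"
    using 1 2 unfolding step_const_def by (simp add: algebra_simps)
  finally show "ms (\<lambda>\<omega>. ?f \<omega> + (W t \<omega> - W s \<omega>) *\<^sub>R (K *v q \<omega>))
      \<le> (1 + (t - s)) * ms p + (t - s) * (step_const B K * ms q)" .
qed

lemma simple_ito_Suc:
  "simple_ito W (Suc k) u \<xi> \<omega> = simple_ito W k u \<xi> \<omega> + (W (u (Suc k)) \<omega> - W (u k) \<omega>) *\<^sub>R \<xi> k \<omega>"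
  by (simp add: simple_ito_def)

lemma simple_ito_adapted:
  assumes "simple_sq T k u \<xi>" "j \<le> k"
  shows "adapted_sq (u j) (simple_ito W j u \<xi>)"
  using assms(2)
proof (induction j)
  case 0
  then show ?case by (simp add: simple_ito_def[abs_def] adapted_sq_zero)
next
  case (Suc j)
  note x = simple_sqD[OF assms(1), of j]
  show ?case
    unfolding simple_ito_Suc[abs_def]
    using Suc x by (intro adapted_sq_add adapted_sq_increment) (auto intro: adapted_sq_mono)
qed

lemma simple_ito_ms:
  assumes "simple_sq T k u \<xi>" "j \<le> k"
  shows "ms (simple_ito W j u \<xi>) = (\<Sum>i<j. (u (Suc i) - u i) * ms (\<xi> i))"
  using assms(2)
proof (induction j)
  case 0
  then show ?case by (simp add: simple_ito_def)
next
  case (Suc j)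
  note x = simple_sqD[OF assms(1), of j]
  have "ms (simple_ito W (Suc j) u \<xi>) = ms (simple_ito W j u \<xi>) + (u (Suc j) - u j) * ms (\<xi> j)"
    unfolding simple_ito_Suc
    using Suc x simple_ito_adapted[OF assms(1), of j] by (intro ms_add_increment) auto
  then show ?case using Suc by simp
qed

lemma markov_sq:
  assumes "E \<in> events" "sq_int M f" "0 < \<epsilon>" "\<And>\<omega>. \<omega> \<in> E \<Longrightarrow> \<epsilon> \<le> norm (f \<omega>)"
  shows "prob E \<le> ms f / \<epsilon>\<^sup>2"
proof -
  have "\<epsilon>\<^sup>2 * prob E = expectation (\<lambda>\<omega>. \<epsilon>\<^sup>2 * indicator E \<omega>)" using assms(1) by simp
  also have "\<dots> \<le> ms f"
  proof (rule integral_mono)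
    show "integrable M (\<lambda>\<omega>. \<epsilon>\<^sup>2 * indicator E \<omega>)" using assms(1) by (simp add: integrable_real_indicator less_top[symmetric])
    show "integrable M (\<lambda>\<omega>. (norm (f \<omega>))\<^sup>2)" by (rule sq_intD(2)[OF assms(2)])
    show "\<epsilon>\<^sup>2 * indicator E \<omega> \<le> (norm (f \<omega>))\<^sup>2" for \<omega>
      using assms(3,4) by (cases "\<omega> \<in> E") (auto intro: power_mono)
  qed
  finally show ?thesis using assms(3) by (simp add: field_simps)
qed

text \<open>
  Kolmogorov's inequality. The integrand is switched off once some partial integral has norm at least
  \<open>\<epsilon>\<close>. From then on the integral keeps its value, so on the event in question the switched integral has
  norm at least \<open>\<epsilon>\<close> at the end, and its mean square is at most that of the original one.
\<close>
lemma maximal_inequality: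
  fixes \<xi> :: "nat \<Rightarrow> 'a \<Rightarrow> 'b::euclidean_space"
  assumes \<xi>: "simple_sq T k u \<xi>" and \<epsilon>: "0 < \<epsilon>"
  shows "{\<omega> \<in> space M. \<exists>j\<le>k. \<epsilon> \<le> norm (simple_ito W j u \<xi> \<omega>)} \<in> events"
    "prob {\<omega> \<in> space M. \<exists>j\<le>k. \<epsilon> \<le> norm (simple_ito W j u \<xi> \<omega>)} \<le> (\<Sum>i<k. (u (Suc i) - u i) * ms (\<xi> i)) / \<epsilon>\<^sup>2"
proof -
  let ?N = "\<lambda>j. simple_ito W j u \<xi>"
  define \<zeta> where "\<zeta> i \<omega> = (if \<forall>l\<le>i. norm (?N l \<omega>) < \<epsilon> then \<xi> i \<omega> else 0)" for i \<omega>
  have meas: "?N l \<in> borel_measurable (F (u i))" if "l \<le> i" "i \<le> k" for l i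
  proof (rule measurable_F_mono[OF _ _ adapted_sqD(1)[OF simple_ito_adapted[OF \<xi>, of l]]])
    show "0 \<le> u l" "u l \<le> u i"
      using \<xi> mono_partition[of k u 0 l] mono_partition[of k u l i] that unfolding simple_sq_def by auto
    show "l \<le> k" using that by simp
  qed
  have \<zeta>: "adapted_sq (u i) (\<zeta> i)" if i: "i < k" for i
  proof -
    have u: "0 \<le> u i" using simple_sqD(1)[OF \<xi> i] .
    have \<xi>i: "adapted_sq (u i) (\<xi> i)" using simple_sqD(4)[OF \<xi> i] .
    have [measurable]: "\<xi> i \<in> borel_measurable (F (u i))" using adapted_sqD(1)[OF \<xi>i] .
    have [measurable]: "Measurable.pred (F (u i)) (\<lambda>\<omega>. \<forall>l\<in>{..i}. norm (?N l \<omega>) < \<epsilon>)"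
    proof (rule pred_intros_finite)
      fix l assume "l \<in> {..i}"
      then have [measurable]: "?N l \<in> borel_measurable (F (u i))" using meas[of l i] i by simp
      show "Measurable.pred (F (u i)) (\<lambda>\<omega>. norm (?N l \<omega>) < \<epsilon>)" by measurable
    qed simp
    have "(\<lambda>\<omega>. if \<forall>l\<in>{..i}. norm (?N l \<omega>) < \<epsilon> then \<xi> i \<omega> else 0) \<in> borel_measurable (F (u i))" by measurable
    moreover have "\<zeta> i = (\<lambda>\<omega>. if \<forall>l\<in>{..i}. norm (?N l \<omega>) < \<epsilon> then \<xi> i \<omega> else 0)"
      unfolding \<zeta>_def[abs_def] by (rule ext) (metis atMost_iff)
    ultimately have m: "\<zeta> i \<in> borel_measurable (F (u i))" by (simp only:)
    have "sq_int M (\<zeta> i)"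
      by (rule sq_int_dominated[OF measurable_F[OF u m] sq_intD(2)[OF adapted_sqD(2)[OF \<xi>i]]]) (simp add: \<zeta>_def)
    with m show ?thesis unfolding adapted_sq_def by blast
  qed
  have \<zeta>s: "simple_sq T k u \<zeta>" using \<xi> \<zeta> unfolding simple_sq_def by auto
  let ?E = "{\<omega> \<in> space M. \<exists>j\<le>k. \<epsilon> \<le> norm (?N j \<omega>)}"
  show E: "?E \<in> events"
  proof -
    have "?E = (\<Union>j\<in>{..k}. {\<omega> \<in> space M. \<epsilon> \<le> norm (?N j \<omega>)})" by auto
    moreover have "{\<omega> \<in> space M. \<epsilon> \<le> norm (?N j \<omega>)} \<in> events" if "j \<le> k" for j
    proof -
      have [measurable]: "?N j \<in> borel_measurable M"
        using sq_intD(1)[OF adapted_sqD(2)[OF simple_ito_adapted[OF \<xi> that]]] .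
      show ?thesis by measurable
    qed
    ultimately show ?thesis by auto
  qed
  have hit: "((\<exists>l\<le>j. \<epsilon> \<le> norm (?N l \<omega>)) \<longrightarrow> \<epsilon> \<le> norm (simple_ito W j u \<zeta> \<omega>)) \<and>
      ((\<forall>l\<le>j. norm (?N l \<omega>) < \<epsilon>) \<longrightarrow> simple_ito W j u \<zeta> \<omega> = ?N j \<omega>)" for j \<omega>
  proof (induction j)
    case 0
    then show ?case by (simp add: simple_ito_def)
  next
    case (Suc j)
    show ?case
    proof (cases "\<forall>l\<le>j. norm (?N l \<omega>) < \<epsilon>")
      case True
      then have "\<zeta> j \<omega> = \<xi> j \<omega>" by (simp add: \<zeta>_def)
      moreover have "simple_ito W j u \<zeta> \<omega> = ?N j \<omega>" using Suc True by blast
      ultimately have "simple_ito W (Suc j) u \<zeta> \<omega> = ?N (Suc j) \<omega>" by (simp add: simple_ito_Suc)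
      moreover have "l = Suc j" if "l \<le> Suc j" "\<epsilon> \<le> norm (?N l \<omega>)" for l
        using True that by (metis le_Suc_eq not_less)
      ultimately show ?thesis by auto
    next
      case False
      then have "\<zeta> j \<omega> = 0" unfolding \<zeta>_def by (rule if_not_P)
      then have "simple_ito W (Suc j) u \<zeta> \<omega> = simple_ito W j u \<zeta> \<omega>" by (simp add: simple_ito_Suc)
      moreover have "\<epsilon> \<le> norm (simple_ito W j u \<zeta> \<omega>)"
        using Suc False by (metis not_less)
      moreover have "\<not> (\<forall>l\<le>Suc j. norm (?N l \<omega>) < \<epsilon>)" using False le_SucI by blast
      ultimately show ?thesis by auto
    qed
  qed
  have "prob ?E \<le> ms (simple_ito W k u \<zeta>) / \<epsilon>\<^sup>2"
    by (rule markov_sq[OF E simple_ito_sq_int[OF \<zeta>s] \<epsilon>]) (use hit in auto)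
  also have "\<dots> \<le> (\<Sum>i<k. (u (Suc i) - u i) * ms (\<xi> i)) / \<epsilon>\<^sup>2"
  proof (rule divide_right_mono)
    show "ms (simple_ito W k u \<zeta>) \<le> (\<Sum>i<k. (u (Suc i) - u i) * ms (\<xi> i))"
      unfolding simple_ito_ms[OF \<zeta>s order_refl]
    proof (intro sum_mono mult_left_mono)
      fix i assume "i \<in> {..<k}"
      then have i: "i < k" by simp
      show "0 \<le> u (Suc i) - u i" using simple_sqD(2)[OF \<xi> i] by simp
      have "ms (\<zeta> i) \<le> 1 * ms (\<xi> i)"
        by (rule ms_mono[OF adapted_sqD(2)[OF \<zeta>[OF i]] adapted_sqD(2)[OF simple_sqD(4)[OF \<xi> i]]]) (simp add: \<zeta>_def)
      then show "ms (\<zeta> i) \<le> ms (\<xi> i)" by simp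
    qed
  qed simp
  finally show "prob ?E \<le> (\<Sum>i<k. (u (Suc i) - u i) * ms (\<xi> i)) / \<epsilon>\<^sup>2" .
qed

lemma Fatou_sq:
  fixes f :: "'a \<Rightarrow> 'b::euclidean_space"
  assumes g: "\<And>m. n \<le> m \<Longrightarrow> sq_int M (g m)" "\<And>m. n \<le> m \<Longrightarrow> ms (g m) \<le> c" and f: "f \<in> borel_measurable M"
    and lim: "AE \<omega> in M. (\<lambda>m. g m \<omega>) \<longlonglongrightarrow> f \<omega>"
  shows "sq_int M f" "ms f \<le> c"
proof -
  let ?h = "\<lambda>m \<omega>. ennreal ((norm (g (m + n) \<omega>))\<^sup>2)"
  have m: "?h m \<in> borel_measurable M" for m
    using sq_intD(1)[OF g(1)[of "m + n"]] by measurable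
  have "(\<integral>\<^sup>+\<omega>. ennreal ((norm (f \<omega>))\<^sup>2) \<partial>M) = (\<integral>\<^sup>+\<omega>. liminf (\<lambda>m. ?h m \<omega>) \<partial>M)"
  proof (rule nn_integral_cong_AE)
    show "AE \<omega> in M. ennreal ((norm (f \<omega>))\<^sup>2) = liminf (\<lambda>m. ?h m \<omega>)"
      using lim
    proof eventually_elim
      fix \<omega> assume "(\<lambda>m. g m \<omega>) \<longlonglongrightarrow> f \<omega>"
      then have "(\<lambda>m. g (m + n) \<omega>) \<longlonglongrightarrow> f \<omega>" by (rule LIMSEQ_ignore_initial_segment)
      then have "(\<lambda>m. ?h m \<omega>) \<longlonglongrightarrow> ennreal ((norm (f \<omega>))\<^sup>2)" by (intro tendsto_intros)
      then show "ennreal ((norm (f \<omega>))\<^sup>2) = liminf (\<lambda>m. ?h m \<omega>)" by (rule lim_imp_Liminf[symmetric, rotated]) simp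
    qed
  qed
  also have "\<dots> \<le> liminf (\<lambda>m. \<integral>\<^sup>+\<omega>. ?h m \<omega> \<partial>M)" by (rule nn_integral_liminf[OF m])
  also have "\<dots> \<le> limsup (\<lambda>m. \<integral>\<^sup>+\<omega>. ?h m \<omega> \<partial>M)" by (rule Liminf_le_Limsup) simp
  also have "\<dots> \<le> ennreal c"
    by (rule Limsup_bounded) (simp add: sq_int_nn_integral[OF g(1)] ennreal_leI g(2))
  finally have le: "(\<integral>\<^sup>+\<omega>. ennreal ((norm (f \<omega>))\<^sup>2) \<partial>M) \<le> ennreal c" .
  then show f2: "sq_int M f" unfolding sq_int_iff_nn_integral[OF f] by (rule le_less_trans) simp
  have "0 \<le> c" using g(2)[of n] order_trans[of 0 "ms (g n)" c] by simp
  then show "ms f \<le> c" using le unfolding sq_int_nn_integral[OF f2] by simp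
qed

end

section \<open>The Euler scheme\<close>

definition grid :: "nat \<Rightarrow> nat \<Rightarrow> real" where "grid n k = real k / 2 ^ n"

definition cell :: "nat \<Rightarrow> real \<Rightarrow> nat" where "cell n t = nat \<lfloor>t * 2 ^ n\<rfloor>"

lemma grid_0 [simp]: "grid n 0 = 0" by (simp add: grid_def)

lemma grid_nonneg [simp]: "0 \<le> grid n k" by (simp add: grid_def)

lemma grid_Suc: "grid n (Suc k) = grid n k + 1 / 2 ^ n" by (simp add: grid_def add_divide_distrib)

lemma grid_mono: "j \<le> k \<Longrightarrow> grid n j \<le> grid n k" by (simp add: grid_def divide_right_mono)

lemma cell_bounds:
  assumes "0 \<le> t" shows "grid n (cell n t) \<le> t" "t < grid n (Suc (cell n t))"
proof -
  have "real (cell n t) = of_int \<lfloor>t * 2 ^ n\<rfloor>" using assms by (simp add: cell_def)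
  then have "real (cell n t) \<le> t * 2 ^ n" "t * 2 ^ n < real (cell n t) + 1" by linarith+
  then show "grid n (cell n t) \<le> t" "t < grid n (Suc (cell n t))" by (simp_all add: grid_def field_simps)
qed

lemma cell_eqI:
  assumes "grid n k \<le> t" "t < grid n (Suc k)" shows "cell n t = k"
proof -
  have "real k \<le> t * 2 ^ n" "t * 2 ^ n < real k + 1" using assms by (simp_all add: grid_def field_simps)
  then have "\<lfloor>t * 2 ^ n\<rfloor> = int k" by (simp add: floor_eq_iff)
  then show ?thesis by (simp add: cell_def)
qed

lemma cell_grid [simp]: "cell n (grid n k) = k"
  by (rule cell_eqI) (simp_all add: grid_Suc)

lemma grid_refine: "n \<le> m \<Longrightarrow> grid n k = grid m (k * 2 ^ (m - n))"
proof -
  assume "n \<le> m"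
  then have "(2::real) ^ m = 2 ^ n * 2 ^ (m - n)" by (simp add: power_add[symmetric])
  then show ?thesis by (simp add: grid_def)
qed

text \<open>
  A cell of a fine dyadic grid lies inside one cell of every coarser grid.
\<close>
lemma grid_cell_refine:
  assumes "n \<le> m"
  shows "grid n (cell n (grid m j)) \<le> grid m j" "grid m (Suc j) \<le> grid n (Suc (cell n (grid m j)))"
proof -
  let ?k = "cell n (grid m j)"
  have b: "grid n ?k \<le> grid m j" "grid m j < grid n (Suc ?k)" using cell_bounds[of "grid m j" n] by auto
  show "grid n ?k \<le> grid m j" by (rule b)
  have "j < Suc ?k * 2 ^ (m - n)"
    using b(2) unfolding grid_refine[OF assms, of "Suc ?k"] unfolding grid_def
    by (simp only: divide_less_cancel of_nat_less_iff) simp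
  then have "Suc j \<le> Suc ?k * 2 ^ (m - n)" by simp
  then show "grid m (Suc j) \<le> grid n (Suc ?k)"
    unfolding grid_refine[OF assms, of "Suc ?k"] by (rule grid_mono)
qed

lemma cell_refine:
  assumes "n \<le> m" "0 \<le> t" shows "cell n (grid m (cell m t)) = cell n t"
proof (rule sym, rule cell_eqI)
  note b = grid_cell_refine[OF assms(1), of "cell m t"] and c = cell_bounds[OF assms(2), of m]
  show "grid n (cell n (grid m (cell m t))) \<le> t" using b c by linarith
  show "t < grid n (Suc (cell n (grid m (cell m t))))" using b c by linarith
qed

locale linear_sde = brownian M F W for M :: "'a measure" and F and W +
  fixes B K :: "real^'n^'n" and x :: "real^'n"
begin

primrec euler :: "nat \<Rightarrow> nat \<Rightarrow> 'a \<Rightarrow> real^'n" where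
  "euler n 0 = (\<lambda>\<omega>. x)"
| "euler n (Suc k) = (\<lambda>\<omega>. euler n k \<omega> + (grid n (Suc k) - grid n k) *\<^sub>R (B *v euler n k \<omega>)
     + (W (grid n (Suc k)) \<omega> - W (grid n k) \<omega>) *\<^sub>R (K *v euler n k \<omega>))"

text \<open>
  The integrand of the scheme: it is constant on each cell and takes the value at the left end.
\<close>
definition frozen_path :: "nat \<Rightarrow> real \<Rightarrow> 'a \<Rightarrow> real^'n" where
  "frozen_path n t \<omega> = euler n (cell n t) \<omega>"

text \<open>
  The scheme with the step of the current cell carried out up to time \<open>t\<close> only; it has continuous paths
  whenever \<open>W\<close> has.
\<close>
definition euler_path :: "nat \<Rightarrow> real \<Rightarrow> 'a \<Rightarrow> real^'n" where
  "euler_path n t \<omega> = frozen_path n t \<omega> + (t - grid n (cell n t)) *\<^sub>R (B *v frozen_path n t \<omega>)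
     + (W t \<omega> - W (grid n (cell n t)) \<omega>) *\<^sub>R (K *v frozen_path n t \<omega>)"

lemma path_cell:
  assumes "grid n k \<le> t" "t \<le> grid n (Suc k)"
  shows "euler_path n t \<omega> = euler n k \<omega> + (t - grid n k) *\<^sub>R (B *v euler n k \<omega>) + (W t \<omega> - W (grid n k) \<omega>) *\<^sub>R (K *v euler n k \<omega>)"
proof (cases "t = grid n (Suc k)")
  case True
  then show ?thesis by (simp add: euler_path_def frozen_path_def)
next
  case False
  then have "cell n t = k" using assms by (intro cell_eqI) auto
  then show ?thesis by (simp add: euler_path_def frozen_path_def)
qed

lemma path_step:
  assumes "grid n k \<le> s" "s \<le> t" "t \<le> grid n (Suc k)"
  shows "euler_path n t \<omega> = euler_path n s \<omega> + (t - s) *\<^sub>R (B *v euler n k \<omega>) + (W t \<omega> - W s \<omega>) *\<^sub>R (K *v euler n k \<omega>)"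
proof -
  have ps: "euler_path n s \<omega> = euler n k \<omega> + (s - grid n k) *\<^sub>R (B *v euler n k \<omega>) + (W s \<omega> - W (grid n k) \<omega>) *\<^sub>R (K *v euler n k \<omega>)"
    by (rule path_cell) (use assms in auto)
  have pt: "euler_path n t \<omega> = euler n k \<omega> + (t - grid n k) *\<^sub>R (B *v euler n k \<omega>) + (W t \<omega> - W (grid n k) \<omega>) *\<^sub>R (K *v euler n k \<omega>)"
    by (rule path_cell) (use assms in auto)
  show ?thesis unfolding ps pt by (simp add: algebra_simps)
qed

lemma path_grid: "euler_path n (grid n k) \<omega> = euler n k \<omega>"
  by (simp add: euler_path_def frozen_path_def)

abbreviation "cst \<equiv> step_const B K"

lemma grid_step_le_1: "grid n (Suc k) - grid n k \<le> 1"
  by (simp add: grid_Suc)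

lemma euler_adapted: "adapted_sq (grid n k) (euler n k)"
proof (induction k)
  case 0
  then show ?case by (simp add: adapted_sq_const)
next
  case (Suc k)
  from euler_step(1)[OF _ _ grid_step_le_1 Suc Suc] grid_mono[of k "Suc k" n] show ?case by simp
qed

lemma one_plus_pow_le:
  assumes "0 \<le> a" shows "(1 + a * (1 / 2 ^ n)) ^ k \<le> exp (a * grid n k)"
proof -
  have "(1 + a * (1 / 2 ^ n)) ^ k \<le> (exp (a * (1 / 2 ^ n))) ^ k"
    by (rule power_mono) (use assms exp_ge_add_one_self[of "a * (1 / 2 ^ n)"] in auto)
  also have "\<dots> = exp (a * grid n k)" by (simp add: exp_of_nat_mult[symmetric] grid_def ac_simps)
  finally show ?thesis .
qed

lemma euler_ms: "ms (euler n k) \<le> exp ((1 + cst) * grid n k) * (norm x)\<^sup>2"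
proof -
  have "ms (euler n k) \<le> (1 + (1 + cst) * (1 / 2 ^ n)) ^ k * (norm x)\<^sup>2"
  proof (induction k)
    case 0
    then show ?case by (simp add: prob_space)
  next
    case (Suc k)
    have "ms (euler n (Suc k)) \<le> (1 + 1 / 2 ^ n) * ms (euler n k) + 1 / 2 ^ n * (cst * ms (euler n k))"
      using euler_step(2)[OF _ _ grid_step_le_1 euler_adapted[of n k] euler_adapted[of n k], of B K] grid_mono[of k "Suc k" n]
      by (simp add: grid_Suc)
    also have "\<dots> = (1 + (1 + cst) * (1 / 2 ^ n)) * ms (euler n k)" by (simp add: algebra_simps add_divide_distrib)
    also have "\<dots> \<le> (1 + (1 + cst) * (1 / 2 ^ n)) * ((1 + (1 + cst) * (1 / 2 ^ n)) ^ k * (norm x)\<^sup>2)"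
      by (intro mult_left_mono Suc) (simp add: step_const_nonneg)
    finally show ?case by (simp add: mult.assoc)
  qed
  also have "\<dots> \<le> exp ((1 + cst) * grid n k) * (norm x)\<^sup>2"
    using step_const_nonneg[of B K] by (intro mult_right_mono one_plus_pow_le) auto
  finally show ?thesis .
qed

text \<open>
  The constants \<open>c0\<close>, \<open>c1\<close>, \<open>c2\<close> and \<open>c3\<close> bound, for times up to \<open>T\<close>, the mean squares of the scheme, of its
  error on grid points, of the error of its integrand, and the probability of a large gap between
  consecutive levels. They are written out since the estimates must be uniform in the levels.
\<close>
definition c0 :: "real \<Rightarrow> real" where "c0 T = exp ((1 + cst) * T) * (norm x)\<^sup>2"

lemma c0_nonneg: "0 \<le> c0 T" by (simp add: c0_def)

lemma frozen_path_adapted: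
  assumes "0 \<le> t" shows "adapted_sq t (frozen_path n t)"
  unfolding frozen_path_def[abs_def]
  by (rule adapted_sq_mono[OF grid_nonneg cell_bounds(1)[OF assms] euler_adapted])

lemma frozen_path_ms:
  assumes "0 \<le> t" "t \<le> T" shows "ms (frozen_path n t) \<le> c0 T"
proof -
  have "ms (frozen_path n t) \<le> exp ((1 + cst) * grid n (cell n t)) * (norm x)\<^sup>2"
    unfolding frozen_path_def by (rule euler_ms)
  also have "\<dots> \<le> c0 T"
  proof -
    have "(1 + cst) * grid n (cell n t) \<le> (1 + cst) * T"
      using cell_bounds(1)[OF assms(1), of n] assms(2) step_const_nonneg[of B K] by (intro mult_left_mono) auto
    then show ?thesis unfolding c0_def by (intro mult_right_mono) auto
  qed
  finally show ?thesis .
qed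

lemma path_adapted:
  assumes "0 \<le> t" shows "adapted_sq t (euler_path n t)"
proof -
  have "t - grid n (cell n t) \<le> 1" using cell_bounds[OF assms, of n] grid_step_le_1[of n "cell n t"] by linarith
  from euler_step(1)[OF grid_nonneg cell_bounds(1)[OF assms] this euler_adapted euler_adapted]
  show ?thesis unfolding euler_path_def[abs_def] frozen_path_def by simp
qed

lemma path_minus_frozen:
  assumes "0 \<le> t" "t \<le> T" shows "ms (\<lambda>\<omega>. euler_path n t \<omega> - frozen_path n t \<omega>) \<le> cst * c0 T / 2 ^ n"
proof -
  let ?s = "grid n (cell n t)"
  have le: "t - ?s \<le> 1 / 2 ^ n" using cell_bounds[OF assms(1), of n] by (simp add: grid_Suc)
  also have "\<dots> \<le> 1" by simp
  finally have le1: "t - ?s \<le> 1" .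
  have "ms (\<lambda>\<omega>. 0 + (t - ?s) *\<^sub>R (B *v frozen_path n t \<omega>) + (W t \<omega> - W ?s \<omega>) *\<^sub>R (K *v frozen_path n t \<omega>))
    \<le> (1 + (t - ?s)) * ms (\<lambda>\<omega>. 0 :: real^'n) + (t - ?s) * (cst * ms (frozen_path n t))"
    unfolding frozen_path_def
    by (rule euler_step(2)[OF grid_nonneg cell_bounds(1)[OF assms(1)] le1 adapted_sq_zero euler_adapted])
  then have "ms (\<lambda>\<omega>. euler_path n t \<omega> - frozen_path n t \<omega>) \<le> (t - ?s) * (cst * ms (frozen_path n t))"
    by (simp add: euler_path_def)
  also have "\<dots> \<le> 1 / 2 ^ n * (cst * c0 T)"
    using le frozen_path_ms[OF assms] step_const_nonneg[of B K]
    by (intro mult_mono) (auto intro!: mult_left_mono)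
  finally show ?thesis by simp
qed

definition ca :: real where "ca = 1 + 2 * cst"
definition cb :: "real \<Rightarrow> real" where "cb T = 2 * cst * (cst * c0 T)"
definition c1 :: "real \<Rightarrow> real" where "c1 T = cb T / ca * exp (ca * T)"

lemma ca_pos: "0 < ca" using step_const_nonneg[of B K] by (simp add: ca_def add_pos_nonneg)
lemma cb_nonneg: "0 \<le> cb T" using step_const_nonneg[of B K] c0_nonneg by (simp add: cb_def)
lemma c1_nonneg: "0 \<le> c1 T" using ca_pos cb_nonneg by (simp add: c1_def)

text \<open>
  On grid \<open>m\<close> the difference of the two levels performs steps whose coefficients are evaluated at the
  difference plus the oscillation of level \<open>n\<close> inside its cell, which is of order \<open>1 / 2 ^ n\<close>. So each step
  multiplies the mean square by at most \<open>1 + ca h\<close> and adds at most \<open>h cb / 2 ^ n\<close>.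
\<close>
lemma euler_error:
  assumes nm: "n \<le> m" and T: "grid m j \<le> T"
  shows "ms (\<lambda>\<omega>. euler m j \<omega> - euler_path n (grid m j) \<omega>) \<le> c1 T / 2 ^ n"
proof -
  define h where "h = 1 / (2::real) ^ m"
  have h: "0 < h" "h \<le> 1" by (simp_all add: h_def)
  have "ms (\<lambda>\<omega>. euler m j \<omega> - euler_path n (grid m j) \<omega>) \<le> cb T / ca * ((1 + ca * h) ^ j - 1) / 2 ^ n"
    using T
  proof (induction j)
    case 0
    have "euler_path n 0 \<omega> = x" for \<omega> using path_grid[of n 0 \<omega>] by simp
    then show ?case by simp
  next
    case (Suc j)
    have jT: "grid m j \<le> T" using Suc.prems grid_mono[of j "Suc j" m] by simp
    let ?e = "\<lambda>\<omega>. euler m j \<omega> - euler_path n (grid m j) \<omega>"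
    let ?d = "\<lambda>\<omega>. euler m j \<omega> - frozen_path n (grid m j) \<omega>"
    have e: "adapted_sq (grid m j) ?e" by (intro adapted_sq_diff euler_adapted path_adapted) simp
    have d: "adapted_sq (grid m j) ?d" by (intro adapted_sq_diff euler_adapted frozen_path_adapted) simp
    have pf: "adapted_sq (grid m j) (\<lambda>\<omega>. euler_path n (grid m j) \<omega> - frozen_path n (grid m j) \<omega>)"
      by (intro adapted_sq_diff path_adapted frozen_path_adapted) simp_all
    have eq: "euler m (Suc j) \<omega> - euler_path n (grid m (Suc j)) \<omega> =
      ?e \<omega> + (grid m (Suc j) - grid m j) *\<^sub>R (B *v ?d \<omega>) + (W (grid m (Suc j)) \<omega> - W (grid m j) \<omega>) *\<^sub>R (K *v ?d \<omega>)" for \<omega>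
    proof -
      have "euler_path n (grid m (Suc j)) \<omega> = euler_path n (grid m j) \<omega> + (grid m (Suc j) - grid m j) *\<^sub>R (B *v frozen_path n (grid m j) \<omega>)
        + (W (grid m (Suc j)) \<omega> - W (grid m j) \<omega>) *\<^sub>R (K *v frozen_path n (grid m j) \<omega>)"
        unfolding frozen_path_def
        by (rule path_step[OF grid_cell_refine(1)[OF nm] grid_mono grid_cell_refine(2)[OF nm]]) simp
      then show ?thesis by (simp add: matrix_vector_mult_diff_distrib scaleR_diff_right)
    qed
    have dle: "ms ?d \<le> 2 * ms ?e + 2 * (cst * c0 T / 2 ^ n)"
    proof -
      have "ms ?d = ms (\<lambda>\<omega>. ?e \<omega> + (euler_path n (grid m j) \<omega> - frozen_path n (grid m j) \<omega>))" by simp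
      also have "\<dots> \<le> 2 * ms ?e + 2 * ms (\<lambda>\<omega>. euler_path n (grid m j) \<omega> - frozen_path n (grid m j) \<omega>)"
        by (rule ms_add_le[OF adapted_sqD(2)[OF e] adapted_sqD(2)[OF pf]])
      also have "\<dots> \<le> 2 * ms ?e + 2 * (cst * c0 T / 2 ^ n)"
        using path_minus_frozen[OF grid_nonneg jT] by (intro add_left_mono mult_left_mono) auto
      finally show ?thesis .
    qed
    have "ms (\<lambda>\<omega>. euler m (Suc j) \<omega> - euler_path n (grid m (Suc j)) \<omega>) \<le> (1 + h) * ms ?e + h * (cst * ms ?d)"
      unfolding eq using euler_step(2)[OF grid_nonneg grid_mono grid_step_le_1 e d, of B K] by (simp add: grid_Suc h_def)
    also have "\<dots> \<le> (1 + h) * ms ?e + h * (cst * (2 * ms ?e + 2 * (cst * c0 T / 2 ^ n)))"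
      using dle h step_const_nonneg[of B K] by (intro add_left_mono mult_left_mono) auto
    also have "\<dots> = (1 + ca * h) * ms ?e + h * cb T / 2 ^ n"
      by (simp add: ca_def cb_def algebra_simps)
    also have "\<dots> \<le> (1 + ca * h) * (cb T / ca * ((1 + ca * h) ^ j - 1) / 2 ^ n) + h * cb T / 2 ^ n"
      using Suc.IH[OF jT] h ca_pos by (intro add_right_mono mult_left_mono) auto
    also have "\<dots> = cb T / ca * ((1 + ca * h) ^ Suc j - 1) / 2 ^ n"
      using ca_pos by (simp add: field_simps)
    finally show ?case .
  qed
  also have "\<dots> \<le> c1 T / 2 ^ n"
  proof -
    have "(1 + ca * h) ^ j - 1 \<le> exp (ca * grid m j)"
      using one_plus_pow_le[of ca m j] ca_pos by (simp add: h_def)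
    also have "\<dots> \<le> exp (ca * T)" using T ca_pos by simp
    finally show ?thesis unfolding c1_def
      using ca_pos cb_nonneg by (intro divide_right_mono mult_left_mono) auto
  qed
  finally show ?thesis .
qed

definition c2 :: "real \<Rightarrow> real" where "c2 T = 2 * c1 T + 2 * (cst * c0 T)"

lemma c2_nonneg: "0 \<le> c2 T" using c1_nonneg c0_nonneg step_const_nonneg[of B K] by (simp add: c2_def)

lemma frozen_path_error:
  assumes nm: "n \<le> m" and t: "0 \<le> t" "t \<le> T"
  shows "ms (\<lambda>\<omega>. frozen_path m t \<omega> - frozen_path n t \<omega>) \<le> c2 T / 2 ^ n"
proof -
  let ?s = "grid m (cell m t)"
  have sT: "?s \<le> T" using cell_bounds(1)[OF t(1), of m] t(2) by linarith
  have eq: "frozen_path m t \<omega> - frozen_path n t \<omega> =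
      (euler m (cell m t) \<omega> - euler_path n ?s \<omega>) + (euler_path n ?s \<omega> - frozen_path n ?s \<omega>)" for \<omega>
    unfolding frozen_path_def cell_refine[OF nm t(1)] by simp
  have "ms (\<lambda>\<omega>. frozen_path m t \<omega> - frozen_path n t \<omega>) \<le> 2 * ms (\<lambda>\<omega>. euler m (cell m t) \<omega> - euler_path n ?s \<omega>)
      + 2 * ms (\<lambda>\<omega>. euler_path n ?s \<omega> - frozen_path n ?s \<omega>)"
    unfolding eq
    by (intro ms_add_le sq_int_diff adapted_sqD(2)[OF euler_adapted] adapted_sqD(2)[OF path_adapted] adapted_sqD(2)[OF frozen_path_adapted] grid_nonneg)
  also have "\<dots> \<le> 2 * (c1 T / 2 ^ n) + 2 * (cst * c0 T / 2 ^ n)"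
    using euler_error[OF nm sT] path_minus_frozen[OF grid_nonneg sT, of n] by linarith
  finally show ?thesis by (simp add: c2_def add_divide_distrib)
qed

end

section \<open>Almost sure convergence of the scheme\<close>

lemma continuous_on_half_line:
  fixes f :: "real \<Rightarrow> 'b::topological_space"
  assumes "\<And>n::nat. continuous_on {0..real n} f" shows "continuous_on {0..} f"
  unfolding continuous_on_eq_continuous_within
proof
  fix t :: real assume t: "t \<in> {0..}"
  obtain n :: nat where n: "t < real n" using reals_Archimedean2 by blast
  have "at t within {0..} = at t within {0..real n}"
    by (rule at_within_nhd[of t "{..<real n}"]) (use n in auto)
  moreover have "continuous (at t within {0..real n}) f"
    using assms[of n] t n unfolding continuous_on_eq_continuous_within by auto
  ultimately show "continuous (at t within {0..}) f" by (simp add: continuous_within)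
qed

lemma grid_cell_tendsto:
  assumes "0 \<le> t" shows "(\<lambda>m. grid m (cell m t)) \<longlonglongrightarrow> t"
proof -
  have b: "t - (1 / 2) ^ m \<le> grid m (cell m t)" "grid m (cell m t) \<le> t" for m
    using cell_bounds[OF assms, of m] by (simp_all add: grid_Suc power_divide)
  have "(\<lambda>m. t - (1 / 2) ^ m) \<longlonglongrightarrow> t - 0" by (intro tendsto_intros LIMSEQ_realpow_zero) auto
  then have 1: "(\<lambda>m. t - (1 / 2) ^ m) \<longlonglongrightarrow> t" by simp
  show ?thesis
    by (rule tendsto_sandwich[OF _ _ 1 tendsto_const]) (use b in auto)
qed

context linear_sde
begin

definition c3 :: "nat \<Rightarrow> real" where
  "c3 T = (real T * (onorm ((*v) K))\<^sup>2 + (real T)\<^sup>2 * (onorm ((*v) B))\<^sup>2) * c2 (real T)"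

definition gap_event :: "nat \<Rightarrow> nat \<Rightarrow> nat \<Rightarrow> real \<Rightarrow> 'a set" where
  "gap_event T n m \<epsilon> = {\<omega> \<in> space M. \<exists>j\<le>T * 2 ^ m. 2 * \<epsilon> \<le> norm (euler_path (Suc n) (grid m j) \<omega> - euler_path n (grid m j) \<omega>)}"

lemma path_measurable [measurable]: "0 \<le> t \<Longrightarrow> euler_path n t \<in> borel_measurable M"
  using sq_intD(1)[OF adapted_sqD(2)[OF path_adapted]] .

lemma gap_event_sets: "gap_event T n m \<epsilon> \<in> events"
proof -
  have "gap_event T n m \<epsilon> = (\<Union>j\<in>{..T * 2 ^ m}. {\<omega> \<in> space M. 2 * \<epsilon> \<le> norm (euler_path (Suc n) (grid m j) \<omega> - euler_path n (grid m j) \<omega>)})"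
    by (auto simp: gap_event_def)
  moreover have "{\<omega> \<in> space M. 2 * \<epsilon> \<le> norm (euler_path (Suc n) (grid m j) \<omega> - euler_path n (grid m j) \<omega>)} \<in> events" for j
  proof -
    have [measurable]: "euler_path k (grid m j) \<in> borel_measurable M" for k by (rule path_measurable) simp
    show ?thesis by measurable
  qed
  ultimately show ?thesis by auto
qed

text \<open>
  On a grid that refines both levels their difference is a drift sum plus a simple Ito integral, with
  coefficients of mean square at most \<open>c2 / 2 ^ n\<close>. The maximal inequality bounds the second part, Markov's
  inequality for the sum of the norms the first one. The bound is the same for all \<open>m\<close>, which lets the grid
  become dense.
\<close>
lemma gap_event_prob:
  assumes nm: "Suc n \<le> m" and \<epsilon>: "0 < \<epsilon>"
  shows "prob (gap_event T n m \<epsilon>) \<le> c3 T / 2 ^ n / \<epsilon>\<^sup>2"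
proof -
  define J where "J = T * 2 ^ m"
  define h where "h = 1 / (2::real) ^ m"
  have h: "0 \<le> h" by (simp add: h_def)
  have Jh: "real J * h = real T" by (simp add: J_def h_def)
  define d where "d i \<omega> = frozen_path (Suc n) (grid m i) \<omega> - frozen_path n (grid m i) \<omega>" for i \<omega>
  have d: "adapted_sq (grid m i) (d i)" for i
    unfolding d_def[abs_def] by (intro adapted_sq_diff frozen_path_adapted grid_nonneg)
  have dms: "ms (d i) \<le> c2 (real T) / 2 ^ n" if "i < J" for i
    unfolding d_def
  proof (rule frozen_path_error)
    have "grid m i \<le> grid m J" using that by (intro grid_mono) simp
    also have "\<dots> = real T" by (simp add: J_def grid_def)
    finally show "grid m i \<le> real T" .
  qed simp_all
  let ?I = "\<lambda>j. simple_ito W j (grid m) (\<lambda>i \<omega>. K *v d i \<omega>)"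
  have sq: "simple_sq (grid m J) J (grid m) (\<lambda>i \<omega>. K *v d i \<omega>)"
    unfolding simple_sq_def by (auto intro!: grid_mono adapted_sq_matrix d)
  have e: "euler_path (Suc n) (grid m j) \<omega> - euler_path n (grid m j) \<omega> = h *\<^sub>R (\<Sum>i<j. B *v d i \<omega>) + ?I j \<omega>" for j \<omega>
  proof (induction j)
    case 0
    have "euler_path k 0 \<omega> = x" for k using path_grid[of k 0 \<omega>] by simp
    then show ?case by (simp add: simple_ito_def)
  next
    case (Suc j)
    have st: "euler_path k (grid m (Suc j)) \<omega> = euler_path k (grid m j) \<omega> + h *\<^sub>R (B *v frozen_path k (grid m j) \<omega>)
        + (W (grid m (Suc j)) \<omega> - W (grid m j) \<omega>) *\<^sub>R (K *v frozen_path k (grid m j) \<omega>)" if "k \<le> m" for k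
      using path_step[OF grid_cell_refine(1)[OF that, of j] grid_mono[of j "Suc j" m] grid_cell_refine(2)[OF that, of j], of \<omega>]
      by (simp add: frozen_path_def grid_Suc h_def)
    have "euler_path (Suc n) (grid m (Suc j)) \<omega> - euler_path n (grid m (Suc j)) \<omega> =
       (euler_path (Suc n) (grid m j) \<omega> - euler_path n (grid m j) \<omega>) + h *\<^sub>R (B *v d j \<omega>) + (W (grid m (Suc j)) \<omega> - W (grid m j) \<omega>) *\<^sub>R (K *v d j \<omega>)"
      using nm by (simp add: st d_def matrix_vector_mult_diff_distrib scaleR_diff_right)
    then show ?case using Suc by (simp add: simple_ito_Suc scaleR_add_right)
  qed
  define g where "g \<omega> = (\<Sum>i<J. h *\<^sub>R norm (B *v d i \<omega>))" for \<omega>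
  have Bd: "sq_int M (\<lambda>\<omega>. B *v d i \<omega>)" for i by (intro sq_int_matrix adapted_sqD(2)[OF d])
  have nBd: "sq_int M (\<lambda>\<omega>. norm (B *v d i \<omega>))" for i
    using Bd[of i] unfolding sq_int_def by auto
  have g: "sq_int M g" unfolding g_def[abs_def] by (intro sq_int_sum sq_int_scaleR nBd)
  let ?E1 = "{\<omega> \<in> space M. \<exists>j\<le>J. \<epsilon> \<le> norm (?I j \<omega>)}" and ?E2 = "{\<omega> \<in> space M. \<epsilon> \<le> norm (g \<omega>)}"
  have E2: "?E2 \<in> events" using sq_intD(1)[OF g] by measurable
  have sub: "gap_event T n m \<epsilon> \<subseteq> ?E1 \<union> ?E2"
  proof
    fix \<omega> assume "\<omega> \<in> gap_event T n m \<epsilon>"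
    then obtain j where \<omega>: "\<omega> \<in> space M" and j: "j \<le> J" and le: "2 * \<epsilon> \<le> norm (h *\<^sub>R (\<Sum>i<j. B *v d i \<omega>) + ?I j \<omega>)"
      unfolding gap_event_def e J_def by auto
    have "norm (h *\<^sub>R (\<Sum>i<j. B *v d i \<omega>)) \<le> h * (\<Sum>i<j. norm (B *v d i \<omega>))"
      using h by (simp add: mult_left_mono norm_sum)
    also have "\<dots> \<le> h * (\<Sum>i<J. norm (B *v d i \<omega>))"
      using h j by (intro mult_left_mono sum_mono2) auto
    also have "\<dots> \<le> norm (g \<omega>)" by (simp add: g_def sum_distrib_left)
    finally have "norm (h *\<^sub>R (\<Sum>i<j. B *v d i \<omega>)) \<le> norm (g \<omega>)" .
    then have "2 * \<epsilon> \<le> norm (g \<omega>) + norm (?I j \<omega>)"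
      using le norm_triangle_ineq[of "h *\<^sub>R (\<Sum>i<j. B *v d i \<omega>)" "?I j \<omega>"] by linarith
    then have "\<epsilon> \<le> norm (g \<omega>) \<or> \<epsilon> \<le> norm (?I j \<omega>)" by linarith
    then show "\<omega> \<in> ?E1 \<union> ?E2" using \<omega> j by auto
  qed
  have p1: "prob ?E1 \<le> (real T * ((onorm ((*v) K))\<^sup>2 * (c2 (real T) / 2 ^ n))) / \<epsilon>\<^sup>2"
  proof (rule order_trans[OF maximal_inequality(2)[OF sq \<epsilon>]], rule divide_right_mono)
    have "(\<Sum>i<J. (grid m (Suc i) - grid m i) * ms (\<lambda>\<omega>. K *v d i \<omega>)) \<le> (\<Sum>i<J. h * ((onorm ((*v) K))\<^sup>2 * (c2 (real T) / 2 ^ n)))"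
    proof (rule sum_mono)
      fix i assume "i \<in> {..<J}"
      then have "ms (\<lambda>\<omega>. K *v d i \<omega>) \<le> (onorm ((*v) K))\<^sup>2 * (c2 (real T) / 2 ^ n)"
        using order_trans[OF ms_matrix_le[OF adapted_sqD(2)[OF d]] mult_left_mono[OF dms]] by simp
      then show "(grid m (Suc i) - grid m i) * ms (\<lambda>\<omega>. K *v d i \<omega>) \<le> h * ((onorm ((*v) K))\<^sup>2 * (c2 (real T) / 2 ^ n))"
        unfolding grid_Suc add_diff_cancel_left' h_def[symmetric] by (rule mult_left_mono[OF _ h])
    qed
    also have "\<dots> = real T * ((onorm ((*v) K))\<^sup>2 * (c2 (real T) / 2 ^ n))"
      using Jh by (simp add: mult.assoc[symmetric])
    finally show "(\<Sum>i<J. (grid m (Suc i) - grid m i) * ms (\<lambda>\<omega>. K *v d i \<omega>)) \<le> real T * ((onorm ((*v) K))\<^sup>2 * (c2 (real T) / 2 ^ n))" .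
  qed simp
  have p2: "prob ?E2 \<le> ((real T)\<^sup>2 * ((onorm ((*v) B))\<^sup>2 * (c2 (real T) / 2 ^ n))) / \<epsilon>\<^sup>2"
  proof (rule order_trans[OF markov_sq[OF E2 g \<epsilon>]])
    have "ms g \<le> expectation (\<lambda>\<omega>. (\<Sum>i<J. real J * h\<^sup>2 * (norm (B *v d i \<omega>))\<^sup>2))"
    proof (rule integral_mono[OF sq_intD(2)[OF g]])
      show "integrable M (\<lambda>\<omega>. (\<Sum>i<J. real J * h\<^sup>2 * (norm (B *v d i \<omega>))\<^sup>2))"
        using sq_intD(2)[OF Bd] by (intro Bochner_Integration.integrable_sum integrable_mult_right) auto
      show "(norm (g \<omega>))\<^sup>2 \<le> (\<Sum>i<J. real J * h\<^sup>2 * (norm (B *v d i \<omega>))\<^sup>2)" for \<omega>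
      proof -
        have "(norm (g \<omega>))\<^sup>2 = (\<Sum>i<J. h * norm (B *v d i \<omega>))\<^sup>2" by (simp add: g_def)
        also have "\<dots> \<le> (\<Sum>i<J. (h * norm (B *v d i \<omega>))\<^sup>2) * real (card {..<J})"
          by (rule sum_squared_le_sum_of_squares)
        also have "\<dots> = (\<Sum>i<J. real J * h\<^sup>2 * (norm (B *v d i \<omega>))\<^sup>2)"
          unfolding sum_distrib_right by (rule sum.cong) (simp_all add: power_mult_distrib)
        finally show ?thesis .
      qed
    qed
    also have "\<dots> = (\<Sum>i<J. real J * h\<^sup>2 * ms (\<lambda>\<omega>. B *v d i \<omega>))"
      using sq_intD(2)[OF Bd] by (subst Bochner_Integration.integral_sum) auto
    also have "\<dots> \<le> (\<Sum>i<J. real J * h\<^sup>2 * ((onorm ((*v) B))\<^sup>2 * (c2 (real T) / 2 ^ n)))"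
    proof (intro sum_mono mult_left_mono)
      fix i assume "i \<in> {..<J}"
      then show "ms (\<lambda>\<omega>. B *v d i \<omega>) \<le> (onorm ((*v) B))\<^sup>2 * (c2 (real T) / 2 ^ n)"
        using order_trans[OF ms_matrix_le[OF adapted_sqD(2)[OF d]] mult_left_mono[OF dms]] by simp
    qed simp
    also have "\<dots> = (real J * h)\<^sup>2 * ((onorm ((*v) B))\<^sup>2 * (c2 (real T) / 2 ^ n))"
      by (simp add: power2_eq_square)
    finally show "ms g / \<epsilon>\<^sup>2 \<le> ((real T)\<^sup>2 * ((onorm ((*v) B))\<^sup>2 * (c2 (real T) / 2 ^ n))) / \<epsilon>\<^sup>2"
      unfolding Jh by (rule divide_right_mono) simp
  qed simp
  have "prob (gap_event T n m \<epsilon>) \<le> prob (?E1 \<union> ?E2)"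
    by (rule finite_measure_mono[OF sub sets.Un[OF maximal_inequality(1)[OF sq \<epsilon>] E2]])
  also have "\<dots> \<le> prob ?E1 + prob ?E2"
    by (rule measure_Un_le[OF maximal_inequality(1)[OF sq \<epsilon>] E2])
  also have "\<dots> \<le> c3 T / 2 ^ n / \<epsilon>\<^sup>2"
    using p1 p2 by (simp add: c3_def add_divide_distrib distrib_right)
  finally show ?thesis .
qed

lemma gap_event_mono: "gap_event T n m \<epsilon> \<subseteq> gap_event T n (Suc m) \<epsilon>"
proof
  fix \<omega> assume "\<omega> \<in> gap_event T n m \<epsilon>"
  then obtain j where j: "\<omega> \<in> space M" "j \<le> T * 2 ^ m" "2 * \<epsilon> \<le> norm (euler_path (Suc n) (grid m j) \<omega> - euler_path n (grid m j) \<omega>)"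
    unfolding gap_event_def by auto
  have "grid m j = grid (Suc m) (j * 2)" using grid_refine[of m "Suc m" j] by simp
  then show "\<omega> \<in> gap_event T n (Suc m) \<epsilon>"
    unfolding gap_event_def using j by (auto intro!: exI[of _ "j * 2"])
qed

text \<open>
  Borel-Cantelli. The threshold \<open>(3 / 4) ^ n\<close> is summable itself and turns the bound on the
  probabilities into a multiple of \<open>(1 / 2) ^ n / (9 / 16) ^ n = (8 / 9) ^ n\<close>.
\<close>
lemma AE_gap_eventually_small:
  "AE \<omega> in M. \<forall>\<^sub>F n in sequentially. \<forall>m. \<forall>j\<le>T * 2 ^ (Suc n + m).
     norm (euler_path (Suc n) (grid (Suc n + m) j) \<omega> - euler_path n (grid (Suc n + m) j) \<omega>) < 2 * (3 / 4) ^ n"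
proof -
  define G where "G n = (\<Union>m. gap_event T n (Suc n + m) ((3 / 4) ^ n))" for n
  have G: "G n \<in> events" for n unfolding G_def by (intro sets.countable_UN) (auto intro: gap_event_sets)
  have pG: "prob (G n) \<le> c3 T * (8 / 9) ^ n" for n
  proof -
    have "incseq (\<lambda>m. gap_event T n (Suc n + m) ((3 / 4) ^ n))"
      by (rule incseq_SucI) (use gap_event_mono in simp)
    then have lim: "(\<lambda>m. prob (gap_event T n (Suc n + m) ((3 / 4) ^ n))) \<longlonglongrightarrow> prob (G n)"
      unfolding G_def by (intro finite_Lim_measure_incseq) (auto intro: gap_event_sets)
    have le: "prob (gap_event T n (Suc n + m) ((3 / 4) ^ n)) \<le> c3 T * (8 / 9) ^ n" for m
    proof -
      have e1: "((3 / 4 :: real) ^ n)\<^sup>2 = (9 / 16) ^ n"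
        by (simp add: power2_eq_square power_mult_distrib[symmetric])
      have e2: "1 / 2 ^ n = (8 / 9 :: real) ^ n * (9 / 16) ^ n"
        by (simp only: power_mult_distrib[symmetric]) (simp add: power_one_over)
      have "(1 / 2 ^ n) / ((3 / 4) ^ n)\<^sup>2 = (8 / 9 :: real) ^ n"
        unfolding e1 e2 by simp
      then have "c3 T * ((1 / 2 ^ n) / ((3 / 4) ^ n)\<^sup>2) = c3 T * (8 / 9) ^ n" by simp
      then show ?thesis using gap_event_prob[of n "Suc n + m" "(3 / 4) ^ n" T] by simp
    qed
    show ?thesis by (rule LIMSEQ_le_const2[OF lim]) (use le in blast)
  qed
  have "summable (\<lambda>n. prob (G n))"
  proof (rule summable_comparison_test')
    show "summable (\<lambda>n. c3 T * (8 / 9) ^ n)" by (intro summable_mult summable_geometric) simp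
    show "norm (prob (G n)) \<le> c3 T * (8 / 9) ^ n" for n using pG[of n] by simp
  qed
  then have "AE \<omega> in M. \<forall>\<^sub>F n in sequentially. \<omega> \<in> space M - G n"
    by (intro borel_cantelli_AE1 G) (auto simp: less_top[symmetric])
  then show ?thesis
  proof eventually_elim
    fix \<omega> assume "\<forall>\<^sub>F n in sequentially. \<omega> \<in> space M - G n"
    then show "\<forall>\<^sub>F n in sequentially. \<forall>m. \<forall>j\<le>T * 2 ^ (Suc n + m).
       norm (euler_path (Suc n) (grid (Suc n + m) j) \<omega> - euler_path n (grid (Suc n + m) j) \<omega>) < 2 * (3 / 4) ^ n"
    proof (rule eventually_mono)
      fix n assume \<omega>: "\<omega> \<in> space M - G n"
      show "\<forall>m. \<forall>j\<le>T * 2 ^ (Suc n + m).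
        norm (euler_path (Suc n) (grid (Suc n + m) j) \<omega> - euler_path n (grid (Suc n + m) j) \<omega>) < 2 * (3 / 4) ^ n"
      proof
        fix m
        have "\<omega> \<notin> gap_event T n (Suc n + m) ((3 / 4) ^ n)" using \<omega> unfolding G_def by blast
        then show "\<forall>j\<le>T * 2 ^ (Suc n + m).
          norm (euler_path (Suc n) (grid (Suc n + m) j) \<omega> - euler_path n (grid (Suc n + m) j) \<omega>) < 2 * (3 / 4) ^ n"
          using \<omega> unfolding gap_event_def mem_Collect_eq Diff_iff not_le[symmetric] by blast
      qed
    qed
  qed
qed

lemma path_continuous:
  assumes "continuous_on {0..} (\<lambda>t. W t \<omega>)" shows "continuous_on {0..} (\<lambda>t. euler_path n t \<omega>)"
proof -
  have on_grid: "continuous_on {0..grid n k} (\<lambda>t. euler_path n t \<omega>)" for k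
  proof (induction k)
    case 0
    then show ?case by simp
  next
    case (Suc k)
    have sub: "{grid n k..grid n (Suc k)} \<subseteq> {0..}"
      using order_trans[OF grid_nonneg] by (meson atLeastAtMost_iff atLeast_iff subsetI)
    have "continuous_on {grid n k..grid n (Suc k)} (\<lambda>t. euler n k \<omega> + (t - grid n k) *\<^sub>R (B *v euler n k \<omega>) + (W t \<omega> - W (grid n k) \<omega>) *\<^sub>R (K *v euler n k \<omega>))"
      by (intro continuous_intros continuous_on_subset[OF assms sub])
    then have "continuous_on {grid n k..grid n (Suc k)} (\<lambda>t. euler_path n t \<omega>)"
      by (rule continuous_on_eq) (rule path_cell[symmetric], auto)
    moreover have "{0..grid n (Suc k)} = {0..grid n k} \<union> {grid n k..grid n (Suc k)}"
      by (rule ivl_disj_un_two_touch(4)[symmetric]) (simp_all add: grid_mono)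
    ultimately show ?case using Suc by (simp add: continuous_on_closed_Un)
  qed
  show ?thesis
  proof (rule continuous_on_half_line)
    fix T :: nat
    have "grid n (T * 2 ^ n) = real T" by (simp add: grid_def)
    then show "continuous_on {0..real T} (\<lambda>t. euler_path n t \<omega>)" using on_grid[of "T * 2 ^ n"] by simp
  qed
qed

text \<open>
  The limit is taken of the frozen paths, which use \<open>W\<close> at countably many times only and are therefore
  progressively measurable. As continuity of the paths of \<open>W\<close> holds only almost surely, this is not clear
  for the interpolated paths.
\<close>
definition sol :: "real \<Rightarrow> 'a \<Rightarrow> real^'n" where
  "sol t \<omega> = lim (\<lambda>n. frozen_path n t \<omega>)"

text \<open>
  The gaps on the dense grids extend to all times by continuity, so the interpolated paths converge
  uniformly on bounded intervals, by comparison with a geometric series, to a continuous limit. The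
  frozen paths are the interpolated ones at the grid point before \<open>t\<close> and have the same limit.
\<close>
lemma pathwise_limit:
  assumes W: "continuous_on {0..} (\<lambda>t. W t \<omega>)"
    and gap: "\<And>T. \<forall>\<^sub>F n in sequentially. \<forall>m. \<forall>j\<le>T * 2 ^ (Suc n + m).
     norm (euler_path (Suc n) (grid (Suc n + m) j) \<omega> - euler_path n (grid (Suc n + m) j) \<omega>) < 2 * (3 / 4) ^ n"
  shows "continuous_on {0..} (\<lambda>t. sol t \<omega>)"
    "\<And>t. 0 \<le> t \<Longrightarrow> (\<lambda>n. frozen_path n t \<omega>) \<longlonglongrightarrow> sol t \<omega>"
proof -
  note pc = path_continuous[OF W]
  define Y where "Y t = lim (\<lambda>n. euler_path n t \<omega>)" for t
  have unif: "uniform_limit {0..real T} (\<lambda>n t. euler_path n t \<omega>) Y sequentially" for T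
  proof -
    obtain N where N: "\<And>n m j. N \<le> n \<Longrightarrow> j \<le> T * 2 ^ (Suc n + m) \<Longrightarrow>
        norm (euler_path (Suc n) (grid (Suc n + m) j) \<omega> - euler_path n (grid (Suc n + m) j) \<omega>) < 2 * (3 / 4) ^ n"
      using gap[of T] unfolding eventually_sequentially by blast
    have step: "norm (euler_path (Suc n) t \<omega> - euler_path n t \<omega>) \<le> 2 * (3 / 4) ^ n" if n: "N \<le> n" and t: "t \<in> {0..real T}" for n t
    proof -
      have t0: "0 \<le> t" using t by simp
      let ?q = "\<lambda>m. grid (Suc n + m) (cell (Suc n + m) t)"
      have q: "?q \<longlonglongrightarrow> t"
        using LIMSEQ_ignore_initial_segment[OF grid_cell_tendsto[OF t0], of "Suc n"] by (simp add: add.commute)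
      have pq: "(\<lambda>m. euler_path k (?q m) \<omega>) \<longlonglongrightarrow> euler_path k t \<omega>" for k
        by (rule continuous_on_tendsto_compose[OF pc q]) (use t0 in auto)
      have le: "norm (euler_path (Suc n) (?q m) \<omega> - euler_path n (?q m) \<omega>) \<le> 2 * (3 / 4) ^ n" for m
      proof -
        define p where "p = Suc n + m"
        have "real (cell p t) \<le> t * 2 ^ p" using cell_bounds(1)[OF t0, of p] by (simp add: grid_def field_simps)
        also have "\<dots> \<le> real T * 2 ^ p" using t by (intro mult_right_mono) auto
        also have "\<dots> = real (T * 2 ^ p)" by simp
        finally have "real (cell (Suc n + m) t) \<le> real (T * 2 ^ (Suc n + m))" unfolding p_def .
        then have "cell (Suc n + m) t \<le> T * 2 ^ (Suc n + m)" by (simp only: of_nat_le_iff)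
        from N[OF n this] show ?thesis by simp
      qed
      show ?thesis
        by (rule LIMSEQ_le_const2[OF tendsto_norm[OF tendsto_diff[OF pq pq]]]) (use le in blast)
    qed
    define f where "f i t = euler_path (Suc (i + N)) t \<omega> - euler_path (i + N) t \<omega>" for i t
    have "uniform_limit {0..real T} (\<lambda>n t. \<Sum>i<n. f i t) (\<lambda>t. suminf (\<lambda>i. f i t)) sequentially"
    proof (rule Weierstrass_m_test)
      show "norm (f i t) \<le> 2 * (3 / 4) ^ (i + N)" if "t \<in> {0..real T}" for i t
        unfolding f_def using step[OF _ that, of "i + N"] by simp
      have "summable (\<lambda>i. 2 * (3 / 4) ^ N * (3 / 4 :: real) ^ i)" by (intro summable_mult summable_geometric) simp
      then show "summable (\<lambda>i. 2 * (3 / 4 :: real) ^ (i + N))" by (simp add: power_add ac_simps)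
    qed
    moreover have "(\<Sum>i<n. f i t) = euler_path (n + N) t \<omega> - euler_path N t \<omega>" for n t
      unfolding f_def by (induction n) auto
    ultimately have "uniform_limit {0..real T} (\<lambda>n t. euler_path N t \<omega> + (euler_path (n + N) t \<omega> - euler_path N t \<omega>)) (\<lambda>t. euler_path N t \<omega> + suminf (\<lambda>i. f i t)) sequentially"
      by (intro uniform_limit_add uniform_limit_const) simp
    then have u: "uniform_limit {0..real T} (\<lambda>n t. euler_path (n + N) t \<omega>) (\<lambda>t. euler_path N t \<omega> + suminf (\<lambda>i. f i t)) sequentially" by simp
    have "Y t = euler_path N t \<omega> + suminf (\<lambda>i. f i t)" if "t \<in> {0..real T}" for t
    proof -
      have "(\<lambda>n. euler_path (n + N) t \<omega>) \<longlonglongrightarrow> euler_path N t \<omega> + suminf (\<lambda>i. f i t)" using tendsto_uniform_limitI[OF u that] .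
      then have "(\<lambda>n. euler_path n t \<omega>) \<longlonglongrightarrow> euler_path N t \<omega> + suminf (\<lambda>i. f i t)" by (rule LIMSEQ_offset)
      then show ?thesis unfolding Y_def by (rule limI)
    qed
    then have Yu: "uniform_limit {0..real T} (\<lambda>n t. euler_path (n + N) t \<omega>) Y sequentially"
      using u unfolding uniform_limit_iff by simp
    show ?thesis
      unfolding uniform_limit_iff
    proof (intro allI impI)
      fix e :: real assume "0 < e"
      then have "\<forall>\<^sub>F n in sequentially. \<forall>t\<in>{0..real T}. dist (euler_path (n + N) t \<omega>) (Y t) < e"
        using Yu unfolding uniform_limit_iff by blast
      then show "\<forall>\<^sub>F n in sequentially. \<forall>t\<in>{0..real T}. dist (euler_path n t \<omega>) (Y t) < e"
        by (subst (asm) eventually_sequentially_seg[of "\<lambda>n. \<forall>t\<in>{0..real T}. dist (euler_path n t \<omega>) (Y t) < e"])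
    qed
  qed
  have Yc: "continuous_on {0..} Y"
  proof (rule continuous_on_half_line)
    fix T :: nat
    have "continuous_on {0..real T} (\<lambda>t. euler_path n t \<omega>)" for n by (rule continuous_on_subset[OF pc]) auto
    then show "continuous_on {0..real T} Y" by (intro uniform_limit_theorem[OF _ unif]) auto
  qed
  have conv: "(\<lambda>n. frozen_path n t \<omega>) \<longlonglongrightarrow> Y t" if t: "0 \<le> t" for t
  proof -
    obtain T :: nat where T: "t \<le> real T" using real_arch_simple by blast
    let ?q = "\<lambda>n. grid n (cell n t)"
    have q: "?q n \<in> {0..real T}" for n using cell_bounds(1)[OF t, of n] T by simp
    have Yq: "(\<lambda>n. Y (?q n)) \<longlonglongrightarrow> Y t"
      by (rule continuous_on_tendsto_compose[OF Yc grid_cell_tendsto[OF t]]) (use t in auto)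
    have "(\<lambda>n. euler_path n (?q n) \<omega> - Y (?q n)) \<longlonglongrightarrow> 0"
    proof (rule metric_LIMSEQ_I)
      fix r :: real assume "0 < r"
      then have "\<forall>\<^sub>F n in sequentially. \<forall>s\<in>{0..real T}. dist (euler_path n s \<omega>) (Y s) < r"
        using unif unfolding uniform_limit_iff by blast
      then show "\<exists>no. \<forall>n\<ge>no. dist (euler_path n (?q n) \<omega> - Y (?q n)) 0 < r"
        unfolding eventually_sequentially using q by (metis dist_norm diff_zero)
    qed
    from tendsto_add[OF this Yq] show ?thesis by (simp add: path_grid frozen_path_def)
  qed
  then have "sol t \<omega> = Y t" if "0 \<le> t" for t unfolding sol_def using that limI by blast
  then show "continuous_on {0..} (\<lambda>t. sol t \<omega>)" "\<And>t. 0 \<le> t \<Longrightarrow> (\<lambda>n. frozen_path n t \<omega>) \<longlonglongrightarrow> sol t \<omega>"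
    using Yc conv by (auto intro: continuous_on_eq)
qed

lemma AE_W_continuous: "AE \<omega> in M. continuous_on {0..} (\<lambda>t. W t \<omega>)"
  using bm unfolding std_brownian_motion_def by blast

lemma AE_sol:
  "AE \<omega> in M. continuous_on {0..} (\<lambda>t. W t \<omega>) \<and> continuous_on {0..} (\<lambda>t. sol t \<omega>) \<and>
    (\<forall>t\<ge>0. (\<lambda>n. frozen_path n t \<omega>) \<longlonglongrightarrow> sol t \<omega>)"
proof -
  have "AE \<omega> in M. \<forall>T. \<forall>\<^sub>F n in sequentially. \<forall>m. \<forall>j\<le>T * 2 ^ (Suc n + m).
     norm (euler_path (Suc n) (grid (Suc n + m) j) \<omega> - euler_path n (grid (Suc n + m) j) \<omega>) < 2 * (3 / 4) ^ n"
    unfolding AE_all_countable using AE_gap_eventually_small by blast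
  with AE_W_continuous show ?thesis
    by eventually_elim (use pathwise_limit in blast)
qed

end

section \<open>Existence of closed-loop solutions\<close>

lemma ennreal_tendsto_0_geometric:
  fixes r :: "nat \<Rightarrow> real"
  assumes "\<And>n. 0 \<le> r n" "\<And>n. r n \<le> c / 2 ^ n" shows "(\<lambda>n. ennreal (r n)) \<longlonglongrightarrow> 0"
proof -
  have "(\<lambda>n. c * (1 / 2) ^ n) \<longlonglongrightarrow> c * 0" by (intro tendsto_intros LIMSEQ_realpow_zero) auto
  then have u: "(\<lambda>n. c / 2 ^ n) \<longlonglongrightarrow> 0" by (simp add: power_one_over)
  have "r \<longlonglongrightarrow> 0" by (rule tendsto_sandwich[OF _ _ tendsto_const u]) (use assms in auto)
  then show ?thesis using assms(1) by (simp add: ennreal_tendsto_0_iff)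
qed

context brownian
begin

text \<open>
  The definition of the Ito integral asks for bounded coefficients; those of the Euler scheme are
  truncated.
\<close>
lemma bounded_approximation:
  fixes f :: "'a \<Rightarrow> 'b::euclidean_space"
  assumes s: "0 \<le> s" and f: "adapted_sq s f" and \<epsilon>: "0 < \<epsilon>"
  shows "\<exists>g. g \<in> borel_measurable (F s) \<and> (\<exists>b. \<forall>\<omega>\<in>space M. norm (g \<omega>) \<le> b) \<and> ms (\<lambda>\<omega>. f \<omega> - g \<omega>) \<le> \<epsilon>"
proof -
  define g where "g R \<omega> = (if norm (f \<omega>) \<le> real R then f \<omega> else 0)" for R \<omega>
  note [measurable] = adapted_sqD(1)[OF f]
  have gF: "g R \<in> borel_measurable (F s)" for R unfolding g_def[abs_def] by measurable
  have fM: "f \<in> borel_measurable M" by (rule sq_intD(1)[OF adapted_sqD(2)[OF f]])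
  have gM: "g R \<in> borel_measurable M" for R by (rule measurable_F[OF s gF])
  have m1: "(\<lambda>\<omega>. (norm (f \<omega> - g R \<omega>))\<^sup>2) \<in> borel_measurable M" for R using fM gM[of R] by measurable
  have "(\<lambda>R. ms (\<lambda>\<omega>. f \<omega> - g R \<omega>)) \<longlonglongrightarrow> expectation (\<lambda>\<omega>. 0)"
  proof (rule integral_dominated_convergence)
    show "integrable M (\<lambda>\<omega>. (norm (f \<omega>))\<^sup>2)" by (rule sq_intD(2)[OF adapted_sqD(2)[OF f]])
    show "AE \<omega> in M. norm ((norm (f \<omega> - g R \<omega>))\<^sup>2) \<le> (norm (f \<omega>))\<^sup>2" for R
      by (intro AE_I2) (simp add: g_def)
    show "AE \<omega> in M. (\<lambda>R. (norm (f \<omega> - g R \<omega>))\<^sup>2) \<longlonglongrightarrow> 0"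
    proof (intro AE_I2 tendsto_eventually)
      fix \<omega>
      obtain N :: nat where "norm (f \<omega>) \<le> real N" using real_arch_simple by blast
      then show "\<forall>\<^sub>F R in sequentially. (norm (f \<omega> - g R \<omega>))\<^sup>2 = 0"
        unfolding eventually_sequentially by (intro exI[of _ N]) (auto simp: g_def)
    qed
  qed (use m1 in simp_all)
  then have "(\<lambda>R. ms (\<lambda>\<omega>. f \<omega> - g R \<omega>)) \<longlonglongrightarrow> 0" by simp
  then have "\<forall>\<^sub>F R in sequentially. ms (\<lambda>\<omega>. f \<omega> - g R \<omega>) < \<epsilon>" using \<epsilon> by (rule order_tendstoD(2))
  then obtain R where "ms (\<lambda>\<omega>. f \<omega> - g R \<omega>) < \<epsilon>" unfolding eventually_sequentially by blast
  moreover have "\<forall>\<omega>\<in>space M. norm (g R \<omega>) \<le> real R" by (simp add: g_def)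
  ultimately show ?thesis using gF by (intro exI[of _ "g R"]) auto
qed

lemma time_integral_simple_val:
  fixes \<xi> :: "nat \<Rightarrow> 'a \<Rightarrow> 'b::euclidean_space"
  assumes "simple_sq T k u \<xi>"
  shows "(\<integral>s. simple_val k u \<xi> s \<omega> \<partial>time_lborel T) = (\<Sum>i<k. (u (Suc i) - u i) *\<^sub>R \<xi> i \<omega>)"
    "integrable (time_lborel T) (\<lambda>s. simple_val k u \<xi> s \<omega>)"
proof -
  have i: "integrable (time_lborel T) (\<lambda>s. indicator {u i<..u (Suc i)} s *\<^sub>R \<xi> i \<omega>)" for i
    by (intro integrable_scaleR_left integrable_indicator_time) auto
  show "integrable (time_lborel T) (\<lambda>s. simple_val k u \<xi> s \<omega>)"
    unfolding simple_val_def by (intro Bochner_Integration.integrable_sum i)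
  have "(\<integral>s. simple_val k u \<xi> s \<omega> \<partial>time_lborel T) = (\<Sum>i<k. (\<integral>s. indicator {u i<..u (Suc i)} s *\<^sub>R \<xi> i \<omega> \<partial>time_lborel T))"
    unfolding simple_val_def by (intro Bochner_Integration.integral_sum i)
  also have "\<dots> = (\<Sum>i<k. (u (Suc i) - u i) *\<^sub>R \<xi> i \<omega>)"
  proof (intro sum.cong refl)
    fix i assume "i \<in> {..<k}"
    then have i: "i < k" by simp
    note x = simple_sqD(1-3)[OF assms i]
    have "(\<integral>s. indicator {u i<..u (Suc i)} s *\<^sub>R \<xi> i \<omega> \<partial>time_lborel T) = (\<integral>s. indicator {u i<..u (Suc i)} s \<partial>time_lborel T) *\<^sub>R \<xi> i \<omega>"
      by (rule integral_scaleR_left) (intro integrable_indicator_time, simp)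
    also have "(\<integral>s. (indicator {u i<..u (Suc i)} s :: real) \<partial>time_lborel T) = measure lborel {u i<..u (Suc i)}"
      by (rule integral_indicator_time) (use x in auto)
    also have "\<dots> = u (Suc i) - u i" using x by simp
    finally show "(\<integral>s. indicator {u i<..u (Suc i)} s *\<^sub>R \<xi> i \<omega> \<partial>time_lborel T) = (u (Suc i) - u i) *\<^sub>R \<xi> i \<omega>" .
  qed
  finally show "(\<integral>s. simple_val k u \<xi> s \<omega> \<partial>time_lborel T) = (\<Sum>i<k. (u (Suc i) - u i) *\<^sub>R \<xi> i \<omega>)" .
qed

end

context linear_sde
begin

text \<open>
  On \<open>[0, T]\<close> a frozen path only uses grid points up to \<open>T\<close>. The values of the scheme at later grid
  points are replaced by zero to stay measurable at time \<open>T\<close>.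
\<close>
lemma sol_prog_measurable: "prog_measurable F sol"
  unfolding prog_measurable_def
proof (intro allI impI)
  fix T :: real assume T: "0 \<le> T"
  let ?N = "restrict_space borel {0..T} \<Otimes>\<^sub>M F T"
  have "case_prod (frozen_path n) \<in> borel_measurable ?N" for n
  proof -
    define f where "f k \<omega> = (if grid n k \<le> T then euler n k \<omega> else 0)" for k \<omega>
    have fF: "f k \<in> borel_measurable (F T)" for k
      using measurable_F_mono[OF grid_nonneg _ adapted_sqD(1)[OF euler_adapted], of n k T]
      unfolding f_def[abs_def] by (cases "grid n k \<le> T") simp_all
    have id: "(\<lambda>s. s) \<in> borel_measurable (restrict_space borel {0..T})" by (rule measurable_restrict_space1) simp
    have fst1[measurable]: "(\<lambda>p. fst p) \<in> borel_measurable ?N" by (rule measurable_compose[OF measurable_fst id])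
    have "(\<lambda>p. f (cell n (fst p)) (snd p)) \<in> borel_measurable ?N"
    proof (rule measurable_compose_countable)
      show "(\<lambda>p. f k (snd p)) \<in> borel_measurable ?N" for k by (rule measurable_compose[OF measurable_snd fF])
      show "(\<lambda>p. cell n (fst p)) \<in> measurable ?N (count_space UNIV)" unfolding cell_def by measurable
    qed
    moreover have "f (cell n (fst p)) (snd p) = case_prod (frozen_path n) p" if "p \<in> space ?N" for p
    proof -
      have p: "0 \<le> fst p" "fst p \<le> T" using that by (auto simp: space_pair_measure space_restrict_space)
      have "grid n (cell n (fst p)) \<le> T" using cell_bounds(1)[OF p(1), of n] p(2) by linarith
      then show ?thesis by (simp add: f_def frozen_path_def case_prod_unfold)
    qed
    ultimately show ?thesis by (subst measurable_cong[symmetric]) auto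
  qed
  then have "(\<lambda>p. lim (\<lambda>n. case_prod (frozen_path n) p)) \<in> borel_measurable ?N" by (rule borel_measurable_lim_metric)
  then show "case_prod sol \<in> borel_measurable ?N" by (simp add: case_prod_unfold sol_def)
qed

lemma sol_measurable: "0 \<le> t \<Longrightarrow> sol t \<in> borel_measurable M"
  using measurable_F[OF _ prog_measurable_adapted[OF sol_prog_measurable]] .

lemma AE_frozen_path_tendsto: "0 \<le> t \<Longrightarrow> AE \<omega> in M. (\<lambda>n. frozen_path n t \<omega>) \<longlonglongrightarrow> sol t \<omega>"
  using AE_sol by eventually_elim blast

lemma sol_sq_int:
  assumes "0 \<le> t" "t \<le> T" shows "sq_int M (sol t)" "ms (sol t) \<le> c0 T"
proof -
  have "sq_int M (frozen_path n t)" for n by (rule adapted_sqD(2)[OF frozen_path_adapted[OF assms(1)]])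
  from Fatou_sq[of 0 "\<lambda>n. frozen_path n t", OF this frozen_path_ms[OF assms] sol_measurable[OF assms(1)] AE_frozen_path_tendsto[OF assms(1)]]
  show "sq_int M (sol t)" "ms (sol t) \<le> c0 T" by auto
qed

lemma sol_minus_frozen:
  assumes "0 \<le> t" "t \<le> T" shows "ms (\<lambda>\<omega>. sol t \<omega> - frozen_path n t \<omega>) \<le> c2 T / 2 ^ n"
proof (rule Fatou_sq(2)[of n "\<lambda>m \<omega>. frozen_path m t \<omega> - frozen_path n t \<omega>"])
  have sq: "sq_int M (frozen_path m t)" for m by (rule adapted_sqD(2)[OF frozen_path_adapted[OF assms(1)]])
  show "sq_int M (\<lambda>\<omega>. frozen_path m t \<omega> - frozen_path n t \<omega>)" for m by (intro sq_int_diff sq)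
  show "ms (\<lambda>\<omega>. frozen_path m t \<omega> - frozen_path n t \<omega>) \<le> c2 T / 2 ^ n" if "n \<le> m" for m
    by (rule frozen_path_error[OF that assms])
  show "(\<lambda>\<omega>. sol t \<omega> - frozen_path n t \<omega>) \<in> borel_measurable M"
    using sol_measurable[OF assms(1)] sq_intD(1)[OF sq] by measurable
  show "AE \<omega> in M. (\<lambda>m. frozen_path m t \<omega> - frozen_path n t \<omega>) \<longlonglongrightarrow> sol t \<omega> - frozen_path n t \<omega>"
    using AE_frozen_path_tendsto[OF assms(1)] by eventually_elim (intro tendsto_diff tendsto_const)
qed

text \<open>
  The error estimate holds on grid points. It is passed to \<open>t\<close> along the grid points before \<open>t\<close> with
  Fatou's lemma, as \<open>frozen_path m t\<close> is the value of level \<open>m\<close> at such a point.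
\<close>
lemma sol_minus_path:
  assumes "0 \<le> t" "t \<le> T" shows "ms (\<lambda>\<omega>. sol t \<omega> - euler_path n t \<omega>) \<le> c1 T / 2 ^ n"
proof (rule Fatou_sq(2)[of n "\<lambda>m \<omega>. frozen_path m t \<omega> - euler_path n (grid m (cell m t)) \<omega>"])
  have sq: "sq_int M (frozen_path m t)" for m by (rule adapted_sqD(2)[OF frozen_path_adapted[OF assms(1)]])
  have sqp: "sq_int M (euler_path n r)" if "0 \<le> r" for r by (rule adapted_sqD(2)[OF path_adapted[OF that]])
  show "sq_int M (\<lambda>\<omega>. frozen_path m t \<omega> - euler_path n (grid m (cell m t)) \<omega>)" for m by (intro sq_int_diff sq sqp) simp
  show "ms (\<lambda>\<omega>. frozen_path m t \<omega> - euler_path n (grid m (cell m t)) \<omega>) \<le> c1 T / 2 ^ n" if "n \<le> m" for m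
    unfolding frozen_path_def
    by (rule euler_error[OF that]) (use cell_bounds(1)[OF assms(1), of m] assms(2) in linarith)
  show "(\<lambda>\<omega>. sol t \<omega> - euler_path n t \<omega>) \<in> borel_measurable M"
    using sol_measurable[OF assms(1)] path_measurable[OF assms(1)] by measurable
  show "AE \<omega> in M. (\<lambda>m. frozen_path m t \<omega> - euler_path n (grid m (cell m t)) \<omega>) \<longlonglongrightarrow> sol t \<omega> - euler_path n t \<omega>"
    using AE_sol
  proof eventually_elim
    fix \<omega> assume a: "continuous_on {0..} (\<lambda>t. W t \<omega>) \<and> continuous_on {0..} (\<lambda>t. sol t \<omega>) \<and>
      (\<forall>t\<ge>0. (\<lambda>n. frozen_path n t \<omega>) \<longlonglongrightarrow> sol t \<omega>)"
    then have "continuous_on {0..} (\<lambda>t. euler_path n t \<omega>)" by (intro path_continuous) blast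
    then have "(\<lambda>m. euler_path n (grid m (cell m t)) \<omega>) \<longlonglongrightarrow> euler_path n t \<omega>"
      by (rule continuous_on_tendsto_compose[OF _ grid_cell_tendsto[OF assms(1)]]) (use assms in auto)
    then show "(\<lambda>m. frozen_path m t \<omega> - euler_path n (grid m (cell m t)) \<omega>) \<longlonglongrightarrow> sol t \<omega> - euler_path n t \<omega>"
      using a assms(1) by (intro tendsto_diff) auto
  qed
qed

lemma sol_NT: assumes t: "0 \<le> t" shows "sq_int (NT t) (case_prod sol)"
proof -
  note m = prog_measurable_NT[OF sol_prog_measurable t]
  have "(\<integral>\<^sup>+p. ennreal ((norm (case_prod sol p))\<^sup>2) \<partial>NT t) = (\<integral>\<^sup>+s\<in>{0..t}. (\<integral>\<^sup>+\<omega>. ennreal ((norm (sol s \<omega>))\<^sup>2) \<partial>M) \<partial>lborel)"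
    using nn_integral_NT'[of "\<lambda>s \<omega>. ennreal ((norm (sol s \<omega>))\<^sup>2)" t] m by (simp add: case_prod_unfold)
  also have "\<dots> \<le> (\<integral>\<^sup>+s\<in>{0..t}. ennreal (c0 t) \<partial>lborel)"
    using sol_sq_int[of _ t] by (intro nn_integral_mono) (auto simp: indicator_def sq_int_nn_integral intro: ennreal_leI)
  also have "\<dots> < \<infinity>" using t by (simp add: ennreal_mult_less_top nn_integral_cmult_indicator)
  finally show ?thesis using m by (simp add: sq_int_iff_nn_integral)
qed

text \<open>
  The grid points before \<open>t\<close>, followed by \<open>t\<close> itself.
\<close>
definition knots :: "nat \<Rightarrow> real \<Rightarrow> nat \<Rightarrow> real" where "knots n t i = min (grid n i) t"

lemma knots_below: assumes "0 \<le> t" "i \<le> cell n t" shows "knots n t i = grid n i"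
  using cell_bounds(1)[OF assms(1), of n] grid_mono[OF assms(2), of n] by (simp add: knots_def)

lemma knots_last: "0 \<le> t \<Longrightarrow> knots n t (Suc (cell n t)) = t"
  using cell_bounds(2)[of t n] by (simp add: knots_def)

lemma euler_simple:
  assumes t: "0 \<le> t" shows "simple_sq t (Suc (cell n t)) (knots n t) (euler n)"
  unfolding simple_sq_def
proof (intro conjI allI impI)
  show "0 \<le> knots n t 0" using t by (simp add: knots_def)
  show "knots n t (Suc (cell n t)) \<le> t" by (simp add: knots_def)
  fix i assume i: "i < Suc (cell n t)"
  show "knots n t i \<le> knots n t (Suc i)" using grid_mono[of i "Suc i" n] by (auto simp: knots_def)
  show "adapted_sq (knots n t i) (euler n i)" using knots_below[OF t, of i n] i euler_adapted[of n i] by simp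
qed

abbreviation "euler_val n t \<equiv> simple_val (Suc (cell n t)) (knots n t) (euler n)"

text \<open>
  Simple processes take the value of an interval at its right end, frozen paths at its left end; the two
  differ on grid points only.
\<close>
lemma euler_val_eq:
  assumes s: "0 \<le> s" "s \<le> t" "s \<notin> range (grid n)"
  shows "euler_val n t s \<omega> = frozen_path n s \<omega>"
proof -
  have ind: "indicator {knots n t i<..knots n t (Suc i)} s = (if i = cell n s then 1 else 0 :: real)" for i
  proof (cases "i = cell n s")
    case True
    have "grid n i \<noteq> s" using s(3) by blast
    then show ?thesis using True cell_bounds[OF s(1), of n] s(2) by (auto simp: knots_def indicator_def)
  next
    case False
    have "\<not> (knots n t i < s \<and> s \<le> knots n t (Suc i))"
    proof
      assume a: "knots n t i < s \<and> s \<le> knots n t (Suc i)"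
      then have "grid n i \<le> s" "s \<le> grid n (Suc i)" using s(2) by (auto simp: knots_def min_def split: if_splits)
      moreover have "s \<noteq> grid n (Suc i)" using s(3) by blast
      ultimately have "cell n s = i" by (intro cell_eqI) auto
      then show False using False by simp
    qed
    then show ?thesis using False by (simp add: indicator_def)
  qed
  have "cell n s < Suc (cell n t)"
    unfolding cell_def using s(2) by (simp add: le_nat_iff nat_mono floor_mono mult_right_mono less_Suc_eq_le)
  then show ?thesis
    unfolding simple_val_def ind by (simp add: if_distrib[of "\<lambda>c. c *\<^sub>R _"] sum.delta frozen_path_def cong: if_cong)
qed

lemma sol_minus_euler_val:
  assumes t: "0 \<le> t"
  shows "(\<integral>p. (norm (case_prod sol p - euler_val n t (fst p) (snd p)))\<^sup>2 \<partial>NT t) \<le> t * c2 t / 2 ^ n"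
proof -
  let ?e = "\<lambda>p. case_prod sol p - euler_val n t (fst p) (snd p)"
  have sq: "sq_int (NT t) ?e" by (intro sq_int_diff sol_NT[OF t] simple_val_sq_int[OF euler_simple[OF t]])
  note [measurable] = sq_intD(1)[OF sq]
  have m: "(\<lambda>p. ennreal ((norm (?e p))\<^sup>2)) \<in> borel_measurable (NT t)" by measurable
  have "ennreal (\<integral>p. (norm (?e p))\<^sup>2 \<partial>NT t) = (\<integral>\<^sup>+p. ennreal ((norm (?e p))\<^sup>2) \<partial>NT t)"
    by (rule sq_int_nn_integral[OF sq, symmetric])
  also have "\<dots> = (\<integral>\<^sup>+s\<in>{0..t}. (\<integral>\<^sup>+\<omega>. ennreal ((norm (sol s \<omega> - euler_val n t s \<omega>))\<^sup>2) \<partial>M) \<partial>lborel)"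
    using nn_integral_NT'[of "\<lambda>s \<omega>. ennreal ((norm (sol s \<omega> - euler_val n t s \<omega>))\<^sup>2)" t] m by (simp add: case_prod_unfold)
  also have "\<dots> \<le> (\<integral>\<^sup>+s\<in>{0..t}. ennreal (c2 t / 2 ^ n) \<partial>lborel)"
  proof (rule nn_integral_mono_AE)
    have "AE s in lborel. s \<notin> range (grid n)"
      by (intro AE_not_in countable_imp_null_set_lborel) auto
    then show "AE s in lborel. (\<integral>\<^sup>+\<omega>. ennreal ((norm (sol s \<omega> - euler_val n t s \<omega>))\<^sup>2) \<partial>M) * indicator {0..t} s \<le> ennreal (c2 t / 2 ^ n) * indicator {0..t} s"
    proof eventually_elim
      fix s assume s: "s \<notin> range (grid n)"
      show "(\<integral>\<^sup>+\<omega>. ennreal ((norm (sol s \<omega> - euler_val n t s \<omega>))\<^sup>2) \<partial>M) * indicator {0..t} s \<le> ennreal (c2 t / 2 ^ n) * indicator {0..t} s"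
      proof (cases "s \<in> {0..t}")
        case True
        then have st: "0 \<le> s" "s \<le> t" by auto
        have "sq_int M (\<lambda>\<omega>. sol s \<omega> - frozen_path n s \<omega>)"
          by (intro sq_int_diff sol_sq_int(1)[OF st] adapted_sqD(2)[OF frozen_path_adapted] st)
        then show ?thesis using True sol_minus_frozen[OF st, of n]
          by (simp add: euler_val_eq[OF st s] sq_int_nn_integral ennreal_leI)
      qed simp
    qed
  qed
  also have "\<dots> = ennreal (t * c2 t / 2 ^ n)"
    using t c2_nonneg[of t]
    by (subst nn_integral_cmult_indicator) (simp_all add: ennreal_mult[symmetric] mult.commute)
  finally show ?thesis using t c2_nonneg by (subst (asm) ennreal_le_iff) auto
qed

text \<open>
  The continuous scheme in integrated form: a time integral of a simple process plus a simple Ito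
  integral.
\<close>
lemma path_sum:
  assumes t: "0 \<le> t"
  shows "euler_path n t \<omega> = x + (\<Sum>i<Suc (cell n t). (knots n t (Suc i) - knots n t i) *\<^sub>R (B *v euler n i \<omega>))
    + simple_ito W (Suc (cell n t)) (knots n t) (\<lambda>i \<omega>. K *v euler n i \<omega>) \<omega>"
proof -
  have "euler n j \<omega> = x + (\<Sum>i<j. (knots n t (Suc i) - knots n t i) *\<^sub>R (B *v euler n i \<omega>))
    + simple_ito W j (knots n t) (\<lambda>i \<omega>. K *v euler n i \<omega>) \<omega>" if "j \<le> cell n t" for j
    using that
  proof (induction j)
    case 0
    then show ?case by (simp add: simple_ito_def)
  next
    case (Suc j)
    then show ?case using knots_below[OF t, of j n] knots_below[OF t, of "Suc j" n] by (simp add: simple_ito_Suc)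
  qed
  from this[OF order_refl] show ?thesis
    unfolding euler_path_def frozen_path_def
    using knots_below[OF t order_refl, of n] knots_last[OF t, of n] by (simp add: simple_ito_Suc)
qed

text \<open>
  What the integral equation leaves for the Ito integral.
\<close>
definition ito_part :: "real \<Rightarrow> 'a \<Rightarrow> real^'n" where
  "ito_part t \<omega> = sol t \<omega> - x - (LINT s:{0..t}|lborel. B *v sol s \<omega>)"

lemma sol_matrix_NT:
  fixes R :: "real^'n^'n"
  shows "0 \<le> t \<Longrightarrow> sq_int (NT t) (case_prod (\<lambda>s \<omega>. R *v sol s \<omega>))"
  using sq_int_matrix[OF sol_NT, of t R] by (simp add: case_prod_unfold)

lemma ito_part_sq_int: assumes t: "0 \<le> t" shows "sq_int M (ito_part t)"
  unfolding ito_part_def[abs_def]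
  using time_integral_sq_int(1)[OF sol_matrix_NT[OF t, of B] t, of t] t
  by (intro sq_int_diff sol_sq_int(1)[OF t order_refl] adapted_sqD(2)[OF adapted_sq_const]) auto

lemma matrix_NT_diff:
  fixes R :: "real^'n^'n"
  assumes t: "0 \<le> t"
  shows "(\<integral>p. (norm (R *v case_prod sol p - R *v euler_val n t (fst p) (snd p)))\<^sup>2 \<partial>NT t)
    \<le> (onorm ((*v) R))\<^sup>2 * (t * c2 t / 2 ^ n)"
proof -
  let ?e = "\<lambda>p. case_prod sol p - euler_val n t (fst p) (snd p)"
  have sq: "sq_int (NT t) ?e" by (intro sq_int_diff sol_NT[OF t] simple_val_sq_int[OF euler_simple[OF t]])
  have "(\<integral>p. (norm (R *v ?e p))\<^sup>2 \<partial>NT t) \<le> (\<integral>p. (onorm ((*v) R))\<^sup>2 * (norm (?e p))\<^sup>2 \<partial>NT t)"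
    using sq_intD(2)[OF sq] sq_intD(2)[OF sq_int_matrix[OF sq, of R]]
    by (intro integral_mono norm_bounded_linear_sq_le matrix_vector_mul_bounded_linear) auto
  also have "\<dots> = (onorm ((*v) R))\<^sup>2 * (\<integral>p. (norm (?e p))\<^sup>2 \<partial>NT t)" by simp
  also have "\<dots> \<le> (onorm ((*v) R))\<^sup>2 * (t * c2 t / 2 ^ n)"
    by (intro mult_left_mono sol_minus_euler_val[OF t]) simp
  finally show ?thesis by (simp add: matrix_vector_mult_diff_distrib)
qed

lemma ito_part_approx:
  assumes t: "0 \<le> t"
  shows "ms (\<lambda>\<omega>. ito_part t \<omega> - simple_ito W (Suc (cell n t)) (knots n t) (\<lambda>i \<omega>. K *v euler n i \<omega>) \<omega>)
    \<le> (2 * c1 t + 2 * (t * ((onorm ((*v) B))\<^sup>2 * (t * c2 t)))) / 2 ^ n"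
proof -
  let ?k = "Suc (cell n t)" and ?u = "knots n t"
  let ?I = "simple_ito W ?k ?u (\<lambda>i \<omega>. K *v euler n i \<omega>)"
  define V where "V s \<omega> = B *v sol s \<omega> - B *v euler_val n t s \<omega>" for s \<omega>
  have VN: "sq_int (NT t) (case_prod V)"
    using sq_int_diff[OF sol_matrix_NT[OF t, of B] sq_int_matrix[where S = B, OF simple_val_sq_int[OF euler_simple[OF t, of n]]]]
    by (simp add: V_def case_prod_unfold)
  let ?J = "\<lambda>\<omega>. LINT s:{0..t}|lborel. V s \<omega>"
  have J: "sq_int M ?J" using time_integral_sq_int(1)[OF VN t, of t] t by simp
  have Jms: "ms ?J \<le> t * ((onorm ((*v) B))\<^sup>2 * (t * c2 t / 2 ^ n))"
  proof -
    have "ennreal (ms ?J) \<le> ennreal t * ennreal (\<integral>p. (norm (case_prod V p))\<^sup>2 \<partial>NT t)"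
      using time_integral_nn_bound[OF sq_intD(1)[OF VN] t order_refl]
      unfolding sq_int_nn_integral[OF VN] sq_int_nn_integral[OF J] .
    then have "ms ?J \<le> t * (\<integral>p. (norm (case_prod V p))\<^sup>2 \<partial>NT t)"
      using t by (simp add: ennreal_mult[symmetric])
    also have "\<dots> \<le> t * ((onorm ((*v) B))\<^sup>2 * (t * c2 t / 2 ^ n))"
      using matrix_NT_diff[OF t, of B n] t by (intro mult_left_mono) (simp_all add: V_def case_prod_unfold)
    finally show ?thesis .
  qed
  have Ksq: "simple_sq t ?k ?u (\<lambda>i \<omega>. B *v euler n i \<omega>)"
    using euler_simple[OF t, of n] unfolding simple_sq_def by (auto intro: adapted_sq_matrix)
  have Isq: "sq_int M ?I"
    by (rule simple_ito_sq_int[of t]) (use euler_simple[OF t, of n] in \<open>auto simp: simple_sq_def intro: adapted_sq_matrix\<close>)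
  have eq: "AE \<omega> in M. ito_part t \<omega> - ?I \<omega> = (sol t \<omega> - euler_path n t \<omega>) - ?J \<omega>"
    using AE_sol
  proof eventually_elim
    fix \<omega> assume a: "continuous_on {0..} (\<lambda>t. W t \<omega>) \<and> continuous_on {0..} (\<lambda>t. sol t \<omega>) \<and>
      (\<forall>t\<ge>0. (\<lambda>n. frozen_path n t \<omega>) \<longlonglongrightarrow> sol t \<omega>)"
    then have "continuous_on {0..t} (\<lambda>s. B *v sol s \<omega>)"
      by (intro bounded_linear.continuous_on[OF matrix_vector_mul_bounded_linear]) (auto elim: continuous_on_subset)
    then have "set_integrable lborel {0..t} (\<lambda>s. B *v sol s \<omega>)" by (rule borel_integrable_atLeastAtMost')
    then have i: "integrable (time_lborel t) (\<lambda>s. B *v sol s \<omega>)"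
      unfolding time_lborel_def set_integrable_def by (subst integrable_restrict_space) auto
    have "?J \<omega> = (\<integral>s. B *v sol s \<omega> - simple_val ?k ?u (\<lambda>i \<omega>. B *v euler n i \<omega>) s \<omega> \<partial>time_lborel t)"
      unfolding integral_time_lborel[symmetric] V_def simple_val_matrix ..
    also have "\<dots> = (\<integral>s. B *v sol s \<omega> \<partial>time_lborel t) - (\<integral>s. simple_val ?k ?u (\<lambda>i \<omega>. B *v euler n i \<omega>) s \<omega> \<partial>time_lborel t)"
      by (rule Bochner_Integration.integral_diff[OF i time_integral_simple_val(2)[OF Ksq]])
    also have "\<dots> = (LINT s:{0..t}|lborel. B *v sol s \<omega>) - (\<Sum>i<?k. (?u (Suc i) - ?u i) *\<^sub>R (B *v euler n i \<omega>))"
      unfolding integral_time_lborel time_integral_simple_val(1)[OF Ksq, unfolded integral_time_lborel] ..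
    finally show "ito_part t \<omega> - ?I \<omega> = (sol t \<omega> - euler_path n t \<omega>) - ?J \<omega>"
      unfolding ito_part_def path_sum[OF t] by simp
  qed
  have sp: "sq_int M (\<lambda>\<omega>. sol t \<omega> - euler_path n t \<omega>)"
    by (intro sq_int_diff sol_sq_int(1)[OF t order_refl] adapted_sqD(2)[OF path_adapted[OF t]])
  have "ms (\<lambda>\<omega>. ito_part t \<omega> - ?I \<omega>) = ms (\<lambda>\<omega>. (sol t \<omega> - euler_path n t \<omega>) - ?J \<omega>)"
  proof (rule integral_cong_AE)
    show "AE \<omega> in M. (norm (ito_part t \<omega> - ?I \<omega>))\<^sup>2 = (norm ((sol t \<omega> - euler_path n t \<omega>) - ?J \<omega>))\<^sup>2"
      using eq by eventually_elim simp
  qed (intro borel_measurable_integrable sq_intD(2) sq_int_diff[OF ito_part_sq_int[OF t] Isq] sq_int_diff[OF sp J])+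
  also have "\<dots> \<le> 2 * ms (\<lambda>\<omega>. sol t \<omega> - euler_path n t \<omega>) + 2 * ms ?J"
    using integral_norm_diff_sq_le[OF sp sq_int_zero J] by simp
  also have "\<dots> \<le> 2 * (c1 t / 2 ^ n) + 2 * (t * ((onorm ((*v) B))\<^sup>2 * (t * c2 t / 2 ^ n)))"
    using sol_minus_path[OF t order_refl, of n] Jms by linarith
  finally show ?thesis by (simp add: add_divide_distrib)
qed

text \<open>
  The truncated integrands of the Euler scheme approximate \<open>K sol\<close>, and by \<open>path_sum\<close> their Ito integrals
  are the schemes without initial value and drift, up to the truncation error. Both converge at rate
  \<open>1 / 2 ^ n\<close>.
\<close>
theorem sol_has_ito_integral:
  assumes t: "0 \<le> t"
  shows "has_ito_integral M F W t (\<lambda>s \<omega>. K *v sol s \<omega>) (ito_part t)"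
proof -
  let ?k = "\<lambda>n. Suc (cell n t)" and ?u = "\<lambda>n. knots n t"
  have cont: "(\<lambda>v. K *v v) \<in> borel_measurable borel"
    by (intro borel_measurable_continuous_onI linear_continuous_on matrix_vector_mul_bounded_linear)
  have prog: "prog_measurable F (\<lambda>s \<omega>. K *v sol s \<omega>)"
    using sol_prog_measurable measurable_compose[OF _ cont] unfolding prog_measurable_def case_prod_unfold by blast
  have Ke: "adapted_sq (grid n i) (\<lambda>\<omega>. K *v euler n i \<omega>)" for n i by (rule adapted_sq_matrix[OF euler_adapted])
  have "\<exists>g. g \<in> borel_measurable (F (grid n i)) \<and> (\<exists>b. \<forall>\<omega>\<in>space M. norm (g \<omega>) \<le> b) \<and>
      ms (\<lambda>\<omega>. K *v euler n i \<omega> - g \<omega>) \<le> 1 / 2 ^ n" for n i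
    by (rule bounded_approximation[OF grid_nonneg Ke]) simp
  then have "\<forall>n i. \<exists>g. g \<in> borel_measurable (F (grid n i)) \<and> (\<exists>b. \<forall>\<omega>\<in>space M. norm (g \<omega>) \<le> b) \<and>
      ms (\<lambda>\<omega>. K *v euler n i \<omega> - g \<omega>) \<le> 1 / 2 ^ n" by blast
  then obtain \<xi> where \<xi>: "\<forall>n i. \<xi> n i \<in> borel_measurable (F (grid n i)) \<and> (\<exists>b. \<forall>\<omega>\<in>space M. norm (\<xi> n i \<omega>) \<le> b) \<and>
      ms (\<lambda>\<omega>. K *v euler n i \<omega> - \<xi> n i \<omega>) \<le> 1 / 2 ^ n"
    unfolding choice_iff by blast
  have simple: "simple_on F t (?k n) (?u n) (\<xi> n)" for n
    unfolding simple_on_def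
  proof (intro conjI allI impI)
    show "0 \<le> ?u n 0" using t by (simp add: knots_def)
    show "?u n (?k n) \<le> t" by (simp add: knots_def)
    fix i assume i: "i < ?k n"
    show "?u n i \<le> ?u n (Suc i)" using grid_mono[of i "Suc i" n] by (auto simp: knots_def)
    have "?u n i = grid n i" using knots_below[OF t, of i n] i by simp
    then show "\<xi> n i \<in> borel_measurable (F (?u n i))" "\<exists>b. \<forall>\<omega>\<in>space (F (?u n i)). norm (\<xi> n i \<omega>) \<le> b"
      using \<xi> space_F[OF grid_nonneg] by simp_all
  qed
  note sq = simple_on_simple_sq[OF simple]
  have Ksq: "simple_sq t (?k n) (?u n) (\<lambda>i \<omega>. K *v euler n i \<omega>)" for n
    using euler_simple[OF t, of n] unfolding simple_sq_def by (auto intro: adapted_sq_matrix)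
  have diff: "ms (\<lambda>\<omega>. simple_ito W (?k n) (?u n) (\<lambda>i \<omega>. K *v euler n i \<omega>) \<omega> - simple_ito W (?k n) (?u n) (\<xi> n) \<omega>) \<le> t / 2 ^ n" for n
  proof -
    let ?d = "\<lambda>i \<omega>. K *v euler n i \<omega> - \<xi> n i \<omega>"
    have dsq: "simple_sq t (?k n) (?u n) ?d"
      using Ksq[of n] sq[of n] unfolding simple_sq_def by (auto intro: adapted_sq_diff)
    have "simple_ito W (?k n) (?u n) (\<lambda>i \<omega>. K *v euler n i \<omega>) \<omega> - simple_ito W (?k n) (?u n) (\<xi> n) \<omega> = simple_ito W (?k n) (?u n) ?d \<omega>" for \<omega>
      unfolding simple_ito_def by (simp add: scaleR_diff_right sum_subtractf)
    then have "ms (\<lambda>\<omega>. simple_ito W (?k n) (?u n) (\<lambda>i \<omega>. K *v euler n i \<omega>) \<omega> - simple_ito W (?k n) (?u n) (\<xi> n) \<omega>)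
      = (\<Sum>i<?k n. (?u n (Suc i) - ?u n i) * ms (?d i))"
      using simple_ito_ms[OF dsq order_refl] by simp
    also have "\<dots> \<le> (\<Sum>i<?k n. (?u n (Suc i) - ?u n i) * (1 / 2 ^ n))"
      using simple_sqD(2)[OF dsq] \<xi> by (intro sum_mono mult_left_mono) auto
    also have "\<dots> = (\<Sum>i<?k n. ?u n (Suc i) - ?u n i) * (1 / 2 ^ n)" by (simp only: sum_distrib_right)
    also have "(\<Sum>i<?k n. ?u n (Suc i) - ?u n i) = ?u n (?k n) - ?u n 0" by (rule sum_lessThan_telescope)
    also have "\<dots> = t" using knots_last[OF t, of n] t by (simp add: knots_def)
    finally show ?thesis by simp
  qed
  show ?thesis
    unfolding has_ito_integral_def
  proof (intro conjI prog exI[of _ ?k] exI[of _ ?u] exI[of _ \<xi>] allI simple)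
    show "ito_part t \<in> borel_measurable M" by (rule sq_intD(1)[OF ito_part_sq_int[OF t]])
    let ?v = "\<lambda>n p. simple_val (?k n) (?u n) (\<xi> n) (fst p) (snd p)"
    let ?w = "\<lambda>n p. simple_val (?k n) (?u n) (\<lambda>i \<omega>. K *v euler n i \<omega>) (fst p) (snd p)"
    let ?y = "case_prod (\<lambda>s \<omega>. K *v sol s \<omega>)"
    have vsq: "sq_int (NT t) (?v n)" "sq_int (NT t) (?w n)" for n
      by (rule simple_val_sq_int[OF sq], rule simple_val_sq_int[OF Ksq])
    have ysq: "sq_int (NT t) ?y" by (rule sol_matrix_NT[OF t])
    have nn: "(\<integral>\<^sup>+\<omega>. (\<integral>\<^sup>+s\<in>{0..t}. ennreal ((norm (K *v sol s \<omega> - simple_val (?k n) (?u n) (\<xi> n) s \<omega>))\<^sup>2) \<partial>lborel) \<partial>M)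
        = ennreal (\<integral>p. (norm (?y p - ?v n p))\<^sup>2 \<partial>NT t)" for n
      using NT_norm_sq[of t "\<lambda>s \<omega>. K *v sol s \<omega> - simple_val (?k n) (?u n) (\<xi> n) s \<omega>"] sq_int_diff[OF ysq vsq(1)]
      by (simp add: case_prod_unfold)
    show "(\<lambda>n. \<integral>\<^sup>+\<omega>. (\<integral>\<^sup>+s\<in>{0..t}. ennreal ((norm (K *v sol s \<omega> - simple_val (?k n) (?u n) (\<xi> n) s \<omega>))\<^sup>2) \<partial>lborel) \<partial>M) \<longlonglongrightarrow> 0"
      unfolding nn
    proof (rule ennreal_tendsto_0_geometric)
      fix n
      have "(\<integral>p. (norm (?y p - ?v n p))\<^sup>2 \<partial>NT t) \<le> 2 * (\<integral>p. (norm (?y p - ?w n p))\<^sup>2 \<partial>NT t) + 2 * (\<integral>p. (norm (?w n p - ?v n p))\<^sup>2 \<partial>NT t)"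
        by (rule integral_norm_diff_sq_le[OF ysq vsq(2,1)])
      also have "(\<integral>p. (norm (?y p - ?w n p))\<^sup>2 \<partial>NT t) \<le> (onorm ((*v) K))\<^sup>2 * (t * c2 t / 2 ^ n)"
        using matrix_NT_diff[OF t, of K n] by (simp add: simple_val_matrix case_prod_unfold)
      also have "(\<integral>p. (norm (?w n p - ?v n p))\<^sup>2 \<partial>NT t) \<le> t / 2 ^ n"
        using diff[of n] unfolding simple_isometry_diff[OF Ksq sq] .
      finally show "(\<integral>p. (norm (?y p - ?v n p))\<^sup>2 \<partial>NT t) \<le> (2 * ((onorm ((*v) K))\<^sup>2 * (t * c2 t)) + 2 * t) / 2 ^ n"
        by (simp add: add_divide_distrib)
    qed simp
    define c where "c = 2 * c1 t + 2 * (t * ((onorm ((*v) B))\<^sup>2 * (t * c2 t)))"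
    have isq: "sq_int M (simple_ito W (?k n) (?u n) (\<xi> n))" "sq_int M (simple_ito W (?k n) (?u n) (\<lambda>i \<omega>. K *v euler n i \<omega>))" for n
      by (rule simple_ito_sq_int[OF sq], rule simple_ito_sq_int[OF Ksq])
    show "(\<lambda>n. \<integral>\<^sup>+\<omega>. ennreal ((norm (ito_part t \<omega> - simple_ito W (?k n) (?u n) (\<xi> n) \<omega>))\<^sup>2) \<partial>M) \<longlonglongrightarrow> 0"
      unfolding sq_int_nn_integral[OF sq_int_diff[OF ito_part_sq_int[OF t] isq(1)]]
    proof (rule ennreal_tendsto_0_geometric)
      fix n
      have "ms (\<lambda>\<omega>. ito_part t \<omega> - simple_ito W (?k n) (?u n) (\<xi> n) \<omega>)
        \<le> 2 * ms (\<lambda>\<omega>. ito_part t \<omega> - simple_ito W (?k n) (?u n) (\<lambda>i \<omega>. K *v euler n i \<omega>) \<omega>)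
          + 2 * ms (\<lambda>\<omega>. simple_ito W (?k n) (?u n) (\<lambda>i \<omega>. K *v euler n i \<omega>) \<omega> - simple_ito W (?k n) (?u n) (\<xi> n) \<omega>)"
        by (rule integral_norm_diff_sq_le[OF ito_part_sq_int[OF t] isq(2,1)])
      also have "\<dots> \<le> 2 * (c / 2 ^ n) + 2 * (t / 2 ^ n)"
        unfolding c_def by (intro add_mono mult_left_mono ito_part_approx[OF t] diff) simp_all
      finally show "ms (\<lambda>\<omega>. ito_part t \<omega> - simple_ito W (?k n) (?u n) (\<xi> n) \<omega>) \<le> (2 * c + 2 * t) / 2 ^ n"
        by (simp only: add_divide_distrib times_divide_eq_right)
    qed simp
  qed
qed

end

context brownian
begin

lemma NT_locally_square_integrable:
  assumes "\<And>T. 0 \<le> T \<Longrightarrow> sq_int (NT T) (case_prod Y)" shows "locally_square_integrable M Y"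
  unfolding locally_square_integrable_def by (simp add: NT_norm_sq assms)

text \<open>
  The limit of the Euler scheme for the drift matrix \<open>A + C K\<close>; the integral equation holds by the choice
  of \<open>ito_part\<close>.
\<close>
theorem closed_loop_solution_exists:
  fixes A C K :: "real^'n^'n"
  shows "\<exists>X. closed_loop_solution M F W A C K x X"
proof -
  interpret linear_sde M F W "A + C ** K" K x ..
  have cont: "(\<lambda>v. K *v v) \<in> borel_measurable borel"
    by (intro borel_measurable_continuous_onI linear_continuous_on matrix_vector_mul_bounded_linear)
  have prog: "prog_measurable F (\<lambda>s \<omega>. K *v sol s \<omega>)"
    using sol_prog_measurable measurable_compose[OF _ cont] unfolding prog_measurable_def case_prod_unfold by blast
  have drift: "A *v v + C *v (K *v v) = (A + C ** K) *v v" for v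
    by (simp add: matrix_vector_mult_add_rdistrib matrix_vector_mul_assoc)
  have "closed_loop_solution M F W A C K x sol"
    unfolding closed_loop_solution_def controlled_solution_def drift
  proof (intro conjI allI impI prog sol_prog_measurable NT_locally_square_integrable sol_NT sol_matrix_NT)
    show "AE \<omega> in M. continuous_on {0..} (\<lambda>t. sol t \<omega>)" using AE_sol by eventually_elim blast
    show "\<exists>I. has_ito_integral M F W t (\<lambda>t \<omega>. K *v sol t \<omega>) I \<and>
      (AE \<omega> in M. sol t \<omega> = x + (LINT s:{0..t}|lborel. (A + C ** K) *v sol s \<omega>) + I \<omega>)" if "0 \<le> t" for t
      by (intro exI[of _ "ito_part t"] conjI sol_has_ito_integral[OF that]) (simp add: ito_part_def)
  qed
  then show ?thesis by blast
qed

end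

section \<open>The equivalences\<close>

lemma (in brownian) stabilizable_iff_lyap_adj_pos:
  "stabilizable M F W A C \<longleftrightarrow> (\<exists>P. pos_def P \<and> pos_def (lyap_adj_op A C P))"
proof
  assume "stabilizable M F W A C"
  then obtain K where "L2_stable_closed_loop M F W A C K" unfolding stabilizable_def by blast
  then obtain P where "pos_def P" "pos_def (- lyap_adj_op (- (A + C ** K)) K P)"
    using lyap_if_stable by blast
  then obtain S where "pos_def S" "pos_def (- lyap_op (- (A + C ** K)) K S)"
    using lyap_dual by blast
  then show "\<exists>P. pos_def P \<and> pos_def (lyap_adj_op A C P)" by (rule lyap_adj_pos_if_feedback)
next
  assume "\<exists>P. pos_def P \<and> pos_def (lyap_adj_op A C P)"
  then obtain P where "pos_def P" "pos_def (lyap_adj_op A C P)" by blast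
  then obtain K S where KS: "pos_def S" "pos_def (- lyap_op (- (A + C ** K)) K S)"
    by (rule stabilizing_feedback)
  have "L2_stable_closed_loop M F W A C K"
    unfolding L2_stable_closed_loop_def
    using closed_loop_solution_exists sq_integrable_if_lyap[OF KS] by blast
  then show "stabilizable M F W A C" unfolding stabilizable_def by blast
qed

text \<open>
  An eigenvector with nonpositive eigenvalue is a forbidden \<open>S\<close>; conversely the Perron-Frobenius
  argument turns a forbidden \<open>S\<close> into such an eigenvector.
\<close>
lemma trivial_kernel_iff_eigenvalues_pos:
  "(\<forall>S. pos_semidef S \<and> pos_semidef (- lyap_op A C S) \<longrightarrow> S = 0) \<longleftrightarrow>
   (\<forall>H \<mu>. pos_semidef H \<and> H \<noteq> 0 \<and> lyap_op A C H = \<mu> *\<^sub>R H \<longrightarrow> 0 < \<mu>)"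
proof (intro iffI allI impI)
  fix H \<mu>
  assume triv: "\<forall>S. pos_semidef S \<and> pos_semidef (- lyap_op A C S) \<longrightarrow> S = 0"
    and H: "pos_semidef H \<and> H \<noteq> 0 \<and> lyap_op A C H = \<mu> *\<^sub>R H"
  show "0 < \<mu>"
  proof (rule ccontr)
    assume "\<not> 0 < \<mu>"
    then have "pos_semidef ((- \<mu>) *\<^sub>R H)" using H by (intro pos_semidef_scaleR) auto
    then have "pos_semidef (- lyap_op A C H)" using H by simp
    then show False using triv H by blast
  qed
next
  fix S
  assume eig: "\<forall>H \<mu>. pos_semidef H \<and> H \<noteq> 0 \<and> lyap_op A C H = \<mu> *\<^sub>R H \<longrightarrow> 0 < \<mu>"
    and S: "pos_semidef S \<and> pos_semidef (- lyap_op A C S)"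
  show "S = 0"
  proof (rule ccontr)
    assume "S \<noteq> 0"
    then obtain H \<mu> where "pos_semidef H" "H \<noteq> 0" "lyap_op A C H = \<mu> *\<^sub>R H" "\<mu> \<le> 0"
      using lyap_nonpos_eigenvalue S by blast
    then show False using eig by force
  qed
qed

theorem proposition4p4:
  fixes M :: "'a measure" and F :: "real \<Rightarrow> 'a measure" and W :: "real \<Rightarrow> 'a \<Rightarrow> real"
    and A C :: "real^'n^'n"
  assumes "std_brownian_motion M F W"
  shows
    "(stabilizable M F W A C
        \<longleftrightarrow> (\<exists>P. pos_def P \<and> loewner_less 0 (lyap_adj_op A C P))) \<and>
     ((\<exists>P. pos_def P \<and> loewner_less 0 (lyap_adj_op A C P))
        \<longleftrightarrow> (\<forall>S. pos_semidef S \<and> loewner_le (lyap_op A C S) 0 \<longrightarrow> S = 0)) \<and>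
     ((\<forall>S. pos_semidef S \<and> loewner_le (lyap_op A C S) 0 \<longrightarrow> S = 0)
        \<longleftrightarrow> (\<forall>H \<mu>. pos_semidef H \<and> H \<noteq> 0 \<and> lyap_op A C H = \<mu> *\<^sub>R H \<longrightarrow> 0 < \<mu>))"
proof -
  interpret brownian M F W by unfold_locales (rule assms)
  have "(\<exists>P. pos_def P \<and> pos_def (lyap_adj_op A C P)) \<longleftrightarrow>
      (\<forall>S. pos_semidef S \<and> pos_semidef (- lyap_op A C S) \<longrightarrow> S = 0)"
    using lyap_adj_pos_if_trivial_kernel trivial_kernel_if_lyap_adj_pos by blast
  moreover have "loewner_less 0 N \<longleftrightarrow> pos_def N" "loewner_le N 0 \<longleftrightarrow> pos_semidef (- N)" for N :: "real^'n^'n"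
    by (simp_all add: loewner_less_def loewner_le_def)
  ultimately show ?thesis
    using stabilizable_iff_lyap_adj_pos[of A C] trivial_kernel_iff_eigenvalues_pos[of A C] by simp
qed

end
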